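(* Let $(M=G/H,ds^2)$ be a connected pseudo-Riemannian $G$-geodesic orbit nilmanifold, where $G=N\rtimes H$ with $N$ nilpotent. Let $\mathfrak n$ be the Lie algebra of $N$, let $\langle\cdot,\cdot\rangle$ be the inner product on $\mathfrak n$ induced by $ds^2$, and let $\langle\cdot,\cdot\rangle'$ be the restriction of $\langle\cdot,\cdot\rangle$ to the derived algebra $[\mathfrak n,\mathfrak n]$. In each of the following cases, $N$ is either abelian or $2$-step nilpotent: (a) $\langle\cdot,\cdot\rangle'$ is of definite signature; (b) $\langle\cdot,\cdot\rangle'$ is of Lorentz signature and the centralizer of $[\mathfrak n,\mathfrak n]$ in $\mathfrak n$ is a nondegenerate subspace of $(\mathfrak n,\langle\cdot,\cdot\rangle)$; (c) both $\langle\cdot,\cdot\rangle$ and $\langle\cdot,\cdot\rangle'$ are of Lorentz signature.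
   Context: Setting. A pseudo-Riemannian nilmanifold is a pseudo-Riemannian manifold admitting a transitive nilpotent Lie group of isometries. Here $G\subset I(M,ds^2)$ is a Lie group of isometries of the form $G=N\rtimes H$, where $N$ is a nilpotent Lie group acting simply transitively on $M$ (so $M$ is identified with $N$ with a left-invariant pseudo-Riemannian metric) and $H$ is the isotropy subgroup at the base point, acting by isometric automorphisms of $N$. The Lie algebras are $\mathfrak g,\mathfrak h,\mathfrak n$, and $\mathfrak g=\mathfrak h\oplus\mathfrak n$ is a reductive decomposition (vector space direct sum with $[\mathfrak h,\mathfrak n]\subset\mathfrak n$). The space $\mathfrak n$ is identified with the tangent space of $M$ at the base point, so $ds^2$ induces a nondegenerate symmetric bilinear form ("inner product") $\langle\cdot,\cdot\rangle$ on $\mathfrak n$; $\mathfrak h$ acts on $\mathfrak n$ by skew-symmetric derivations. $G$-geodesic orbit. $(M=G/H,ds^2)$ is $G$-geodesic orbit ($G$-GO) if every geodesic of $M$ is, up to reparametrization, an orbit of a $1$-parameter subgroup of $G$. By the Geodesic Lemma this holds if and only if for every $T\in\mathfrak n$ there exist $A=A(T)\in\mathfrak h$ and $k=k(T)\in\mathbb R$ such that $\langle[T+A,T']_{\mathfrak n},T\rangle=k\langle T,T'\rangle$ for all $T'\in\mathfrak n$, where the subscript $\mathfrak n$ denotes the $\mathfrak n$-component in $\mathfrak g=\mathfrak h\oplus\mathfrak n$. Signature. Lorentz signature on a space of dimension $m$ means signature $(m-1,1)$ (exactly one negative direction, nondegenerate). A subspace is nondegenerate if the restriction of the inner product to it is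 nondegenerate. "$2$-step nilpotent" means $[\mathfrak n,[\mathfrak n,\mathfrak n]]=0$ and $[\mathfrak n,\mathfrak n]\neq0$. *)

theory Defs
  imports "HOL-Analysis.Analysis" "HOL-Algebra.Bij" "HOL-Algebra.Generated_Groups"
begin

section \<open>Smooth manifolds\<close>

text \<open>
  \<open>Ck k f S\<close> and \<open>smooth_on f S\<close> are only meant for open \<open>S\<close>: the derivatives are taken
  in the full space.
\<close>

primrec Ck :: "nat \<Rightarrow> ('a::euclidean_space \<Rightarrow> 'b::euclidean_space) \<Rightarrow> 'a set \<Rightarrow> bool" where
  "Ck 0 f S \<longleftrightarrow> continuous_on S f"
| "Ck (Suc k) f S \<longleftrightarrow> (\<forall>x\<in>S. f differentiable (at x)) \<and>
     (\<forall>v. Ck k (\<lambda>x. frechet_derivative f (at x) v) S)"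

definition smooth_on :: "('a::euclidean_space \<Rightarrow> 'b::euclidean_space) \<Rightarrow> 'a set \<Rightarrow> bool" where
  "smooth_on f S \<longleftrightarrow> (\<forall>k. Ck k f S)"

text \<open>
  A chart is a pair of its domain and its coordinate map; the latter is only relevant on the domain.
  The manifold is the whole type \<open>'m\<close>, whose topology is the manifold topology.
\<close>

type_synonym ('m, 'e) chart = "'m set \<times> ('m \<Rightarrow> 'e)"

definition is_chart :: "('m::topological_space, 'e::euclidean_space) chart \<Rightarrow> bool" where
  "is_chart c \<longleftrightarrow> open (fst c) \<and> open (snd c ` fst c) \<and>
     (\<exists>\<psi>. homeomorphism (fst c) (snd c ` fst c) (snd c) \<psi>)"

definition chart_inv :: "('m, 'e) chart \<Rightarrow> 'e \<Rightarrow> 'm" where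
  "chart_inv c = inv_into (fst c) (snd c)"

definition coord_map :: "('m, 'e) chart \<Rightarrow> ('n, 'f) chart \<Rightarrow> ('m \<Rightarrow> 'n) \<Rightarrow> 'e \<Rightarrow> 'f" where
  "coord_map c d F = (\<lambda>x. snd d (F (chart_inv c x)))"

definition smooth_map :: "('m::topological_space, 'e::euclidean_space) chart set \<Rightarrow>
    ('n::topological_space, 'f::euclidean_space) chart set \<Rightarrow> ('m \<Rightarrow> 'n) \<Rightarrow> bool" where
  "smooth_map A B F \<longleftrightarrow> continuous_on UNIV F \<and>
     (\<forall>c\<in>A. \<forall>d\<in>B. smooth_on (coord_map c d F) (snd c ` (fst c \<inter> F -` fst d)))"

text \<open>The last condition says that all transition maps are smooth.\<close>

definition smooth_atlas :: "('m::topological_space, 'e::euclidean_space) chart set \<Rightarrow> bool" where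
  "smooth_atlas A \<longleftrightarrow> (\<forall>c\<in>A. is_chart c) \<and> (\<Union>c\<in>A. fst c) = UNIV \<and> smooth_map A A id"

definition prod_atlas :: "('m, 'e) chart set \<Rightarrow> ('n, 'f) chart set \<Rightarrow> ('m \<times> 'n, 'e \<times> 'f) chart set"
  where "prod_atlas A B = {(fst c \<times> fst d, map_prod (snd c) (snd d)) | c d. c \<in> A \<and> d \<in> B}"

definition real_atlas :: "(real, real) chart set" where
  "real_atlas = {(UNIV, id)}"

text \<open>
  Tangent vectors at \<open>p\<close> are represented by their coordinates with respect to a chart around \<open>p\<close>.
  \<open>differential c d F p\<close> is the differential of \<open>F\<close> at \<open>p\<close> with respect to a chart \<open>c\<close> around \<open>p\<close>
  and a chart \<open>d\<close> around \<open>F p\<close>.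
\<close>

definition differential :: "('m, 'e::euclidean_space) chart \<Rightarrow> ('n, 'f::euclidean_space) chart \<Rightarrow>
    ('m \<Rightarrow> 'n) \<Rightarrow> 'm \<Rightarrow> 'e \<Rightarrow> 'f" where
  "differential c d F p = frechet_derivative (coord_map c d F) (at (snd c p))"


section \<open>Pseudo-Riemannian metrics, isometries and geodesics\<close>

text \<open>
  \<open>ds2 c p u v\<close> is the scalar product of the tangent vectors at \<open>p\<close> that have the coordinates
  \<open>u\<close> and \<open>v\<close> in the chart \<open>c\<close>. The inner product of the class \<open>euclidean_space\<close> plays no role.
\<close>

type_synonym ('m, 'e) metric = "('m, 'e) chart \<Rightarrow> 'm \<Rightarrow> 'e \<Rightarrow> 'e \<Rightarrow> real"

definition preserves_metric :: "('m, 'e::euclidean_space) chart set \<Rightarrow> ('m, 'e) metric \<Rightarrow>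
    ('m \<Rightarrow> 'm) \<Rightarrow> bool" where
  "preserves_metric A ds2 F \<longleftrightarrow> (\<forall>c\<in>A. \<forall>d\<in>A. \<forall>p. p \<in> fst c \<and> F p \<in> fst d \<longrightarrow>
     (\<forall>u v. ds2 d (F p) (differential c d F p u) (differential c d F p v) = ds2 c p u v))"

definition nondegenerate_on :: "('e::real_vector \<Rightarrow> 'e \<Rightarrow> real) \<Rightarrow> 'e set \<Rightarrow> bool" where
  "nondegenerate_on b S \<longleftrightarrow> (\<forall>x\<in>S. (\<forall>y\<in>S. b x y = 0) \<longrightarrow> x = 0)"

text \<open>For \<open>id\<close>, \<open>preserves_metric\<close> is the transformation law of a tensor under a change of charts.\<close>

definition pseudo_riemannian_metric :: "('m::topological_space, 'e::euclidean_space) chart set \<Rightarrow>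
    ('m, 'e) metric \<Rightarrow> bool" where
  "pseudo_riemannian_metric A ds2 \<longleftrightarrow>
     (\<forall>c\<in>A. \<forall>p\<in>fst c. bilinear (ds2 c p) \<and> (\<forall>u v. ds2 c p u v = ds2 c p v u) \<and>
        nondegenerate_on (ds2 c p) UNIV) \<and>
     (\<forall>c\<in>A. \<forall>u v. smooth_on (\<lambda>x. ds2 c (chart_inv c x) u v) (snd c ` fst c)) \<and>
     preserves_metric A ds2 id"

definition isometry :: "('m::topological_space, 'e::euclidean_space) chart set \<Rightarrow>
    ('m, 'e) metric \<Rightarrow> ('m \<Rightarrow> 'm) \<Rightarrow> bool" where
  "isometry A ds2 F \<longleftrightarrow>
     bij F \<and> smooth_map A A F \<and> smooth_map A A (inv_into UNIV F) \<and> preserves_metric A ds2 F"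

definition metric_deriv :: "('m, 'e::euclidean_space) metric \<Rightarrow> ('m, 'e) chart \<Rightarrow> 'm \<Rightarrow>
    'e \<Rightarrow> 'e \<Rightarrow> 'e \<Rightarrow> real" where
  "metric_deriv ds2 c p w u v =
     frechet_derivative (\<lambda>x. ds2 c (chart_inv c x) u v) (at (snd c p)) w"

text \<open>The Christoffel symbols of the first kind of the Levi-Civita connection.\<close>

definition christoffel :: "('m, 'e::euclidean_space) metric \<Rightarrow> ('m, 'e) chart \<Rightarrow> 'm \<Rightarrow>
    'e \<Rightarrow> 'e \<Rightarrow> 'e \<Rightarrow> real" where
  "christoffel ds2 c p u v w =
     (metric_deriv ds2 c p u v w + metric_deriv ds2 c p v u w - metric_deriv ds2 c p w u v) / 2"

definition velocity :: "('m, 'e::euclidean_space) chart \<Rightarrow> (real \<Rightarrow> 'm) \<Rightarrow> real \<Rightarrow> 'e" where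
  "velocity c \<gamma> t = vector_derivative (\<lambda>s. snd c (\<gamma> s)) (at t)"

definition acceleration :: "('m, 'e::euclidean_space) chart \<Rightarrow> (real \<Rightarrow> 'm) \<Rightarrow> real \<Rightarrow> 'e" where
  "acceleration c \<gamma> t = vector_derivative (velocity c \<gamma>) (at t)"

text \<open>
  The equation is \<open>\<langle>\<nabla>\<^bsub>\<gamma>'\<^esub> \<gamma>', w\<rangle> = 0\<close> in coordinates, that is, the usual geodesic equation with
  its free index lowered by the metric.
\<close>

definition geodesic :: "('m::topological_space, 'e::euclidean_space) chart set \<Rightarrow>
    ('m, 'e) metric \<Rightarrow> real set \<Rightarrow> (real \<Rightarrow> 'm) \<Rightarrow> bool" where
  "geodesic A ds2 J \<gamma> \<longleftrightarrow> open J \<and> is_interval J \<and> J \<noteq> {} \<and> continuous_on J \<gamma> \<and>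
     (\<forall>c\<in>A. \<forall>t\<in>J. \<gamma> t \<in> fst c \<longrightarrow>
        (\<lambda>s. snd c (\<gamma> s)) differentiable (at t) \<and> velocity c \<gamma> differentiable (at t) \<and>
        (\<forall>w. ds2 c (\<gamma> t) (acceleration c \<gamma> t) w +
             christoffel ds2 c (\<gamma> t) (velocity c \<gamma> t) (velocity c \<gamma> t) w = 0))"


section \<open>The geodesic orbit property\<close>

text \<open>
  Groups of isometries are given as sets of transformations. The one-parameter subgroups of a Lie
  group of isometries are the smooth one-parameter groups of transformations with values in it.
\<close>

definition one_param_subgroup :: "('m::topological_space, 'e::euclidean_space) chart set \<Rightarrow>
    ('m \<Rightarrow> 'm) set \<Rightarrow> (real \<Rightarrow> 'm \<Rightarrow> 'm) \<Rightarrow> bool" where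
  "one_param_subgroup A \<Gamma> \<sigma> \<longleftrightarrow> (\<forall>t. \<sigma> t \<in> \<Gamma>) \<and> \<sigma> 0 = id \<and> (\<forall>s t. \<sigma> (s + t) = \<sigma> s \<circ> \<sigma> t) \<and>
     smooth_map (prod_atlas real_atlas A) A (\<lambda>(t, p). \<sigma> t p)"

text \<open>
  The reparametrization is local, around each parameter \<open>s\<close> of the geodesic: a maximal null
  geodesic can properly contain the orbit that it traces out around \<open>\<gamma> s\<close> (whose parameter is then
  exponential in the affine one), and conversely a geodesic that is not maximal is only a piece of
  an orbit.
\<close>

definition geodesic_orbit :: "('m::topological_space, 'e::euclidean_space) chart set \<Rightarrow>
    ('m, 'e) metric \<Rightarrow> ('m \<Rightarrow> 'm) set \<Rightarrow> bool" where
  "geodesic_orbit A ds2 \<Gamma> \<longleftrightarrow> (\<forall>J \<gamma>. geodesic A ds2 J \<gamma> \<longrightarrow> (\<forall>s\<in>J.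
     \<exists>\<sigma> I \<phi>. one_param_subgroup A \<Gamma> \<sigma> \<and>
       open I \<and> is_interval I \<and> 0 \<in> I \<and>
       smooth_on \<phi> I \<and> (\<forall>t\<in>I. deriv \<phi> t \<noteq> 0) \<and> \<phi> 0 = s \<and> \<phi> ` I \<subseteq> J \<and>
       (\<forall>t\<in>I. \<gamma> (\<phi> t) = \<sigma> t (\<gamma> s))))"


section \<open>Lie groups\<close>

definition lie_group :: "'m::{t2_space, second_countable_topology} monoid \<Rightarrow>
    ('m, 'e::euclidean_space) chart set \<Rightarrow> bool" where
  "lie_group N A \<longleftrightarrow> group N \<and> carrier N = UNIV \<and> smooth_atlas A \<and>
     smooth_map (prod_atlas A A) A (\<lambda>(x, y). x \<otimes>\<^bsub>N\<^esub> y) \<and> smooth_map A A (\<lambda>x. inv\<^bsub>N\<^esub> x)"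

primrec lower_central :: "'m monoid \<Rightarrow> nat \<Rightarrow> 'm set" where
  "lower_central N 0 = carrier N"
| "lower_central N (Suc k) = generate N
     {x \<otimes>\<^bsub>N\<^esub> y \<otimes>\<^bsub>N\<^esub> inv\<^bsub>N\<^esub> x \<otimes>\<^bsub>N\<^esub> inv\<^bsub>N\<^esub> y | x y. x \<in> carrier N \<and> y \<in> lower_central N k}"

definition nilpotent_group :: "'m monoid \<Rightarrow> bool" where
  "nilpotent_group N \<longleftrightarrow> (\<exists>k. lower_central N k = {\<one>\<^bsub>N\<^esub>})"

definition left_invariant_metric :: "'m::topological_space monoid \<Rightarrow>
    ('m, 'e::euclidean_space) chart set \<Rightarrow> ('m, 'e) metric \<Rightarrow> bool" where
  "left_invariant_metric N A ds2 \<longleftrightarrow> (\<forall>a\<in>carrier N. isometry A ds2 (\<lambda>x. a \<otimes>\<^bsub>N\<^esub> x))"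

text \<open>
  The semidirect product of \<open>N\<close> with a group \<open>H\<close> of automorphisms, as a transformation group of
  \<open>N\<close>; \<open>N\<close> acts by left translations and \<open>H\<close> is the isotropy group at the unit element.
\<close>

definition semidirect :: "'m monoid \<Rightarrow> ('m \<Rightarrow> 'm) set \<Rightarrow> ('m \<Rightarrow> 'm) set" where
  "semidirect N H = {\<lambda>x. a \<otimes>\<^bsub>N\<^esub> h x | a h. a \<in> carrier N \<and> h \<in> H}"

text \<open>
  With respect to a chart \<open>c\<close> around the unit element, the tangent space there is the model space
  \<open>'e\<close>. \<open>left_invariant_field N c u\<close> is the coordinate expression of the left-invariant vector
  field with value \<open>u\<close> at the unit element, and the commutator of vector fields is
  \<open>[X, Y] = DY X - DX Y\<close> in coordinates.
\<close>

definition left_invariant_field :: "'m monoid \<Rightarrow> ('m, 'e::euclidean_space) chart \<Rightarrow> 'e \<Rightarrow> 'e \<Rightarrow> 'e"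
  where "left_invariant_field N c u x =
    differential c c (\<lambda>q. chart_inv c x \<otimes>\<^bsub>N\<^esub> q) \<one>\<^bsub>N\<^esub> u"

definition lie_bracket :: "'m monoid \<Rightarrow> ('m, 'e::euclidean_space) chart \<Rightarrow> 'e \<Rightarrow> 'e \<Rightarrow> 'e" where
  "lie_bracket N c u v =
     (let X = left_invariant_field N c u; Y = left_invariant_field N c v; x = snd c \<one>\<^bsub>N\<^esub>
      in frechet_derivative Y (at x) (X x) - frechet_derivative X (at x) (Y x))"


section \<open>Linear algebra of Lie algebras with an inner product\<close>

definition bracket_span :: "('e::real_vector \<Rightarrow> 'e \<Rightarrow> 'e) \<Rightarrow> 'e set \<Rightarrow> 'e set \<Rightarrow> 'e set" where
  "bracket_span br S T = span {br x y | x y. x \<in> S \<and> y \<in> T}"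

definition derived_algebra :: "('e::real_vector \<Rightarrow> 'e \<Rightarrow> 'e) \<Rightarrow> 'e set" where
  "derived_algebra br = bracket_span br UNIV UNIV"

definition centralizer_of :: "('e::real_vector \<Rightarrow> 'e \<Rightarrow> 'e) \<Rightarrow> 'e set \<Rightarrow> 'e set" where
  "centralizer_of br S = {x. \<forall>y\<in>S. br x y = 0}"

definition two_step_nilpotent :: "('e::real_vector \<Rightarrow> 'e \<Rightarrow> 'e) \<Rightarrow> bool" where
  "two_step_nilpotent br \<longleftrightarrow>
     bracket_span br UNIV (derived_algebra br) = {0} \<and> derived_algebra br \<noteq> {0}"

text \<open>
  The restriction of the symmetric bilinear form \<open>b\<close> to the subspace \<open>S\<close> is nondegenerate with
  \<open>p\<close> positive and \<open>q\<close> negative directions.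
\<close>

definition has_signature :: "('e::real_vector \<Rightarrow> 'e \<Rightarrow> real) \<Rightarrow> 'e set \<Rightarrow> nat \<Rightarrow> nat \<Rightarrow> bool" where
  "has_signature b S p q \<longleftrightarrow> (\<exists>P Q. finite P \<and> finite Q \<and> P \<inter> Q = {} \<and> card P = p \<and> card Q = q \<and>
     independent (P \<union> Q) \<and> span (P \<union> Q) = S \<and> pairwise (\<lambda>x y. b x y = 0) (P \<union> Q) \<and>
     (\<forall>x\<in>P. b x x > 0) \<and> (\<forall>x\<in>Q. b x x < 0))"

definition definite_on :: "('e::real_vector \<Rightarrow> 'e \<Rightarrow> real) \<Rightarrow> 'e set \<Rightarrow> bool" where
  "definite_on b S \<longleftrightarrow> has_signature b S (dim S) 0 \<or> has_signature b S 0 (dim S)"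

definition lorentzian_on :: "('e::real_vector \<Rightarrow> 'e \<Rightarrow> real) \<Rightarrow> 'e set \<Rightarrow> bool" where
  "lorentzian_on b S \<longleftrightarrow> has_signature b S (dim S - 1) 1"

end

theory Submission
  imports Defs
begin

text \<open>
  The second-order expansion of an orbit through the unit turns the geodesic orbit property into an
  algebraic condition: for every \<open>T\<close> there are a skew derivation \<open>D\<close> and a number \<open>k\<close> with
  \<open>\<langle>[T, w] + D w, T\<rangle> = k \<langle>T, w\<rangle>\<close> for all \<open>w\<close>. Let \<open>n\<close> be the Lie algebra and \<open>n' = [n, n]\<close>.
  For \<open>T = Y + Z\<close> with \<open>Y \<bottom> n'\<close> and \<open>Z \<in> n'\<close>, taking \<open>w = Z\<close> gives \<open>\<langle>[Y, Z], Z\<rangle> = 0\<close> when \<open>T\<close> is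
  not null and hence always. So \<open>n\<close> acts on \<open>n'\<close> by nilpotent skew operators, and these vanish if \<open>n'\<close>
  is definite.

  If \<open>n'\<close> is Lorentz and the action is nonzero, there is a null central vector \<open>e \<in> [n, n']\<close>, the
  action maps \<open>n' \<inter> e\<^sup>\<bottom>\<close> to the line of \<open>e\<close>, and \<open>[n', n'] = 0\<close>. Let \<open>u\<close> be the orthogonal complement
  of the centralizer of \<open>n'\<close>, which is nondegenerate (automatically so when \<open>n\<close> is Lorentz, since then
  the orthogonal complement of \<open>n'\<close> is definite). The geodesic orbit condition shows that \<open>u\<close> commutes
  with the part of the centralizer that is orthogonal to \<open>n'\<close>, hence \<open>[u, u]\<close> is not orthogonal to \<open>e\<close>.
  The Jacobi identity then forces \<open>u\<close> to be spanned by two vectors \<open>Y\<^sub>1\<close>, \<open>Y\<^sub>2\<close>. Applying the condition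
  to \<open>T = Y\<^sub>1 + F\<close> with \<open>F = [Y\<^sub>1, Y\<^sub>2]\<close> gives \<open>[Y\<^sub>1, F] \<in> \<real> F\<close>, so \<open>[Y\<^sub>1, F] = 0\<close> by nilpotency, which
  contradicts \<open>\<langle>F, e\<rangle> \<noteq> 0\<close>.
\<close>

section \<open>Twice differentiable functions\<close>

abbreviation fderiv :: "('a::real_normed_vector \<Rightarrow> 'b::real_normed_vector) \<Rightarrow> 'a \<Rightarrow> 'a \<Rightarrow> 'b"
  where "fderiv f x \<equiv> frechet_derivative f (at x)"

lemma fderiv_works: "f differentiable (at x) \<Longrightarrow> (f has_derivative fderiv f x) (at x)"
  by (simp add: frechet_derivative_works)

lemma fderiv_eqI: "(f has_derivative f') (at x) \<Longrightarrow> fderiv f x = f'"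
  by (metis frechet_derivative_at)

lemma has_derivative_cong_nhds:
  assumes "\<forall>\<^sub>F z in nhds x. f z = g z" and "(f has_derivative f') (at x)"
  shows "(g has_derivative f') (at x)"
proof (rule has_derivative_transform_eventually[OF assms(2)])
  show "\<forall>\<^sub>F z in at x. f z = g z"
    using assms(1) by (simp add: eventually_nhds_conv_at)
  show "f x = g x"
    using assms(1) by (rule eventually_nhds_x_imp_x)
qed simp

lemma differentiable_cong_nhds:
  assumes "\<forall>\<^sub>F z in nhds x. f z = g z" and "f differentiable (at x)"
  shows "g differentiable (at x)"
  using assms has_derivative_cong_nhds unfolding differentiable_def by blast

lemma fderiv_cong_nhds:
  assumes "\<forall>\<^sub>F z in nhds x. f z = g z"
  shows "fderiv f x = fderiv g x"
proof -
  have "\<forall>\<^sub>F z in nhds x. g z = f z"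
    using assms by (rule eventually_mono) simp
  then have "(f has_derivative f') (at x) \<longleftrightarrow> (g has_derivative f') (at x)" for f'
    using has_derivative_cong_nhds assms by blast
  then show ?thesis
    unfolding frechet_derivative_def by simp
qed

lemma eventually_nhds_compose:
  assumes "isCont g x" and "\<forall>\<^sub>F z in nhds (g x). P z"
  shows "\<forall>\<^sub>F z in nhds x. P (g z)"
proof -
  from assms(2) obtain S where "open S" "g x \<in> S" "\<forall>z\<in>S. P z"
    unfolding eventually_nhds by blast
  moreover have "\<forall>\<^sub>F z in nhds x. g z \<in> S"
    using assms(1) calculation(1,2) unfolding isCont_def tendsto_at_iff_tendsto_nhds
    by (rule topological_tendstoD)
  ultimately show ?thesis by (auto elim: eventually_mono)
qed

lemma has_derivative_apply_linear:
  fixes L :: "'x::real_normed_vector \<Rightarrow> 'e::euclidean_space \<Rightarrow> 'f::real_normed_vector"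
  assumes lin: "\<forall>\<^sub>F z in nhds x. linear (L z)"
    and L: "\<And>v. (\<lambda>z. L z v) differentiable (at x)"
    and g: "(g has_derivative g') (at x)"
  shows "((\<lambda>z. L z (g z)) has_derivative (\<lambda>h. fderiv (\<lambda>z. L z (g x)) x h + L x (g' h))) (at x)"
proof -
  have exp: "L z v = (\<Sum>b\<in>Basis. (v \<bullet> b) *\<^sub>R L z b)" if "linear (L z)" for z v
    using linear_sum[OF that, of "\<lambda>b. (v \<bullet> b) *\<^sub>R b" Basis]
    by (simp add: linear_scale[OF that] euclidean_representation)
  have linx: "linear (L x)" using lin by (rule eventually_nhds_x_imp_x)
  have 1: "((\<lambda>z. \<Sum>b\<in>Basis. (g z \<bullet> b) *\<^sub>R L z b) has_derivative
      (\<lambda>h. \<Sum>b\<in>Basis. (g x \<bullet> b) *\<^sub>R fderiv (\<lambda>z. L z b) x h + (g' h \<bullet> b) *\<^sub>R L x b)) (at x)"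
    by (intro has_derivative_sum has_derivative_scaleR has_derivative_inner_left g fderiv_works L)
  have 2: "((\<lambda>z. \<Sum>b\<in>Basis. (g x \<bullet> b) *\<^sub>R L z b) has_derivative
      (\<lambda>h. \<Sum>b\<in>Basis. (g x \<bullet> b) *\<^sub>R fderiv (\<lambda>z. L z b) x h)) (at x)"
    by (intro has_derivative_sum has_derivative_scaleR_right fderiv_works L)
  have "fderiv (\<lambda>z. L z (g x)) x = fderiv (\<lambda>z. \<Sum>b\<in>Basis. (g x \<bullet> b) *\<^sub>R L z b) x"
    by (rule fderiv_cong_nhds) (use lin exp in \<open>auto elim: eventually_mono\<close>)
  also have "\<dots> = (\<lambda>h. \<Sum>b\<in>Basis. (g x \<bullet> b) *\<^sub>R fderiv (\<lambda>z. L z b) x h)"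
    using 2 by (rule fderiv_eqI)
  finally have 3: "(\<lambda>h. fderiv (\<lambda>z. L z (g x)) x h + L x (g' h)) =
      (\<lambda>h. \<Sum>b\<in>Basis. (g x \<bullet> b) *\<^sub>R fderiv (\<lambda>z. L z b) x h + (g' h \<bullet> b) *\<^sub>R L x b)"
    by (simp add: sum.distrib exp[OF linx, of "g' _"])
  show ?thesis
    unfolding 3
  proof (rule has_derivative_cong_nhds[OF _ 1])
    show "\<forall>\<^sub>F z in nhds x. (\<Sum>b\<in>Basis. (g z \<bullet> b) *\<^sub>R L z b) = L z (g z)"
      using lin by (rule eventually_mono) (simp add: exp[symmetric])
  qed
qed

lemma linear_fderiv_param:
  fixes L :: "'x::real_normed_vector \<Rightarrow> 'e::real_normed_vector \<Rightarrow> 'f::real_normed_vector"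
  assumes lin: "\<forall>\<^sub>F z in nhds x. linear (L z)"
    and L: "\<And>v. (\<lambda>z. L z v) differentiable (at x)"
  shows "linear (\<lambda>v. fderiv (\<lambda>z. L z v) x h)"
proof (rule linearI)
  fix u v r
  have "fderiv (\<lambda>z. L z (u + v)) x = fderiv (\<lambda>z. L z u + L z v) x"
    by (rule fderiv_cong_nhds) (use lin in \<open>auto elim!: eventually_mono simp: linear_add\<close>)
  also have "\<dots> = (\<lambda>h. fderiv (\<lambda>z. L z u) x h + fderiv (\<lambda>z. L z v) x h)"
    by (rule fderiv_eqI) (intro has_derivative_add fderiv_works L)
  finally show "fderiv (\<lambda>z. L z (u + v)) x h = fderiv (\<lambda>z. L z u) x h + fderiv (\<lambda>z. L z v) x h"
    by simp
  have "fderiv (\<lambda>z. L z (r *\<^sub>R v)) x = fderiv (\<lambda>z. r *\<^sub>R L z v) x"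
    by (rule fderiv_cong_nhds) (use lin in \<open>auto elim!: eventually_mono simp: linear_scale\<close>)
  also have "\<dots> = (\<lambda>h. r *\<^sub>R fderiv (\<lambda>z. L z v) x h)"
    by (rule fderiv_eqI) (intro has_derivative_scaleR_right fderiv_works L)
  finally show "fderiv (\<lambda>z. L z (r *\<^sub>R v)) x h = r *\<^sub>R fderiv (\<lambda>z. L z v) x h"
    by simp
qed

definition twice_diff :: "('a::real_normed_vector \<Rightarrow> 'b::real_normed_vector) \<Rightarrow> 'a \<Rightarrow> bool" where
  "twice_diff f x \<longleftrightarrow> (\<forall>\<^sub>F z in nhds x. f differentiable (at z)) \<and>
     (\<forall>v. (\<lambda>z. fderiv f z v) differentiable (at x))"

abbreviation fderiv2 :: "('a::real_normed_vector \<Rightarrow> 'b::real_normed_vector) \<Rightarrow> 'a \<Rightarrow> 'a \<Rightarrow> 'a \<Rightarrow> 'b"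
  where "fderiv2 f x w v \<equiv> fderiv (\<lambda>z. fderiv f z v) x w"

lemma twice_diff_differentiable: "twice_diff f x \<Longrightarrow> f differentiable (at x)"
  unfolding twice_diff_def by (metis eventually_nhds_x_imp_x)

lemma twice_diff_isCont: "twice_diff f x \<Longrightarrow> isCont f x"
  using differentiable_imp_continuous_within twice_diff_differentiable by blast

lemma twice_diff_cong:
  assumes "\<forall>\<^sub>F z in nhds x. f z = g z" and "twice_diff f x"
  shows "twice_diff g x"
proof -
  have ev: "\<forall>\<^sub>F z in nhds x. \<forall>\<^sub>F y in nhds z. f y = g y"
    using assms(1) by (simp add: eventually_eventually)
  have "\<forall>\<^sub>F z in nhds x. g differentiable (at z)"
    using ev assms(2)[unfolded twice_diff_def, THEN conjunct1]
    by eventually_elim (rule differentiable_cong_nhds)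
  moreover have "(\<lambda>z. fderiv g z v) differentiable (at x)" for v
  proof (rule differentiable_cong_nhds)
    show "\<forall>\<^sub>F z in nhds x. fderiv f z v = fderiv g z v"
      using ev by eventually_elim (metis fderiv_cong_nhds)
    show "(\<lambda>z. fderiv f z v) differentiable (at x)"
      using assms(2) by (simp add: twice_diff_def)
  qed
  ultimately show ?thesis by (simp add: twice_diff_def)
qed

lemma linear_fderiv_near: "twice_diff f x \<Longrightarrow> \<forall>\<^sub>F z in nhds x. linear (fderiv f z)"
  unfolding twice_diff_def by (auto elim!: eventually_mono intro: linear_frechet_derivative)

lemma linear_fderiv: "twice_diff f x \<Longrightarrow> linear (fderiv f x)"
  using linear_fderiv_near eventually_nhds_x_imp_x by blast

lemma twice_diffI:
  assumes "\<forall>\<^sub>F z in nhds x. (f has_derivative f' z) (at z)"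
    and "\<And>v. (\<lambda>z. f' z v) differentiable (at x)"
  shows "twice_diff f x"
proof -
  have "\<forall>\<^sub>F z in nhds x. f' z v = fderiv f z v" for v
    using assms(1) by (rule eventually_mono) (simp add: fderiv_eqI)
  then have "(\<lambda>z. fderiv f z v) differentiable (at x)" for v
    using differentiable_cong_nhds[of "\<lambda>z. f' z v" "\<lambda>z. fderiv f z v" x] assms(2) by blast
  moreover have "\<forall>\<^sub>F z in nhds x. f differentiable (at z)"
    using assms(1) by (rule eventually_mono) (auto simp: differentiable_def)
  ultimately show ?thesis by (simp add: twice_diff_def)
qed

lemma twice_diff_compose:
  fixes f :: "'b::euclidean_space \<Rightarrow> 'c::real_normed_vector" and g :: "'a::real_normed_vector \<Rightarrow> 'b"
  assumes f: "twice_diff f (g x)" and g: "twice_diff g x"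
  shows "twice_diff (\<lambda>z. f (g z)) x"
proof (rule twice_diffI)
  have "\<forall>\<^sub>F z in nhds x. f differentiable (at (g z))"
    using eventually_nhds_compose[OF twice_diff_isCont[OF g]] f by (auto simp: twice_diff_def)
  moreover have "\<forall>\<^sub>F z in nhds x. g differentiable (at z)"
    using g by (simp add: twice_diff_def)
  ultimately show "\<forall>\<^sub>F z in nhds x. ((\<lambda>z. f (g z)) has_derivative (\<lambda>v. fderiv f (g z) (fderiv g z v))) (at z)"
  proof eventually_elim
    case (elim z)
    show ?case
      using diff_chain_at[OF fderiv_works[OF elim(2)] fderiv_works[OF elim(1)]] by (simp add: o_def)
  qed
  fix v
  have "((\<lambda>z. fderiv f (g z) (fderiv g z v)) has_derivative
     (\<lambda>h. fderiv (\<lambda>z. fderiv f (g z) (fderiv g x v)) x h + fderiv f (g x) (fderiv (\<lambda>z. fderiv g z v) x h))) (at x)"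
  proof (rule has_derivative_apply_linear)
    show "\<forall>\<^sub>F z in nhds x. linear (fderiv f (g z))"
      using eventually_nhds_compose[OF twice_diff_isCont[OF g]] linear_fderiv_near[OF f] by auto
    show "((\<lambda>z. fderiv g z v) has_derivative fderiv (\<lambda>z. fderiv g z v) x) (at x)"
      using g by (simp add: twice_diff_def fderiv_works)
    fix w
    show "(\<lambda>z. fderiv f (g z) w) differentiable (at x)"
      using differentiable_chain_at[of g x "\<lambda>y. fderiv f y w"] f g
      by (auto simp: twice_diff_def twice_diff_differentiable[OF g] o_def)
  qed
  then show "(\<lambda>z. fderiv f (g z) (fderiv g z v)) differentiable (at x)"
    by (auto simp: differentiable_def)
qed

lemma fderiv_compose:
  assumes "f differentiable (at (g x))" and "g differentiable (at x)"
  shows "fderiv (\<lambda>z. f (g z)) x v = fderiv f (g x) (fderiv g x v)"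
  using diff_chain_at[OF fderiv_works[OF assms(2)] fderiv_works[OF assms(1)]]
  by (simp add: o_def fderiv_eqI)

lemma twice_diff_const [simp]: "twice_diff (\<lambda>z. k) x"
  by (simp add: twice_diff_def)

lemma twice_diff_bounded_linear: "bounded_linear f \<Longrightarrow> twice_diff f x"
  by (rule twice_diffI[where f' = "\<lambda>z. f"]) (auto intro!: always_eventually bounded_linear_imp_has_derivative)

lemma twice_diff_id [simp]: "twice_diff (\<lambda>z. z) x"
  by (rule twice_diff_bounded_linear) (rule bounded_linear_ident)

lemma twice_diff_fst [simp]: "twice_diff fst x"
  by (rule twice_diff_bounded_linear) (rule bounded_linear_fst)

lemma twice_diff_snd [simp]: "twice_diff snd x"
  by (rule twice_diff_bounded_linear) (rule bounded_linear_snd)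

lemma twice_diff_bilinear:
  assumes "bounded_bilinear p" and f: "twice_diff f x" and g: "twice_diff g x"
  shows "twice_diff (\<lambda>z. p (f z) (g z)) x"
proof (rule twice_diffI)
  interpret bounded_bilinear p by fact
  show "\<forall>\<^sub>F z in nhds x. ((\<lambda>z. p (f z) (g z)) has_derivative
      (\<lambda>v. p (f z) (fderiv g z v) + p (fderiv f z v) (g z))) (at z)"
    using f[unfolded twice_diff_def, THEN conjunct1] g[unfolded twice_diff_def, THEN conjunct1]
    by eventually_elim (intro FDERIV fderiv_works)
  fix v
  have "(\<lambda>z. fderiv f z v) differentiable (at x)" "(\<lambda>z. fderiv g z v) differentiable (at x)"
    using f g by (auto simp: twice_diff_def)
  then show "(\<lambda>z. p (f z) (fderiv g z v) + p (fderiv f z v) (g z)) differentiable (at x)"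
    using twice_diff_differentiable[OF f] twice_diff_differentiable[OF g]
    by (intro differentiable_add) (rule differentiableI, rule FDERIV, (rule fderiv_works, assumption)+)+
qed

lemma twice_diff_add:
  assumes f: "twice_diff f x" and g: "twice_diff g x"
  shows "twice_diff (\<lambda>z. f z + g z) x"
proof (rule twice_diffI)
  show "\<forall>\<^sub>F z in nhds x. ((\<lambda>z. f z + g z) has_derivative (\<lambda>v. fderiv f z v + fderiv g z v)) (at z)"
    using f[unfolded twice_diff_def, THEN conjunct1] g[unfolded twice_diff_def, THEN conjunct1]
    by eventually_elim (intro has_derivative_add fderiv_works)
  show "(\<lambda>z. fderiv f z v + fderiv g z v) differentiable (at x)" for v
    using f g by (auto simp: twice_diff_def)
qed

lemma twice_diff_sum:
  assumes "finite I" "\<And>i. i \<in> I \<Longrightarrow> twice_diff (f i) x"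
  shows "twice_diff (\<lambda>z. \<Sum>i\<in>I. f i z) x"
  using assms by (induction I rule: finite_induct) (auto intro: twice_diff_add)

lemma twice_diff_Pair:
  fixes f :: "'a::real_normed_vector \<Rightarrow> 'b::real_normed_vector" and g :: "'a \<Rightarrow> 'c::real_normed_vector"
  assumes f: "twice_diff f x" and g: "twice_diff g x"
  shows "twice_diff (\<lambda>z. (f z, g z)) x"
proof (rule twice_diffI)
  show "\<forall>\<^sub>F z in nhds x. ((\<lambda>z. (f z, g z)) has_derivative (\<lambda>v. (fderiv f z v, fderiv g z v))) (at z)"
    using f[unfolded twice_diff_def, THEN conjunct1] g[unfolded twice_diff_def, THEN conjunct1]
    by eventually_elim (intro has_derivative_Pair fderiv_works)
  show "(\<lambda>z. (fderiv f z v, fderiv g z v)) differentiable (at x)" for v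
    using f g has_derivative_Pair[OF fderiv_works fderiv_works]
    by (auto simp: twice_diff_def intro: differentiableI)
qed

lemma fderiv_Pair:
  assumes "f differentiable (at x)" "g differentiable (at x)"
  shows "fderiv (\<lambda>z. (f z, g z)) x v = (fderiv f x v, fderiv g x v)"
  using assms by (subst fderiv_eqI[OF has_derivative_Pair[OF fderiv_works fderiv_works]]) auto

lemma twice_diff_scaleR_const: "twice_diff f x \<Longrightarrow> twice_diff (\<lambda>z. f z *\<^sub>R k) x"
  by (rule twice_diff_bilinear[OF bounded_bilinear_scaleR]) auto

lemma fderiv_inner:
  assumes "f differentiable (at x)"
  shows "fderiv (\<lambda>z. f z \<bullet> b) x v = fderiv f x v \<bullet> b"
  using fderiv_eqI[OF has_derivative_inner_left[OF fderiv_works[OF assms]]] by simp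

lemma fderiv_bilinear:
  fixes \<beta> :: "'b::euclidean_space \<Rightarrow> 'c::euclidean_space \<Rightarrow> 'd::real_normed_vector"
  assumes "bilinear \<beta>" "f differentiable (at x)" "g differentiable (at x)"
  shows "fderiv (\<lambda>z. \<beta> (f z) (g z)) x h = \<beta> (f x) (fderiv g x h) + \<beta> (fderiv f x h) (g x)"
proof -
  interpret bounded_bilinear \<beta> using assms(1) by (simp add: bilinear_conv_bounded_bilinear)
  show ?thesis
    using FDERIV[OF fderiv_works[OF assms(2)] fderiv_works[OF assms(3)]] by (simp add: fderiv_eqI)
qed

lemma second_difference_quotient:
  fixes f :: "'a::real_normed_vector \<Rightarrow> real"
  assumes f: "twice_diff f x"
  shows "((\<lambda>t. (f (x + t *\<^sub>R v + t *\<^sub>R w) - f (x + t *\<^sub>R v) - f (x + t *\<^sub>R w) + f x) / t\<^sup>2)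
    \<longlongrightarrow> fderiv2 f x w v) (at_right 0)"
proof (rule tendstoI)
  fix e :: real assume e: "e > 0"
  let ?L = "fderiv (\<lambda>z. fderiv f z v) x"
  have derL: "((\<lambda>z. fderiv f z v) has_derivative ?L) (at x)"
    using f by (simp add: twice_diff_def fderiv_works)
  then have linL: "linear ?L" by (rule has_derivative_linear)
  define K where "K = norm v + norm w + 1"
  have K: "K > 0" unfolding K_def by (simp add: add_nonneg_pos)
  define e' where "e' = e / (4 * K)"
  have e': "e' > 0" using e K by (simp add: e'_def)
  obtain d1 where d1: "d1 > 0"
    "\<And>y. norm (y - x) < d1 \<Longrightarrow> norm (fderiv f y v - fderiv f x v - ?L (y - x)) \<le> e' * norm (y - x)"
    using derL[unfolded has_derivative_at_alt] e' by blast
  obtain d2 where d2: "d2 > 0" "\<And>y. dist y x < d2 \<Longrightarrow> f differentiable (at y)"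
    using f unfolding twice_diff_def eventually_nhds_metric by blast
  define d where "d = min d1 d2 / K"
  have d: "d > 0" using d1 d2 K by (simp add: d_def)
  have main: "dist ((f (x + t *\<^sub>R v + t *\<^sub>R w) - f (x + t *\<^sub>R v) - f (x + t *\<^sub>R w) + f x) / t\<^sup>2) (?L w) < e"
    if t: "t \<in> {0<..<d}" for t
  proof -
    have tpos: "t > 0" and tK: "t * K < min d1 d2"
      using t K by (auto simp: d_def field_simps)
    have nb1: "norm (s *\<^sub>R v + t *\<^sub>R w) \<le> t * K" "norm (s *\<^sub>R v) \<le> t * K" if "0 \<le> s" "s \<le> t" for s
    proof -
      have 1: "s * norm v \<le> t * norm v" using that by (simp add: mult_right_mono)
      have "norm (s *\<^sub>R v + t *\<^sub>R w) \<le> s * norm v + t * norm w"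
        using norm_triangle_ineq[of "s *\<^sub>R v" "t *\<^sub>R w"] that tpos by simp
      then show "norm (s *\<^sub>R v + t *\<^sub>R w) \<le> t * K"
        using 1 tpos unfolding K_def distrib_left by (auto simp: mult.commute)
      have "t * norm w \<ge> 0" using tpos by simp
      then show "norm (s *\<^sub>R v) \<le> t * K"
        using 1 that tpos unfolding K_def distrib_left norm_scaleR by linarith
    qed
    define g where "g s = f (x + (s *\<^sub>R v + t *\<^sub>R w)) - f (x + s *\<^sub>R v)" for s
    have "(g has_derivative (\<lambda>h. h * (fderiv f (x + (s *\<^sub>R v + t *\<^sub>R w)) v - fderiv f (x + s *\<^sub>R v) v))) (at s)"
      if "0 \<le> s" "s \<le> t" for s
    proof -
      have D: "f differentiable (at (x + (s *\<^sub>R v + t *\<^sub>R w)))" "f differentiable (at (x + s *\<^sub>R v))"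
        using nb1[OF that] tK by (auto intro!: d2(2) simp: dist_norm)
      note D' = D[THEN linear_frechet_derivative]
      have "((\<lambda>s. x + (s *\<^sub>R v + t *\<^sub>R w)) has_derivative (\<lambda>h. h *\<^sub>R v)) (at s)"
        "((\<lambda>s. x + s *\<^sub>R v) has_derivative (\<lambda>h. h *\<^sub>R v)) (at s)"
        by (auto intro!: derivative_eq_intros)
      note diff_chain_at[OF this(1) fderiv_works[OF D(1)]] diff_chain_at[OF this(2) fderiv_works[OF D(2)]]
      from has_derivative_diff[OF this] show ?thesis
        unfolding g_def o_def
        by (simp add: linear_scale[OF D'(1)] linear_scale[OF D'(2)] right_diff_distrib)
    qed
    then have "(g has_derivative (\<lambda>h. h * (fderiv f (x + (s *\<^sub>R v + t *\<^sub>R w)) v - fderiv f (x + s *\<^sub>R v) v))) (at s within {0..t})"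
      if "0 \<le> s" "s \<le> t" for s
      using that has_derivative_at_withinI by blast
    from mvt_simple[OF tpos, of g, OF this] obtain s where s: "s \<in> {0<..<t}"
      and gs: "g t - g 0 = t * (fderiv f (x + (s *\<^sub>R v + t *\<^sub>R w)) v - fderiv f (x + s *\<^sub>R v) v)"
      by auto
    define A B where "A = fderiv f (x + (s *\<^sub>R v + t *\<^sub>R w)) v" and "B = fderiv f (x + s *\<^sub>R v) v"
    have s': "0 \<le> s" "s \<le> t" using s by auto
    have nA: "norm (A - fderiv f x v - ?L (s *\<^sub>R v + t *\<^sub>R w)) \<le> e' * (t * K)"
    proof -
      have "norm (A - fderiv f x v - ?L (s *\<^sub>R v + t *\<^sub>R w)) \<le> e' * norm (s *\<^sub>R v + t *\<^sub>R w)"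
        using d1(2)[of "x + (s *\<^sub>R v + t *\<^sub>R w)"] nb1(1)[OF s'] tK by (simp add: A_def)
      also have "\<dots> \<le> e' * (t * K)"
        using nb1(1)[OF s'] e' by (intro mult_left_mono) auto
      finally show ?thesis .
    qed
    have nB: "norm (B - fderiv f x v - ?L (s *\<^sub>R v)) \<le> e' * (t * K)"
    proof -
      have "norm (B - fderiv f x v - ?L (s *\<^sub>R v)) \<le> e' * norm (s *\<^sub>R v)"
        using d1(2)[of "x + s *\<^sub>R v"] nb1(2)[OF s'] tK by (simp add: B_def)
      also have "\<dots> \<le> e' * (t * K)"
        using nb1(2)[OF s'] e' by (intro mult_left_mono) auto
      finally show ?thesis .
    qed
    have "A - B - t * ?L w = (A - fderiv f x v - ?L (s *\<^sub>R v + t *\<^sub>R w)) - (B - fderiv f x v - ?L (s *\<^sub>R v))"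
      by (simp add: linear_add[OF linL] linear_scale[OF linL])
    then have "\<bar>A - B - t * ?L w\<bar> \<le> 2 * (e' * (t * K))"
      using nA nB by simp
    also have "\<dots> = t * (e / 2)" using K by (simp add: e'_def)
    also have "\<dots> < t * e" using tpos e by simp
    finally have AB: "\<bar>(A - B) - t * ?L w\<bar> < t * e" .
    have eq: "f (x + t *\<^sub>R v + t *\<^sub>R w) - f (x + t *\<^sub>R v) - f (x + t *\<^sub>R w) + f x = t * (A - B)"
      using gs by (simp add: g_def A_def B_def add.assoc)
    have "t * (A - B) / t\<^sup>2 - ?L w = ((A - B) - t * ?L w) / t"
      using tpos by (simp add: field_simps power2_eq_square)
    then have "\<bar>t * (A - B) / t\<^sup>2 - ?L w\<bar> = \<bar>(A - B) - t * ?L w\<bar> / t"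
      using tpos by (simp only: abs_divide abs_of_pos)
    also have "\<dots> < e"
      using AB tpos by (simp only: pos_divide_less_eq mult.commute)
    finally show ?thesis
      unfolding eq dist_real_def .
  qed
  show "\<forall>\<^sub>F t in at_right 0. dist ((f (x + t *\<^sub>R v + t *\<^sub>R w) - f (x + t *\<^sub>R v) - f (x + t *\<^sub>R w) + f x) / t\<^sup>2) (?L w) < e"
    unfolding eventually_at_right_field using d main by auto
qed

lemma fderiv2_symmetric:
  fixes f :: "'a::real_normed_vector \<Rightarrow> 'b::euclidean_space"
  assumes f: "twice_diff f x"
  shows "fderiv2 f x w v = fderiv2 f x v w"
proof (rule euclidean_eqI)
  fix b :: 'b assume "b \<in> Basis"
  have td: "twice_diff (\<lambda>z. f z \<bullet> b) x"
    by (rule twice_diff_bilinear[OF bounded_bilinear_inner]) (use f in auto)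
  have comp: "fderiv2 (\<lambda>z. f z \<bullet> b) x w v = fderiv2 f x w v \<bullet> b" for w v
  proof -
    have "fderiv (\<lambda>z. fderiv (\<lambda>z. f z \<bullet> b) z v) x = fderiv (\<lambda>z. fderiv f z v \<bullet> b) x"
      by (rule fderiv_cong_nhds)
        (use f in \<open>auto simp: twice_diff_def fderiv_inner elim: eventually_mono\<close>)
    then show ?thesis
      using f by (simp add: fderiv_inner twice_diff_def)
  qed
  have "(\<lambda>t. (f (x + t *\<^sub>R v + t *\<^sub>R w) \<bullet> b - f (x + t *\<^sub>R v) \<bullet> b - f (x + t *\<^sub>R w) \<bullet> b + f x \<bullet> b) / t\<^sup>2)
    = (\<lambda>t. (f (x + t *\<^sub>R w + t *\<^sub>R v) \<bullet> b - f (x + t *\<^sub>R w) \<bullet> b - f (x + t *\<^sub>R v) \<bullet> b + f x \<bullet> b) / t\<^sup>2)"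
    by (simp add: algebra_simps)
  with second_difference_quotient[OF td, of v w] second_difference_quotient[OF td, of w v]
  have "fderiv2 (\<lambda>z. f z \<bullet> b) x w v = fderiv2 (\<lambda>z. f z \<bullet> b) x v w"
    by (intro tendsto_unique[of "at_right (0::real)"]) auto
  then show "fderiv2 f x w v \<bullet> b = fderiv2 f x v w \<bullet> b"
    by (simp add: comp)
qed

lemma fderiv_linear_compose:
  fixes T :: "'b::euclidean_space \<Rightarrow> 'c::real_normed_vector"
  assumes "linear T" "f differentiable (at x)"
  shows "(\<lambda>z. T (f z)) differentiable (at x)" "fderiv (\<lambda>z. T (f z)) x v = T (fderiv f x v)"
proof -
  have "((\<lambda>z. T (f z)) has_derivative (\<lambda>v. T (fderiv f x v))) (at x)"
    using assms bounded_linear.has_derivative fderiv_works linear_conv_bounded_linear by blast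
  then show "(\<lambda>z. T (f z)) differentiable (at x)" "fderiv (\<lambda>z. T (f z)) x v = T (fderiv f x v)"
    by (auto simp: differentiable_def fderiv_eqI)
qed

lemma fderiv_in_subspace:
  fixes g :: "'a::real_normed_vector \<Rightarrow> 'b::euclidean_space"
  assumes S: "subspace S" and g: "g differentiable (at x)" and ev: "\<forall>\<^sub>F z in nhds x. g z \<in> S"
  shows "fderiv g x h \<in> S"
proof -
  have "y \<bullet> fderiv g x h = 0" if y: "y \<in> orthogonal_comp S" for y
  proof -
    have "\<forall>\<^sub>F z in nhds x. g z \<bullet> y = 0"
      using ev by (rule eventually_mono)
        (use y in \<open>auto simp: orthogonal_comp_def orthogonal_def inner_commute\<close>)
    then have "fderiv (\<lambda>z. g z \<bullet> y) x h = 0"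
      by (simp add: fderiv_cong_nhds[of "\<lambda>z. g z \<bullet> y" "\<lambda>z. 0"])
    then show ?thesis using fderiv_inner[OF g] by (simp add: inner_commute)
  qed
  then have "fderiv g x h \<in> orthogonal_comp (orthogonal_comp S)"
    by (auto simp: orthogonal_comp_def orthogonal_def inner_commute)
  then show ?thesis by (simp add: orthogonal_comp_self[OF S])
qed

lemma fderiv2_compose:
  fixes f :: "'b::euclidean_space \<Rightarrow> 'c::real_normed_vector" and g :: "'a::real_normed_vector \<Rightarrow> 'b"
  assumes f: "twice_diff f (g x)" and g: "twice_diff g x"
  shows "fderiv2 (\<lambda>z. f (g z)) x w v =
    fderiv2 f (g x) (fderiv g x w) (fderiv g x v) + fderiv f (g x) (fderiv2 g x w v)"
proof -
  have "\<forall>\<^sub>F z in nhds x. f differentiable (at (g z))"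
    using eventually_nhds_compose[OF twice_diff_isCont[OF g]] f by (auto simp: twice_diff_def)
  moreover have "\<forall>\<^sub>F z in nhds x. g differentiable (at z)"
    using g by (simp add: twice_diff_def)
  ultimately have "\<forall>\<^sub>F z in nhds x. fderiv (\<lambda>z. f (g z)) z v = fderiv f (g z) (fderiv g z v)"
    by eventually_elim (rule fderiv_compose)
  note eq = fderiv_cong_nhds[OF this]
  have df: "(\<lambda>y. fderiv f y u) differentiable (at (g x))" for u
    using f unfolding twice_diff_def by blast
  have comp: "fderiv (\<lambda>z. fderiv f (g z) u) x h = fderiv2 f (g x) (fderiv g x h) u"
    and dcomp: "(\<lambda>z. fderiv f (g z) u) differentiable (at x)" for u h
    using fderiv_compose[of "\<lambda>y. fderiv f y u" g x h, OF df twice_diff_differentiable[OF g]]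
      differentiable_chain_at[OF twice_diff_differentiable[OF g] df[of u]]
    by (simp_all add: o_def)
  have dg: "((\<lambda>z. fderiv g z v) has_derivative fderiv (\<lambda>z. fderiv g z v) x) (at x)"
    using g unfolding twice_diff_def by (intro fderiv_works) blast
  have "((\<lambda>z. fderiv f (g z) (fderiv g z v)) has_derivative
     (\<lambda>h. fderiv (\<lambda>z. fderiv f (g z) (fderiv g x v)) x h + fderiv f (g x) (fderiv (\<lambda>z. fderiv g z v) x h))) (at x)"
    by (rule has_derivative_apply_linear[OF
        eventually_nhds_compose[OF twice_diff_isCont[OF g] linear_fderiv_near[OF f]] dcomp dg])
  then show ?thesis
    unfolding eq by (simp add: fderiv_eqI comp)
qed

lemma has_derivative_bilinear_family:
  fixes \<beta> :: "'x::real_normed_vector \<Rightarrow> 'e::euclidean_space \<Rightarrow> 'e \<Rightarrow> real"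
  assumes bil: "\<forall>\<^sub>F z in nhds x. bilinear (\<beta> z)"
    and d: "\<And>u v. (\<lambda>z. \<beta> z u v) differentiable (at x)"
    and a: "(a has_derivative a') (at x)" and b: "(b has_derivative b') (at x)"
  shows "((\<lambda>z. \<beta> z (a z) (b z)) has_derivative
    (\<lambda>h. fderiv (\<lambda>z. \<beta> z (a x) (b x)) x h + \<beta> x (a' h) (b x) + \<beta> x (a x) (b' h))) (at x)"
proof -
  have 1: "((\<lambda>z. \<beta> z (a z) v) has_derivative
      (\<lambda>h. fderiv (\<lambda>z. \<beta> z (a x) v) x h + \<beta> x (a' h) v)) (at x)" for v
    by (rule has_derivative_apply_linear[where L = "\<lambda>z u. \<beta> z u v", OF _ d a])
      (use bil in \<open>auto simp: bilinear_def elim: eventually_mono\<close>)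
  have "((\<lambda>z. \<beta> z (a z) (b z)) has_derivative
      (\<lambda>h. fderiv (\<lambda>z. \<beta> z (a z) (b x)) x h + \<beta> x (a x) (b' h))) (at x)"
    by (rule has_derivative_apply_linear[where L = "\<lambda>z. \<beta> z (a z)", OF _ _ b])
      (use bil 1 in \<open>auto simp: bilinear_def differentiable_def elim: eventually_mono\<close>)
  then show ?thesis by (simp add: fderiv_eqI[OF 1])
qed

lemma fderiv_real: "f differentiable (at t) \<Longrightarrow> fderiv f t h = h *\<^sub>R vector_derivative f (at t)"
  by (simp add: frechet_derivative_eq_vector_derivative)

lemma smooth_on_differentiable: "smooth_on f S \<Longrightarrow> x \<in> S \<Longrightarrow> f differentiable (at x)"
  using Ck.simps(2) smooth_on_def by blast

lemma smooth_on_fderiv: "smooth_on f S \<Longrightarrow> smooth_on (\<lambda>x. fderiv f x v) S"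
  unfolding smooth_on_def using Ck.simps(2) by blast

lemma smooth_on_twice_diff:
  assumes "smooth_on f S" "open S" "x \<in> S"
  shows "twice_diff f x"
  unfolding twice_diff_def
  using assms smooth_on_differentiable smooth_on_fderiv eventually_nhds by blast

lemma twice_diff_locally_lipschitz:
  fixes f :: "'a::euclidean_space \<Rightarrow> 'b::real_normed_vector"
  assumes "open S" "z0 \<in> S" and f: "\<And>z. z \<in> S \<Longrightarrow> twice_diff f z"
  obtains r L where "r > 0" "L \<ge> 0" "cball z0 r \<subseteq> S"
    "\<And>x y. x \<in> cball z0 r \<Longrightarrow> y \<in> cball z0 r \<Longrightarrow> norm (f x - f y) \<le> L * norm (x - y)"
proof -
  obtain r where r: "r > 0" "cball z0 r \<subseteq> S"
    using assms open_contains_cball by blast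
  have "continuous_on (cball z0 r) (\<lambda>z. \<Sum>b\<in>Basis. norm (fderiv f z b))"
    using f r
    by (intro continuous_intros continuous_at_imp_continuous_on ballI
        differentiable_imp_continuous_within) (auto simp: twice_diff_def)
  then have "bounded ((\<lambda>z. \<Sum>b\<in>Basis. norm (fderiv f z b)) ` cball z0 r)"
    by (intro compact_imp_bounded compact_continuous_image) auto
  then obtain L where "\<forall>y\<in>(\<lambda>z. \<Sum>b\<in>Basis. norm (fderiv f z b)) ` cball z0 r. norm y \<le> L"
    unfolding bounded_iff by blast
  then have L: "(\<Sum>b\<in>Basis. norm (fderiv f z b)) \<le> L" if "z \<in> cball z0 r" for z
    using that by (auto simp: sum_nonneg)
  have "onorm (fderiv f z) \<le> L" if "z \<in> cball z0 r" for z
  proof (rule onorm_le)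
    fix h
    have lin: "linear (fderiv f z)"
      using f r that linear_fderiv by blast
    have "fderiv f z h = (\<Sum>b\<in>Basis. (h \<bullet> b) *\<^sub>R fderiv f z b)"
      using linear_sum[OF lin, of "\<lambda>b. (h \<bullet> b) *\<^sub>R b" Basis]
      by (simp add: linear_scale[OF lin] euclidean_representation)
    also have "norm \<dots> \<le> (\<Sum>b\<in>Basis. norm h * norm (fderiv f z b))"
      by (rule sum_norm_le) (simp add: Basis_le_norm mult_right_mono)
    also have "\<dots> = norm h * (\<Sum>b\<in>Basis. norm (fderiv f z b))"
      by (simp add: sum_distrib_left)
    also have "\<dots> \<le> L * norm h"
      by (subst mult.commute) (rule mult_right_mono[OF L[OF that]], simp)
    finally show "norm (fderiv f z h) \<le> L * norm h" .
  qed
  then have "norm (f x - f y) \<le> L * norm (x - y)" if "x \<in> cball z0 r" "y \<in> cball z0 r" for x y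
    using that f r
    by (intro differentiable_bound[of "cball z0 r" f "fderiv f"])
      (auto intro!: has_derivative_at_withinI fderiv_works twice_diff_differentiable)
  moreover have "0 \<le> L"
    using L[of z0] r(1) sum_nonneg[of Basis "\<lambda>b. norm (fderiv f z0 b)"] by simp
  ultimately show thesis using that r by blast
qed

text \<open>
  Precomposing \<open>f\<close> with the nearest-point projection onto the ball makes it globally Lipschitz and
  bounded, so that Banach's theorem applies to all bounded continuous functions.
\<close>

lemma picard_lindelof:
  fixes f :: "'a::euclidean_space \<Rightarrow> 'a"
  assumes r: "r > 0" and L: "L \<ge> 0"
    and lip: "\<And>x y. x \<in> cball z0 r \<Longrightarrow> y \<in> cball z0 r \<Longrightarrow> norm (f x - f y) \<le> L * norm (x - y)"
  obtains e z where "e > 0" "z 0 = z0" "\<And>t. t \<in> {-e<..<e} \<Longrightarrow> z t \<in> cball z0 r"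
    "\<And>t. t \<in> {-e<..<e} \<Longrightarrow> (z has_vector_derivative f (z t)) (at t)"
proof -
  let ?p = "closest_point (cball z0 r)"
  define F where "F = (\<lambda>x. f (?p x))"
  have pin: "?p x \<in> cball z0 r" for x
    using r by (intro closest_point_in_set) auto
  have Flip: "norm (F x - F y) \<le> L * norm (x - y)" for x y
  proof -
    have "norm (F x - F y) \<le> L * norm (?p x - ?p y)"
      unfolding F_def by (rule lip) (rule pin)+
    also have "\<dots> \<le> L * norm (x - y)"
      using closest_point_lipschitz[of "cball z0 r" x y] r L
      by (intro mult_left_mono) (auto simp: dist_norm)
    finally show ?thesis .
  qed
  have Fcont: "continuous_on S F" for S
    by (rule lipschitz_on_continuous_on[where L = L]) (auto simp: lipschitz_on_def dist_norm L Flip)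
  define M where "M = norm (f z0) + L * r"
  have M: "M \<ge> 0" using L r by (simp add: M_def)
  have FM: "norm (F x) \<le> M" for x
  proof -
    have "norm (F x - f z0) \<le> L * norm (?p x - z0)"
      unfolding F_def by (rule lip) (use pin r in auto)
    also have "\<dots> \<le> L * r"
      using pin[of x] L by (intro mult_left_mono) (auto simp: dist_norm norm_minus_commute)
    finally show ?thesis unfolding M_def using norm_triangle_sub[of "F x" "f z0"] by simp
  qed
  define e where "e = min (1 / (6 * (L + 1))) (r / (3 * (M + 1)))"
  have e: "e > 0" using L M r by (simp add: e_def)
  have eL: "3 * e * L \<le> 1 / 2"
  proof -
    have "e * (6 * (L + 1)) \<le> 1 / (6 * (L + 1)) * (6 * (L + 1))"
      using L by (intro mult_right_mono) (auto simp: e_def)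
    also have "\<dots> = 1" using L by simp
    finally have "e * (6 * (L + 1)) \<le> 1" .
    then show ?thesis using e by (simp add: field_simps)
  qed
  have eM: "3 * e * M \<le> r"
  proof -
    have "e * (3 * (M + 1)) \<le> r"
    proof -
      have "e * (3 * (M + 1)) \<le> r / (3 * (M + 1)) * (3 * (M + 1))"
        using M by (intro mult_right_mono) (auto simp: e_def)
      then show ?thesis using M by simp
    qed
    then show ?thesis using e by (simp add: field_simps)
  qed
  define cl where "cl t = max (-e) (min e t)" for t
  have cl: "cl t \<in> {-e..e}" for t using e by (auto simp: cl_def)
  define I where "I z t = integral {-e..t} (\<lambda>s. F (z s)) - integral {-e..0} (\<lambda>s. F (z s))"
    for z :: "real \<Rightarrow> 'a" and t
  have intg: "(\<lambda>s. F (z s)) integrable_on {a..b}" if "continuous_on UNIV z" for z :: "real \<Rightarrow> 'a" and a b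
    by (intro integrable_continuous_interval continuous_on_compose2[OF Fcont[of UNIV]]
        continuous_on_subset[OF that]) auto
  have Inorm: "norm (I z t) \<le> 3 * e * M" if "continuous_on UNIV z" "t \<in> {-e..e}" for z t
  proof -
    have 1: "norm (integral {-e..t} (\<lambda>s. F (z s))) \<le> M * (t - (-e))" if "t \<in> {-e..e}" for t
      using that FM by (intro integral_bound continuous_on_compose2[OF Fcont[of UNIV]]
        continuous_on_subset[OF \<open>continuous_on UNIV z\<close>]) auto
    have "M * t \<le> M * e" using that M by (intro mult_left_mono) auto
    then show ?thesis
      using 1[OF that(2)] 1[of 0] e norm_triangle_ineq4[of "integral {-e..t} (\<lambda>s. F (z s))" "integral {-e..0} (\<lambda>s. F (z s))"]
      by (simp add: I_def algebra_simps)
  qed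
  have Icont: "continuous_on UNIV (\<lambda>t. z0 + I z (cl t))" if "continuous_on UNIV z" for z
  proof -
    have "continuous_on {-e..e} (\<lambda>t. integral {-e..t} (\<lambda>s. F (z s)))"
      by (rule indefinite_integral_continuous_1) (rule intg[OF that])
    then have "continuous_on UNIV (\<lambda>t. integral {-e..cl t} (\<lambda>s. F (z s)))"
      by (rule continuous_on_compose2) (use cl in \<open>auto simp: cl_def[abs_def] intro!: continuous_intros\<close>)
    then show ?thesis unfolding I_def by (intro continuous_intros)
  qed
  define \<Phi> where "\<Phi> z = Bcontfun (\<lambda>t. z0 + I (apply_bcontfun z) (cl t))" for z :: "real \<Rightarrow>\<^sub>C 'a"
  have bc: "(\<lambda>t. z0 + I (apply_bcontfun z) (cl t)) \<in> bcontfun" for z :: "real \<Rightarrow>\<^sub>C 'a"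
  proof (rule bcontfun_normI)
    show "continuous_on UNIV (\<lambda>t. z0 + I (apply_bcontfun z) (cl t))"
      by (rule Icont) simp
    show "norm (z0 + I (apply_bcontfun z) (cl t)) \<le> norm z0 + 3 * e * M" for t
      using Inorm[OF _ cl, of "apply_bcontfun z" t] norm_triangle_ineq[of z0] by (meson add_left_mono continuous_on_apply_bcontfun order_trans)
  qed
  have app: "apply_bcontfun (\<Phi> z) t = z0 + I (apply_bcontfun z) (cl t)" for z t
    unfolding \<Phi>_def using bc by (simp add: Bcontfun_inverse)
  have contr: "dist (\<Phi> y) (\<Phi> z) \<le> 1/2 * dist y z" for y z
  proof (rule dist_bound)
    fix t
    let ?y = "apply_bcontfun y" and ?z = "apply_bcontfun z"
    let ?d = "\<lambda>s. F (?y s) - F (?z s)"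
    have cy: "continuous_on UNIV ?y" "continuous_on UNIV ?z" by simp_all
    have dF: "norm (?d s) \<le> L * dist y z" for s
    proof -
      have "norm (?d s) \<le> L * norm (?y s - ?z s)" by (rule Flip)
      also have "\<dots> \<le> L * dist y z"
        using dist_bounded[of y s z] L by (intro mult_left_mono) (auto simp: dist_norm)
      finally show ?thesis .
    qed
    have 1: "norm (integral {-e..t} ?d) \<le> L * dist y z * (t - (-e))" if "t \<in> {-e..e}" for t
      using that dF
      by (intro integral_bound continuous_intros continuous_on_compose2[OF Fcont[of UNIV]]
        continuous_on_subset[OF cy(1)] continuous_on_subset[OF cy(2)]) auto
    have "I ?y t - I ?z t = integral {-e..t} ?d - integral {-e..0} ?d" for t
      unfolding I_def by (simp add: integral_diff[OF intg[OF cy(1)] intg[OF cy(2)]])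
    then have "dist (apply_bcontfun (\<Phi> y) t) (apply_bcontfun (\<Phi> z) t)
        \<le> norm (integral {-e..cl t} ?d) + norm (integral {-e..0} ?d)"
      by (simp add: app dist_norm norm_triangle_ineq4)
    also have "\<dots> \<le> L * dist y z * (cl t + e) + L * dist y z * e"
      using 1[OF cl] 1[of 0] e by (intro add_mono) auto
    also have "\<dots> \<le> L * dist y z * (2 * e) + L * dist y z * e"
      using cl[of t] L by (intro add_mono mult_left_mono) auto
    also have "\<dots> = (3 * e * L) * dist y z" by (simp add: algebra_simps)
    also have "\<dots> \<le> 1/2 * dist y z" by (rule mult_right_mono[OF eL]) simp
    finally show "dist (apply_bcontfun (\<Phi> y) t) (apply_bcontfun (\<Phi> z) t) \<le> 1/2 * dist y z" .
  qed
  obtain z where z: "\<Phi> z = z"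
    using banach_fix_type[of "1/2" \<Phi>] contr by auto
  define y where "y = apply_bcontfun z"
  have ycont: "continuous_on UNIV y" by (simp add: y_def)
  have y: "y t = z0 + I y t" if "t \<in> {-e..e}" for t
    using app[of z t] that unfolding z y_def cl_def by (auto simp: max_def min_def)
  have yin: "y t \<in> cball z0 r" if "t \<in> {-e..e}" for t
    using Inorm[OF ycont that] eM y[OF that] by (simp add: dist_norm)
  have "(y has_vector_derivative f (y t)) (at t)" if t: "t \<in> {-e<..<e}" for t
  proof -
    have tI: "t \<in> {-e..e}" using t by auto
    have "((\<lambda>t. integral {-e..t} (\<lambda>s. F (y s))) has_vector_derivative F (y t)) (at t within {-e..e})"
      by (rule integral_has_vector_derivative[OF _ tI])
        (intro continuous_on_compose2[OF Fcont[of UNIV]] continuous_on_subset[OF ycont], auto)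
    then have "((\<lambda>t. z0 + I y t) has_vector_derivative F (y t)) (at t within {-e..e})"
      unfolding I_def by (auto intro!: derivative_eq_intros)
    then have "((\<lambda>t. z0 + I y t) has_vector_derivative F (y t)) (at t within {-e<..<e})"
      by (rule has_vector_derivative_within_subset) auto
    then have "(y has_vector_derivative F (y t)) (at t within {-e<..<e})"
      by (rule has_vector_derivative_transform[OF t, rotated]) (use y in auto)
    then have "(y has_vector_derivative F (y t)) (at t)"
      using t at_within_open[of t "{-e<..<e}"] by simp
    then show ?thesis
      using yin[OF tI] by (simp add: F_def closest_point_self)
  qed
  moreover have "y 0 = z0" using y[of 0] e by (simp add: I_def)
  ultimately show thesis
    using that[of e y] e yin by auto
qed

section \<open>Charts\<close>

lemma chart_inv_in: "x \<in> snd c ` fst c \<Longrightarrow> chart_inv c x \<in> fst c"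
  unfolding chart_inv_def by (rule inv_into_into)

lemma chart_chart_inv: "x \<in> snd c ` fst c \<Longrightarrow> snd c (chart_inv c x) = x"
  unfolding chart_inv_def by (rule f_inv_into_f)

lemma is_chart_inj_on: "is_chart c \<Longrightarrow> inj_on (snd c) (fst c)"
  unfolding is_chart_def homeomorphism_def by (metis inj_on_inverseI)

lemma chart_inv_chart: "is_chart c \<Longrightarrow> p \<in> fst c \<Longrightarrow> chart_inv c (snd c p) = p"
  unfolding chart_inv_def by (simp add: is_chart_inj_on)

lemma continuous_on_chart: "is_chart c \<Longrightarrow> continuous_on (fst c) (snd c)"
  unfolding is_chart_def homeomorphism_def by blast

lemma continuous_on_chart_inv:
  assumes "is_chart c" shows "continuous_on (snd c ` fst c) (chart_inv c)"
proof -
  obtain \<psi> where \<psi>: "homeomorphism (fst c) (snd c ` fst c) (snd c) \<psi>"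
    using assms unfolding is_chart_def by blast
  have "\<psi> x = chart_inv c x" if "x \<in> snd c ` fst c" for x
    using that \<psi> chart_inv_chart[OF assms] unfolding homeomorphism_def by auto
  then show ?thesis
    using \<psi> continuous_on_cong[of "snd c ` fst c" "snd c ` fst c" \<psi> "chart_inv c"]
    unfolding homeomorphism_def by auto
qed

lemma open_chart_domain: "is_chart c \<Longrightarrow> open (fst c)"
  and open_chart_range: "is_chart c \<Longrightarrow> open (snd c ` fst c)"
  unfolding is_chart_def by auto

lemma open_chart_image:
  assumes c: "is_chart c" and "open T"
  shows "open (snd c ` (fst c \<inter> T))"
proof -
  have "snd c ` (fst c \<inter> T) = chart_inv c -` T \<inter> snd c ` fst c"
    using chart_inv_chart[OF c] chart_inv_in[of _ c] chart_chart_inv[of _ c]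
    by (auto simp: image_iff)
  moreover have "open (chart_inv c -` T \<inter> snd c ` fst c)"
    using continuous_on_open_vimage[OF open_chart_range[OF c]] continuous_on_chart_inv[OF c] assms(2)
    by blast
  ultimately show ?thesis by simp
qed

definition prod_chart :: "('m, 'e) chart \<Rightarrow> ('n, 'f) chart \<Rightarrow> ('m \<times> 'n, 'e \<times> 'f) chart" where
  "prod_chart c d = (fst c \<times> fst d, map_prod (snd c) (snd d))"

lemma prod_chart_simps [simp]:
  "fst (prod_chart c d) = fst c \<times> fst d" "snd (prod_chart c d) = map_prod (snd c) (snd d)"
  by (simp_all add: prod_chart_def)

lemma prod_chart_in: "c \<in> A \<Longrightarrow> d \<in> B \<Longrightarrow> prod_chart c d \<in> prod_atlas A B"
  unfolding prod_chart_def prod_atlas_def by blast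

lemma continuous_on_map_prod:
  assumes "continuous_on S f" "continuous_on T g"
  shows "continuous_on (S \<times> T) (map_prod f g)"
  unfolding map_prod_def split_beta
  by (intro continuous_on_Pair continuous_on_compose2[OF assms(1)] continuous_on_compose2[OF assms(2)]
      continuous_on_fst continuous_on_snd continuous_on_id) auto

lemma is_chart_prod:
  assumes c: "is_chart c" and d: "is_chart d"
  shows "is_chart (prod_chart c d)"
proof -
  have im: "map_prod (snd c) (snd d) ` (fst c \<times> fst d) = snd c ` fst c \<times> snd d ` fst d"
    by (simp add: map_prod_image)
  obtain \<psi> \<phi> where "homeomorphism (fst c) (snd c ` fst c) (snd c) \<psi>"
    "homeomorphism (fst d) (snd d ` fst d) (snd d) \<phi>"
    using c d unfolding is_chart_def by blast
  then have *: "homeomorphism (fst c \<times> fst d) (snd c ` fst c \<times> snd d ` fst d)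
      (map_prod (snd c) (snd d)) (map_prod \<psi> \<phi>)"
    unfolding homeomorphism_def
    by (intro conjI continuous_on_map_prod) (auto simp: map_prod_image)
  then show ?thesis
    using c d unfolding is_chart_def by (auto simp: im open_Times)
qed

lemma is_chart_real: "is_chart (UNIV, id :: real \<Rightarrow> real)"
  unfolding is_chart_def by (auto intro!: exI[of _ id] simp: homeomorphism_def)

definition chart_reg :: "('m, 'e::euclidean_space) chart \<Rightarrow> ('x::real_normed_vector \<Rightarrow> 'm) \<Rightarrow> 'x \<Rightarrow> bool" where
  "chart_reg d f z \<longleftrightarrow> (\<forall>\<^sub>F w in nhds z. f w \<in> fst d) \<and> twice_diff (\<lambda>w. snd d (f w)) z"

lemma chart_reg_in: "chart_reg d f z \<Longrightarrow> f z \<in> fst d"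
  unfolding chart_reg_def by (metis eventually_nhds_x_imp_x)

lemma chart_reg_diff: "chart_reg d f z \<Longrightarrow> (\<lambda>w. snd d (f w)) differentiable (at z)"
  unfolding chart_reg_def by (metis twice_diff_differentiable)

lemma chart_reg_cong:
  assumes "\<forall>\<^sub>F w in nhds z. f w = g w" "chart_reg d f z"
  shows "chart_reg d g z"
proof -
  have "\<forall>\<^sub>F w in nhds z. g w \<in> fst d"
    using assms unfolding chart_reg_def by (auto elim: eventually_elim2)
  moreover have "twice_diff (\<lambda>w. snd d (g w)) z"
    by (rule twice_diff_cong[where f = "\<lambda>w. snd d (f w)"])
      (use assms in \<open>auto simp: chart_reg_def elim: eventually_mono\<close>)
  ultimately show ?thesis by (simp add: chart_reg_def)
qed

lemma chart_reg_eventually: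
  assumes c: "is_chart c" and f: "chart_reg c f z" and "open T" "f z \<in> T"
  shows "\<forall>\<^sub>F w in nhds z. f w \<in> T"
proof -
  let ?S = "snd c ` (fst c \<inter> T)"
  have "\<forall>\<^sub>F x in nhds (snd c (f z)). x \<in> ?S"
    using assms chart_reg_in[OF f] by (intro eventually_nhds_in_open open_chart_image) auto
  moreover have "isCont (\<lambda>w. snd c (f w)) z"
    using f unfolding chart_reg_def by (metis twice_diff_isCont)
  ultimately have "\<forall>\<^sub>F w in nhds z. snd c (f w) \<in> ?S"
    by (rule eventually_nhds_compose[rotated])
  moreover have "\<forall>\<^sub>F w in nhds z. f w \<in> fst c"
    using f by (simp add: chart_reg_def)
  ultimately show ?thesis
    by eventually_elim (use is_chart_inj_on[OF c] in \<open>auto dest: inj_onD\<close>)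
qed

lemma chart_reg_isCont:
  fixes f :: "'x::real_normed_vector \<Rightarrow> 'm::topological_space" and c :: "('m, 'e::euclidean_space) chart"
  assumes c: "is_chart c" and f: "chart_reg c f z"
  shows "isCont f z"
  unfolding isCont_def tendsto_at_iff_tendsto_nhds
  by (rule topological_tendstoI) (rule chart_reg_eventually[OF c f])

lemma coord_map_twice_diff:
  assumes F: "smooth_map A B F" "c \<in> A" "d \<in> B" and c: "is_chart c" "is_chart d"
    and p: "p \<in> fst c" "F p \<in> fst d"
  shows "twice_diff (coord_map c d F) (snd c p)"
    and "\<forall>\<^sub>F x in nhds (snd c p). x \<in> snd c ` fst c \<and> F (chart_inv c x) \<in> fst d \<and>
      twice_diff (coord_map c d F) x"
proof -
  let ?S = "snd c ` (fst c \<inter> F -` fst d)"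
  have "open (F -` fst d)"
    using F(1) open_chart_domain[OF c(2)] unfolding smooth_map_def
    by (metis continuous_on_open_vimage open_UNIV inf_top.right_neutral)
  then have S: "open ?S" using c(1) by (rule open_chart_image[rotated])
  have sm: "smooth_on (coord_map c d F) ?S"
    using F by (auto simp: smooth_map_def)
  have p: "snd c p \<in> ?S" using p by auto
  show "twice_diff (coord_map c d F) (snd c p)"
    by (rule smooth_on_twice_diff[OF sm S p])
  show "\<forall>\<^sub>F x in nhds (snd c p). x \<in> snd c ` fst c \<and> F (chart_inv c x) \<in> fst d \<and>
      twice_diff (coord_map c d F) x"
    using eventually_nhds_in_open[OF S p]
    by (rule eventually_mono) (auto simp: chart_inv_chart[OF c(1)] intro!: smooth_on_twice_diff[OF sm S])
qed

lemma chart_reg_smooth_map: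
  assumes F: "smooth_map A B F" "c \<in> A" "d \<in> B" and c: "is_chart c" "is_chart d"
    and f: "chart_reg c f z" and Fd: "F (f z) \<in> fst d"
  shows "chart_reg d (\<lambda>w. F (f w)) z"
    and "fderiv (\<lambda>w. snd d (F (f w))) z v =
      fderiv (coord_map c d F) (snd c (f z)) (fderiv (\<lambda>w. snd c (f w)) z v)"
proof -
  note fz = chart_reg_in[OF f]
  have "\<forall>\<^sub>F w in nhds z. f w \<in> fst c" using f by (simp add: chart_reg_def)
  then have eq: "\<forall>\<^sub>F w in nhds z. coord_map c d F (snd c (f w)) = snd d (F (f w))"
    by (rule eventually_mono) (simp add: coord_map_def chart_inv_chart[OF c(1)])
  have td: "twice_diff (coord_map c d F) (snd c (f z))"
    by (rule coord_map_twice_diff[OF F c fz Fd])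
  have tf: "twice_diff (\<lambda>w. snd c (f w)) z" using f by (simp add: chart_reg_def)
  have "twice_diff (\<lambda>w. snd d (F (f w))) z"
    using twice_diff_cong[OF eq] twice_diff_compose[of "coord_map c d F", OF td tf] .
  moreover have "\<forall>\<^sub>F w in nhds z. f w \<in> F -` fst d"
    using F(1) open_chart_domain[OF c(2)] Fd unfolding smooth_map_def
    by (intro chart_reg_eventually[OF c(1) f])
      (metis continuous_on_open_vimage open_UNIV inf_top.right_neutral, simp)
  ultimately show "chart_reg d (\<lambda>w. F (f w)) z"
    by (simp add: chart_reg_def)
  show "fderiv (\<lambda>w. snd d (F (f w))) z v =
      fderiv (coord_map c d F) (snd c (f z)) (fderiv (\<lambda>w. snd c (f w)) z v)"
    using fderiv_compose[of "coord_map c d F" "\<lambda>w. snd c (f w)" z v] td tf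
    by (simp add: fderiv_cong_nhds[OF eq, symmetric] twice_diff_differentiable)
qed

lemma chart_reg_Pair:
  assumes "chart_reg c f z" "chart_reg d g z"
  shows "chart_reg (prod_chart c d) (\<lambda>w. (f w, g w)) z"
  using assms unfolding chart_reg_def by (auto simp: eventually_conj_iff intro: twice_diff_Pair)

lemma chart_reg_compose:
  fixes g :: "'x::real_normed_vector \<Rightarrow> 'y::euclidean_space"
  assumes "chart_reg d f (g z)" "twice_diff g z"
  shows "chart_reg d (\<lambda>w. f (g w)) z"
  using assms eventually_nhds_compose[OF twice_diff_isCont[OF assms(2)]]
    twice_diff_compose[of "\<lambda>w. snd d (f w)" g]
  unfolding chart_reg_def by auto

lemma chart_reg_const: "p \<in> fst d \<Longrightarrow> chart_reg d (\<lambda>w. p) z"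
  by (simp add: chart_reg_def)

lemma chart_reg_chart_inv:
  assumes "is_chart c" "x \<in> snd c ` fst c"
  shows "chart_reg c (chart_inv c) x"
proof -
  have ev: "\<forall>\<^sub>F y in nhds x. y \<in> snd c ` fst c"
    using assms open_chart_range by (intro eventually_nhds_in_open)
  have "twice_diff (\<lambda>w. snd c (chart_inv c w)) x"
  proof (rule twice_diff_cong[of "\<lambda>w. w"])
    show "\<forall>\<^sub>F w in nhds x. w = snd c (chart_inv c w)"
      using ev by (rule eventually_mono) (simp add: chart_chart_inv)
  qed simp
  moreover have "\<forall>\<^sub>F w in nhds x. chart_inv c w \<in> fst c"
    using ev by (rule eventually_mono) (rule chart_inv_in)
  ultimately show ?thesis
    unfolding chart_reg_def by blast
qed

section \<open>Lie groups in a chart\<close>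

locale lie_chart =
  fixes N :: "'m::{t2_space, second_countable_topology} monoid" (structure)
    and A :: "('m, 'e::euclidean_space) chart set"
    and c :: "('m, 'e) chart"
  assumes lie: "lie_group N A" and cA: "c \<in> A" and one_in: "\<one> \<in> fst c"
begin

sublocale group N
  using lie by (simp add: lie_group_def)

lemma carrier_UNIV [simp]: "carrier N = UNIV"
  using lie by (simp add: lie_group_def)

lemma charts: "d \<in> A \<Longrightarrow> is_chart d"
  using lie by (auto simp: lie_group_def smooth_atlas_def)

lemma chart_c: "is_chart c" using charts cA .

lemma smooth_mult: "smooth_map (prod_atlas A A) A (\<lambda>(x, y). x \<otimes> y)"
  and smooth_inv: "smooth_map A A (\<lambda>x. inv x)"
  and smooth_id: "smooth_map A A id"
  using lie by (auto simp: lie_group_def smooth_atlas_def)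

abbreviation "K \<equiv> snd c"
abbreviation "Ki \<equiv> chart_inv c"
abbreviation "V \<equiv> snd c ` fst c"
abbreviation "e0 \<equiv> snd c \<one>"
abbreviation "reg \<equiv> chart_reg c"

definition "mu = coord_map (prod_chart c c) c (\<lambda>(x, y). x \<otimes> y)"
definition "E u x = fderiv mu (x, e0) (0, u)"

lemma e0_in: "e0 \<in> V" using one_in by auto
lemma Ki_e0 [simp]: "Ki e0 = \<one>" using chart_inv_chart[OF chart_c one_in] .
lemma open_V: "open V" using open_chart_range[OF chart_c] .
lemma ev_V: "x \<in> V \<Longrightarrow> \<forall>\<^sub>F y in nhds x. y \<in> V" using open_V by (rule eventually_nhds_in_open)
lemma K_Ki: "x \<in> V \<Longrightarrow> K (Ki x) = x" by (rule chart_chart_inv)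
lemma Ki_in: "x \<in> V \<Longrightarrow> Ki x \<in> fst c" by (rule chart_inv_in)
lemma Ki_K: "p \<in> fst c \<Longrightarrow> Ki (K p) = p" using chart_inv_chart[OF chart_c] .
lemma reg_Ki: "x \<in> V \<Longrightarrow> reg Ki x" using chart_reg_chart_inv[OF chart_c] .

lemma reg_mult:
  assumes "reg f z" "reg g z" "f z \<otimes> g z \<in> fst c"
  shows "reg (\<lambda>w. f w \<otimes> g w) z"
    and "fderiv (\<lambda>w. K (f w \<otimes> g w)) z v =
      fderiv mu (K (f z), K (g z)) (fderiv (\<lambda>w. K (f w)) z v, fderiv (\<lambda>w. K (g w)) z v)"
proof -
  note * = chart_reg_smooth_map[OF smooth_mult prod_chart_in[OF cA cA] cA
      is_chart_prod[OF chart_c chart_c] chart_c chart_reg_Pair[OF assms(1,2)]]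
  from *(1) assms(3) show "reg (\<lambda>w. f w \<otimes> g w) z" by simp
  from *(2)[of v] assms show "fderiv (\<lambda>w. K (f w \<otimes> g w)) z v =
      fderiv mu (K (f z), K (g z)) (fderiv (\<lambda>w. K (f w)) z v, fderiv (\<lambda>w. K (g w)) z v)"
    by (simp add: mu_def fderiv_Pair chart_reg_diff)
qed

lemma reg_inv: "reg f z \<Longrightarrow> inv (f z) \<in> fst c \<Longrightarrow> reg (\<lambda>w. inv (f w)) z"
  using chart_reg_smooth_map(1)[OF smooth_inv cA cA chart_c chart_c] .

lemma mu_twice_diff:
  assumes "x \<in> V" "y \<in> V" "Ki x \<otimes> Ki y \<in> fst c"
  shows "twice_diff mu (x, y)"
  using coord_map_twice_diff(1)[OF smooth_mult prod_chart_in[OF cA cA] cA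
      is_chart_prod[OF chart_c chart_c] chart_c, of "(Ki x, Ki y)"] assms
  by (auto simp: mu_def K_Ki Ki_in Ki_K)

lemma smooth_on_mu: "smooth_on mu (map_prod K K ` (fst c \<times> fst c \<inter> (\<lambda>(x, y). x \<otimes> y) -` fst c))"
  using smooth_mult prod_chart_in[OF cA cA] cA unfolding smooth_map_def mu_def by fastforce

lemma mu_eq: "x \<in> V \<Longrightarrow> y \<in> V \<Longrightarrow> mu (x, y) = K (Ki x \<otimes> Ki y)"
proof -
  assume "x \<in> V" "y \<in> V"
  then have "chart_inv (prod_chart c c) (map_prod K K (Ki x, Ki y)) = (Ki x, Ki y)"
    using chart_inv_chart[OF is_chart_prod[OF chart_c chart_c], of "(Ki x, Ki y)"] Ki_in
    by simp
  with \<open>x \<in> V\<close> \<open>y \<in> V\<close> show ?thesis by (simp add: mu_def coord_map_def K_Ki)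
qed

lemma linear_E: "x \<in> V \<Longrightarrow> linear (\<lambda>u. E u x)"
proof -
  assume x: "x \<in> V"
  have "linear (fderiv mu (x, e0))"
    using mu_twice_diff[OF x e0_in] x by (intro linear_fderiv) (simp add: Ki_in)
  moreover have "linear (\<lambda>u::'e. (0::'e, u))" by (intro linearI) auto
  ultimately show ?thesis
    unfolding E_def using linear_compose[of "\<lambda>u. (0::'e, u)" "fderiv mu (x, e0)"] by (simp add: o_def)
qed

lemma fderiv_mu_unit:
  assumes x: "x \<in> V"
  shows "fderiv mu (x, e0) (a, 0) = a" "fderiv mu (e0, x) (0, a) = a"
proof -
  have "\<forall>\<^sub>F y in nhds x. mu (y, e0) = y" "\<forall>\<^sub>F y in nhds x. mu (e0, y) = y"
    using ev_V[OF x] by (auto simp: mu_eq e0_in K_Ki elim!: eventually_mono)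
  then have "fderiv (\<lambda>y. mu (y, e0)) x a = a" "fderiv (\<lambda>y. mu (e0, y)) x a = a"
    using fderiv_cong_nhds[of _ "\<lambda>y. y" x] by simp_all
  moreover have "fderiv (\<lambda>y. mu (y, e0)) x a = fderiv mu (x, e0) (fderiv (\<lambda>y. (y, e0)) x a)"
    "fderiv (\<lambda>y. mu (e0, y)) x a = fderiv mu (e0, x) (fderiv (\<lambda>y. (e0, y)) x a)"
    using mu_twice_diff[OF x e0_in] mu_twice_diff[OF e0_in x] x
    by (auto simp: Ki_in twice_diff_differentiable intro!: fderiv_compose[of mu] twice_diff_Pair)
  ultimately show "fderiv mu (x, e0) (a, 0) = a" "fderiv mu (e0, x) (0, a) = a"
    by (simp_all add: fderiv_Pair)
qed

lemma E_e0 [simp]: "E u e0 = u"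
  using fderiv_mu_unit(2)[OF e0_in] by (simp add: E_def)

lemma fderiv_mult_right:
  assumes f: "reg f z" and g: "reg g z" "g z = \<one>"
  shows "fderiv (\<lambda>w. K (f w \<otimes> g w)) z v = fderiv (\<lambda>w. K (f w)) z v + E (fderiv (\<lambda>w. K (g w)) z v) (K (f z))"
proof -
  let ?x = "K (f z)"
  have x: "?x \<in> V" and fz: "f z \<in> fst c" using chart_reg_in[OF f] by auto
  have lin: "linear (fderiv mu (?x, e0))"
    using mu_twice_diff[OF x e0_in] fz by (intro linear_fderiv) (simp add: Ki_K)
  have "fderiv mu (?x, e0) (a, b) = a + E b ?x" for a b
    using linear_add[OF lin, of "(a, 0)" "(0, b)"] fderiv_mu_unit(1)[OF x] by (simp add: E_def)
  then show ?thesis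
    using reg_mult(2)[OF f g(1), of v] fz g(2) by simp
qed

lemma fderiv_mult_left:
  assumes f: "reg f z" "f z = \<one>" and g: "reg g z"
  shows "fderiv (\<lambda>w. K (f w \<otimes> g w)) z v =
    fderiv mu (e0, K (g z)) (fderiv (\<lambda>w. K (f w)) z v, 0) + fderiv (\<lambda>w. K (g w)) z v"
proof -
  let ?x = "K (g z)"
  have x: "?x \<in> V" and gz: "g z \<in> fst c" using chart_reg_in[OF g] by auto
  have lin: "linear (fderiv mu (e0, ?x))"
    using mu_twice_diff[OF e0_in x] gz by (intro linear_fderiv) (simp add: Ki_K)
  have "fderiv mu (e0, ?x) (a, b) = fderiv mu (e0, ?x) (a, 0) + b" for a b
    using linear_add[OF lin, of "(a, 0)" "(0, b)"] fderiv_mu_unit(2)[OF x] by simp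
  from this[of "fderiv (\<lambda>w. K (f w)) z v" "fderiv (\<lambda>w. K (g w)) z v"] show ?thesis
    using reg_mult(2)[OF f(1) g, of v] gz f(2) by simp
qed

lemma fderiv_K_Ki: "x \<in> V \<Longrightarrow> fderiv (\<lambda>y. K (Ki y)) x u = u"
  using fderiv_cong_nhds[of "\<lambda>y. K (Ki y)" "\<lambda>y. y" x] eventually_mono[OF ev_V K_Ki] by simp

lemma left_translation:
  assumes x: "x \<in> V"
  shows "reg (\<lambda>y. Ki x \<otimes> Ki y) e0" "fderiv (\<lambda>y. K (Ki x \<otimes> Ki y)) e0 u = E u x"
  using reg_mult(1)[OF chart_reg_const[OF Ki_in[OF x]] reg_Ki[OF e0_in]]
    fderiv_mult_right[OF chart_reg_const[OF Ki_in[OF x]] reg_Ki[OF e0_in], of u] x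
  by (simp_all add: Ki_in K_Ki fderiv_K_Ki e0_in)

lemma left_invariant_field_eq: "x \<in> V \<Longrightarrow> left_invariant_field N c u x = E u x"
  by (simp add: left_invariant_field_def differential_def coord_map_def left_translation(2))

lemma smooth_on_E: "\<exists>S. open S \<and> V \<times> {e0} \<subseteq> S \<and> smooth_on (\<lambda>z. fderiv mu z (0, u)) S"
proof (intro exI conjI)
  let ?S = "map_prod K K ` (fst c \<times> fst c \<inter> (\<lambda>(x, y). x \<otimes> y) -` fst c)"
  have "open ((\<lambda>(x, y). x \<otimes> y) -` fst c)"
    using smooth_mult open_chart_domain[OF chart_c] unfolding smooth_map_def
    by (metis continuous_on_open_vimage open_UNIV inf_top.right_neutral)
  then show "open ?S"
    using open_chart_image[OF is_chart_prod[OF chart_c chart_c], of "(\<lambda>(x, y). x \<otimes> y) -` fst c"]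
    by (simp only: prod_chart_simps)
  show "V \<times> {e0} \<subseteq> ?S"
  proof
    fix z assume "z \<in> V \<times> {e0}"
    then obtain p where "z = map_prod K K (p, \<one>)" "p \<in> fst c" by auto
    then show "z \<in> ?S" using one_in by (auto intro!: image_eqI[of _ _ "(p, \<one>)"])
  qed
  show "smooth_on (\<lambda>z. fderiv mu z (0, u)) ?S"
    by (rule smooth_on_fderiv[OF smooth_on_mu])
qed

lemma E_twice_diff: "x \<in> V \<Longrightarrow> twice_diff (E u) x"
proof -
  assume x: "x \<in> V"
  obtain S where S: "open S" "V \<times> {e0} \<subseteq> S" "smooth_on (\<lambda>z. fderiv mu z (0, u)) S"
    using smooth_on_E by blast
  have "(x, e0) \<in> S" using x S(2) by blast
  then have "twice_diff (\<lambda>z. fderiv mu z (0, u)) (x, e0)"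
    by (rule smooth_on_twice_diff[OF S(3,1)])
  then show ?thesis
    unfolding E_def[abs_def]
    by (rule twice_diff_compose[where g = "\<lambda>x. (x, e0)"]) (auto intro: twice_diff_Pair)
qed

definition "P u w = fderiv (E u) e0 w"

lemma ev_linear_E: "x \<in> V \<Longrightarrow> \<forall>\<^sub>F x in nhds x. linear (\<lambda>u. E u x)"
  by (erule eventually_mono[OF ev_V]) (rule linear_E)

lemma linear_P_left: "linear (\<lambda>u. P u w)"
  unfolding P_def
  by (rule linear_fderiv_param[where L = "\<lambda>x u. E u x", OF ev_linear_E[OF e0_in]])
    (rule twice_diff_differentiable[OF E_twice_diff[OF e0_in]])

lemma linear_P_right: "linear (P u)"
  unfolding P_def[abs_def] by (rule linear_fderiv[OF E_twice_diff[OF e0_in]])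

abbreviation "br \<equiv> lie_bracket N c"

lemma br_eq: "br u v = P v u - P u v"
proof -
  have "fderiv (left_invariant_field N c u) e0 = fderiv (E u) e0" for u
    by (rule fderiv_cong_nhds, rule eventually_mono[OF ev_V[OF e0_in]]) (rule left_invariant_field_eq)
  then show ?thesis
    by (simp add: lie_bracket_def Let_def P_def left_invariant_field_eq e0_in)
qed

lemma linear_br_right: "linear (br u)"
  unfolding br_eq[abs_def] by (intro linear_compose_sub linear_P_left linear_P_right)

lemma br_antisym: "br u v = - br v u"
  by (simp add: br_eq)

lemma linear_br_left: "linear (\<lambda>u. br u v)"
  unfolding br_eq[abs_def] by (intro linear_compose_sub linear_P_left linear_P_right)

lemma bilinear_br: "bilinear br"
  by (simp add: bilinear_def linear_br_left linear_br_right)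

text \<open>With \<open>\<psi> = id\<close> this is the invariance of \<open>E u\<close> under a left translation \<open>\<phi>\<close>.\<close>

lemma fderiv_E_equivariant:
  assumes mult: "\<And>p q. \<phi> (p \<otimes> q) = \<phi> p \<otimes> \<psi> q" and one: "\<psi> \<one> = \<one>"
    and x: "x \<in> V" and \<phi>: "reg (\<lambda>y. \<phi> (Ki y)) x" and \<psi>: "reg (\<lambda>y. \<psi> (Ki y)) e0"
  shows "fderiv (\<lambda>y. K (\<phi> (Ki y))) x (E u x) =
    E (fderiv (\<lambda>y. K (\<psi> (Ki y))) e0 u) (K (\<phi> (Ki x)))"
proof -
  note r = left_translation(1)[OF x] and d = left_translation(2)[OF x, of u]
  have "fderiv (\<lambda>y. (\<lambda>x. K (\<phi> (Ki x))) (K (Ki x \<otimes> Ki y))) e0 u =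
     fderiv (\<lambda>y. K (\<phi> (Ki y))) x (fderiv (\<lambda>y. K (Ki x \<otimes> Ki y)) e0 u)"
    using fderiv_compose[of "\<lambda>y. K (\<phi> (Ki y))" "\<lambda>y. K (Ki x \<otimes> Ki y)" e0 u]
      chart_reg_diff[OF \<phi>] chart_reg_diff[OF r] x by (simp add: K_Ki)
  moreover have "fderiv (\<lambda>y. (\<lambda>x. K (\<phi> (Ki x))) (K (Ki x \<otimes> Ki y))) e0 =
      fderiv (\<lambda>y. K (\<phi> (Ki x) \<otimes> \<psi> (Ki y))) e0"
    by (rule fderiv_cong_nhds)
      (use r in \<open>auto simp: chart_reg_def Ki_K mult elim: eventually_mono\<close>)
  moreover have "fderiv (\<lambda>y. K (\<phi> (Ki x) \<otimes> \<psi> (Ki y))) e0 u =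
      E (fderiv (\<lambda>y. K (\<psi> (Ki y))) e0 u) (K (\<phi> (Ki x)))"
    using fderiv_mult_right[OF chart_reg_const[OF chart_reg_in[OF \<phi>]] \<psi>, of u] one by simp
  ultimately show ?thesis using d by simp
qed

lemma reg_eventually_V: "reg f z \<Longrightarrow> \<forall>\<^sub>F w in nhds z. K (f w) \<in> V"
  unfolding chart_reg_def by (auto elim: eventually_mono)

text \<open>
  Differentiate the equivariance of \<open>E u\<close> at \<open>e0\<close>; the second derivative of \<open>\<phi>\<close> drops out of the
  antisymmetrization.
\<close>

lemma automorphism_bracket:
  assumes mult: "\<And>p q. \<phi> (p \<otimes> q) = \<phi> p \<otimes> \<phi> q" and one: "\<phi> \<one> = \<one>"
    and \<phi>: "\<forall>\<^sub>F x in nhds e0. reg (\<lambda>y. \<phi> (Ki y)) x"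
  defines "B \<equiv> fderiv (\<lambda>y. K (\<phi> (Ki y))) e0"
  shows "br (B u) (B v) = B (br u v)"
proof -
  let ?\<Phi> = "\<lambda>y. K (\<phi> (Ki y))"
  have r0: "reg (\<lambda>y. \<phi> (Ki y)) e0" using \<phi> by (rule eventually_nhds_x_imp_x)
  have td: "twice_diff ?\<Phi> e0" using r0 by (simp add: chart_reg_def)
  note linB = linear_fderiv[OF td]
  have key: "fderiv2 ?\<Phi> e0 w u + B (P u w) = P (B u) (B w)" for u w
  proof -
    have 1: "((\<lambda>x. fderiv ?\<Phi> x (E u x)) has_derivative
        (\<lambda>h. fderiv (\<lambda>x. fderiv ?\<Phi> x (E u e0)) e0 h + fderiv ?\<Phi> e0 (fderiv (E u) e0 h))) (at e0)"
      by (rule has_derivative_apply_linear)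
        (use td linear_fderiv_near[OF td] in \<open>auto simp: twice_diff_def
           intro!: fderiv_works twice_diff_differentiable[OF E_twice_diff[OF e0_in]]\<close>)
    have "fderiv (\<lambda>x. fderiv ?\<Phi> x (E u x)) e0 w = fderiv (\<lambda>x. E (B u) (?\<Phi> x)) e0 w"
    proof -
      have "\<forall>\<^sub>F x in nhds e0. fderiv ?\<Phi> x (E u x) = E (B u) (?\<Phi> x)"
        using \<phi> ev_V[OF e0_in]
        by eventually_elim (simp add: fderiv_E_equivariant[OF mult one _ _ r0] B_def)
      from fderiv_cong_nhds[OF this] show ?thesis by simp
    qed
    moreover have "fderiv (\<lambda>x. E (B u) (?\<Phi> x)) e0 w = P (B u) (B w)"
      using fderiv_compose[of "E (B u)" ?\<Phi> e0 w] td E_twice_diff[OF e0_in]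
      by (simp add: one P_def B_def twice_diff_differentiable)
    ultimately show ?thesis
      using fderiv_eqI[OF 1] by (simp add: P_def B_def)
  qed
  have "B (br u v) = B (P v u) - B (P u v)"
    unfolding B_def by (simp add: br_eq linear_diff[OF linB])
  moreover have "P (B v) (B u) - P (B u) (B v) = B (P v u) - B (P u v)"
  proof -
    have aux: "p - q = x - y" if "a + x = p" "b + y = q" "a = b" for a b p q x y :: 'e
      using that by auto
    show ?thesis
      by (rule aux[OF key key fderiv2_symmetric[OF td]])
  qed
  ultimately show ?thesis by (simp only: br_eq)
qed

definition "cj x q = Ki x \<otimes> q \<otimes> inv (Ki x)"
definition "Ad x v = fderiv (\<lambda>y. K (cj x (Ki y))) e0 v"
definition "V1 = {x \<in> V. inv (Ki x) \<in> fst c}"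

lemma open_V1: "open V1"
proof -
  have "open ((\<lambda>x. inv x) -` fst c)"
    using smooth_inv open_chart_domain[OF chart_c] unfolding smooth_map_def
    by (metis continuous_on_open_vimage open_UNIV inf_top.right_neutral)
  from open_chart_image[OF chart_c this]
  have "open (snd c ` (fst c \<inter> (\<lambda>x. inv x) -` fst c))" .
  also have "snd c ` (fst c \<inter> (\<lambda>x. inv x) -` fst c) = V1"
    by (auto simp: V1_def Ki_K)
  finally show ?thesis .
qed

lemma e0_V1: "e0 \<in> V1" using one_in by (auto simp: V1_def)

lemma ev_V1: "x \<in> V1 \<Longrightarrow> \<forall>\<^sub>F y in nhds x. y \<in> V1" using open_V1 by (rule eventually_nhds_in_open)

lemma V1_V: "x \<in> V1 \<Longrightarrow> x \<in> V" by (simp add: V1_def)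

lemma cj_mult: "cj x (p \<otimes> q) = cj x p \<otimes> cj x q"
proof -
  have "inv (Ki x) \<otimes> (Ki x \<otimes> r) = r" for r
    by (simp add: m_assoc[symmetric])
  then show ?thesis by (simp add: cj_def m_assoc)
qed

lemma cj_one [simp]: "cj x \<one> = \<one>" by (simp add: cj_def)

lemma reg_cj_joint:
  assumes x: "x \<in> V1" and y: "y \<in> V" "Ki x \<otimes> Ki y \<in> fst c" "cj x (Ki y) \<in> fst c"
  shows "reg (\<lambda>z. cj (fst z) (Ki (snd z))) (x, y)"
proof -
  have 1: "reg (\<lambda>z. Ki (fst z)) (x, y)" "reg (\<lambda>z. Ki (snd z)) (x, y)"
    using chart_reg_compose[where f = Ki and g = fst and d = c and z = "(x, y)"] reg_Ki[OF V1_V[OF x]]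
      chart_reg_compose[where f = Ki and g = snd and d = c and z = "(x, y)"] reg_Ki[OF y(1)]
    by simp_all
  have 2: "reg (\<lambda>z. Ki (fst z) \<otimes> Ki (snd z)) (x, y)"
    using reg_mult(1)[OF 1] y(2) by simp
  have 3: "reg (\<lambda>z. inv (Ki (fst z))) (x, y)"
    using reg_inv[OF 1(1)] x by (simp add: V1_def)
  show ?thesis
    using reg_mult(1)[OF 2 3] y(3) by (simp add: cj_def)
qed

lemma reg_cj:
  assumes "x \<in> V1" "y \<in> V" "Ki x \<otimes> Ki y \<in> fst c" "cj x (Ki y) \<in> fst c"
  shows "reg (\<lambda>y. cj x (Ki y)) y"
  using chart_reg_compose[where g = "\<lambda>y. (x, y)" and f = "\<lambda>z. cj (fst z) (Ki (snd z))" and z = y and d = c]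
    reg_cj_joint[OF assms]
  by (simp add: twice_diff_Pair)

lemma ev_reg_cj: "x \<in> V1 \<Longrightarrow> \<forall>\<^sub>F y in nhds e0. reg (\<lambda>y. cj x (Ki y)) y"
proof -
  assume x: "x \<in> V1"
  have "reg (\<lambda>y. Ki x \<otimes> Ki y) e0" by (rule left_translation(1)[OF V1_V[OF x]])
  then have 1: "\<forall>\<^sub>F y in nhds e0. Ki x \<otimes> Ki y \<in> fst c" by (simp add: chart_reg_def)
  have "reg (\<lambda>y. cj x (Ki y)) e0"
    by (rule reg_cj[OF x e0_in]) (use x one_in in \<open>auto simp: V1_def Ki_in\<close>)
  then have 2: "\<forall>\<^sub>F y in nhds e0. cj x (Ki y) \<in> fst c" by (simp add: chart_reg_def)
  show ?thesis
    using 1 2 ev_V[OF e0_in] by eventually_elim (rule reg_cj[OF x])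
qed

lemma reg_cj_e0: "x \<in> V1 \<Longrightarrow> reg (\<lambda>y. cj x (Ki y)) e0"
  by (rule eventually_nhds_x_imp_x) (rule ev_reg_cj)

lemma Ad_bracket: "x \<in> V1 \<Longrightarrow> br (Ad x u) (Ad x v) = Ad x (br u v)"
  unfolding Ad_def by (rule automorphism_bracket[OF cj_mult cj_one ev_reg_cj])

lemma reg_cj_joint_e0: "x \<in> V1 \<Longrightarrow> reg (\<lambda>z. cj (fst z) (Ki (snd z))) (x, e0)"
  by (rule reg_cj_joint) (use e0_in one_in in \<open>auto simp: V1_def Ki_in\<close>)

lemma Ad_joint: "x \<in> V1 \<Longrightarrow> Ad x v = fderiv (\<lambda>z. K (cj (fst z) (Ki (snd z)))) (x, e0) (0, v)"
  using fderiv_compose[of "\<lambda>z. K (cj (fst z) (Ki (snd z)))" "\<lambda>y. (x, y)" e0 v]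
    chart_reg_diff[OF reg_cj_joint_e0, of x]
  by (simp add: Ad_def fderiv_Pair twice_diff_differentiable twice_diff_Pair)

lemma Ad_differentiable: "x \<in> V1 \<Longrightarrow> (\<lambda>x. Ad x v) differentiable (at x)"
proof -
  assume x: "x \<in> V1"
  let ?C = "\<lambda>z. K (cj (fst z) (Ki (snd z)))"
  have "(\<lambda>z. fderiv ?C z (0, v)) differentiable (at (x, e0))"
    using reg_cj_joint_e0[OF x] by (simp add: chart_reg_def twice_diff_def)
  then have "(\<lambda>x. fderiv ?C (x, e0) (0, v)) differentiable (at x)"
    using differentiable_chain_at[of "\<lambda>x. (x, e0)" x "\<lambda>z. fderiv ?C z (0, v)"]
    by (simp add: o_def twice_diff_differentiable twice_diff_Pair)
  then show ?thesis
    by (rule differentiable_cong_nhds[rotated])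
      (use ev_V1[OF x] Ad_joint in \<open>auto elim: eventually_mono\<close>)
qed

lemma linear_Ad: "x \<in> V1 \<Longrightarrow> linear (Ad x)"
  unfolding Ad_def[abs_def]
  using reg_cj_e0 by (intro linear_fderiv) (simp add: chart_reg_def)

lemma Ad_e0 [simp]: "Ad e0 v = v"
  using fderiv_K_Ki[OF e0_in] by (simp add: Ad_def cj_def)

text \<open>Differentiate \<open>x y = (x y x\<^sup>-\<^sup>1) x\<close> first in \<open>y\<close> and then in \<open>x\<close>, both at the unit.\<close>

lemma fderiv_Ad: "fderiv (\<lambda>x. Ad x v) e0 u = br u v"
proof -
  define R where "R x w = fderiv mu (e0, x) (w, 0)" for x w
  have mu0: "twice_diff mu (e0, x)" if "x \<in> V" for x
    using mu_twice_diff[OF e0_in that] that by (simp add: Ki_in)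
  have linR: "linear (R x)" if "x \<in> V" for x
  proof -
    have "linear (\<lambda>u::'e. (u, 0::'e))" by (intro linearI) auto
    then show ?thesis
      unfolding R_def[abs_def]
      using linear_compose[of "\<lambda>u. (u, 0::'e)" "fderiv mu (e0, x)"] linear_fderiv[OF mu0[OF that]]
      by (simp add: o_def)
  qed
  have dmu: "(\<lambda>z. fderiv mu z w) differentiable (at (e0, e0))" for w
    using mu0[OF e0_in] unfolding twice_diff_def by blast
  have dR: "(\<lambda>x. R x w) differentiable (at e0)" for w
    using dmu differentiable_chain_at[of "\<lambda>x. (e0, x)" e0 "\<lambda>z. fderiv mu z (w, 0)"]
    by (simp add: R_def o_def twice_diff_differentiable twice_diff_Pair)
  have eq: "E v x = R x (Ad x v)" if x: "x \<in> V1" for x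
  proof -
    have r: "reg (\<lambda>y. cj x (Ki y)) e0" using x by (rule reg_cj_e0)
    have "fderiv (\<lambda>y. K (cj x (Ki y) \<otimes> Ki x)) e0 v = R x (Ad x v)"
      using fderiv_mult_left[OF r _ chart_reg_const[OF Ki_in[OF V1_V[OF x]]], of v] V1_V[OF x]
      by (simp add: R_def Ad_def K_Ki)
    moreover have "(\<lambda>y. K (cj x (Ki y) \<otimes> Ki x)) = (\<lambda>y. K (Ki x \<otimes> Ki y))"
      by (simp add: cj_def m_assoc)
    moreover have "fderiv (\<lambda>y. K (Ki x \<otimes> Ki y)) e0 v = E v x"
      by (rule left_translation(2)[OF V1_V[OF x]])
    ultimately show ?thesis by simp
  qed
  have "((\<lambda>x. R x (Ad x v)) has_derivative
      (\<lambda>h. fderiv (\<lambda>x. R x (Ad e0 v)) e0 h + R e0 (fderiv (\<lambda>x. Ad x v) e0 h))) (at e0)"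
    by (rule has_derivative_apply_linear[OF eventually_mono[OF ev_V[OF e0_in] linR] dR
          fderiv_works[OF Ad_differentiable[OF e0_V1]]])
  then have "fderiv (\<lambda>x. R x (Ad x v)) e0 u = fderiv (\<lambda>x. R x v) e0 u + R e0 (fderiv (\<lambda>x. Ad x v) e0 u)"
    by (simp add: fderiv_eqI)
  moreover have "fderiv (E v) e0 = fderiv (\<lambda>x. R x (Ad x v)) e0"
    by (rule fderiv_cong_nhds) (rule eventually_mono[OF ev_V1[OF e0_V1] eq])
  moreover have "R e0 w = w" for w
    using fderiv_mu_unit(1)[OF e0_in] by (simp add: R_def)
  moreover have "fderiv (\<lambda>x. R x v) e0 u = fderiv2 mu (e0, e0) (0, u) (v, 0)"
  proof -
    have "fderiv (\<lambda>x. fderiv mu (e0, x) (v, 0)) e0 u = fderiv2 mu (e0, e0) (fderiv (\<lambda>x. (e0, x)) e0 u) (v, 0)"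
      by (rule fderiv_compose[of "\<lambda>z. fderiv mu z (v, 0)" "\<lambda>x. (e0, x)"])
        (rule dmu, simp add: twice_diff_differentiable twice_diff_Pair)
    then show ?thesis by (simp add: R_def fderiv_Pair)
  qed
  moreover have "P u v = fderiv2 mu (e0, e0) (v, 0) (0, u)"
  proof -
    have "fderiv (\<lambda>x. fderiv mu (x, e0) (0, u)) e0 v = fderiv2 mu (e0, e0) (fderiv (\<lambda>x. (x, e0)) e0 v) (0, u)"
      by (rule fderiv_compose[of "\<lambda>z. fderiv mu z (0, u)" "\<lambda>x. (x, e0)"])
        (rule dmu, simp add: twice_diff_differentiable twice_diff_Pair)
    then show ?thesis by (simp add: P_def E_def[abs_def] fderiv_Pair)
  qed
  ultimately show ?thesis
    unfolding br_eq P_def[of v] fderiv2_symmetric[OF mu0[OF e0_in], of "(0, u)" "(v, 0)"]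
    by (metis add_diff_cancel_left')
qed

end

primrec upper_central :: "('e::real_vector \<Rightarrow> 'e \<Rightarrow> 'e) \<Rightarrow> nat \<Rightarrow> 'e set" where
  "upper_central b 0 = {0}"
| "upper_central b (Suc k) = {v. \<forall>u. b u v \<in> upper_central b k}"

lemma subspace_upper_central:
  assumes "\<And>u. linear (b u)" shows "subspace (upper_central b k)"
proof (induction k)
  case (Suc k)
  then show ?case
    by (auto simp: subspace_def linear_0[OF assms] linear_add[OF assms] linear_scale[OF assms])
qed (simp add: subspace_0)

context lie_chart
begin

lemma jacobi: "br u (br v w) = br (br u v) w + br v (br u w)"
proof -
  note dAd = Ad_differentiable[OF e0_V1]
  have "fderiv (\<lambda>x. br (Ad x v) (Ad x w)) e0 u = br (br u v) w + br v (br u w)"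
    using fderiv_bilinear[OF bilinear_br dAd dAd] by (simp add: fderiv_Ad add.commute)
  moreover have "fderiv (\<lambda>x. br (Ad x v) (Ad x w)) e0 = fderiv (\<lambda>x. Ad x (br v w)) e0"
    by (rule fderiv_cong_nhds, rule eventually_mono[OF ev_V1[OF e0_V1]]) (rule Ad_bracket)
  ultimately show ?thesis by (simp add: fderiv_Ad)
qed

lemma reg_cj_compose:
  assumes x: "x \<in> V1" and f: "reg f z" "f z = \<one>"
  shows "reg (\<lambda>y. cj x (f y)) z" "fderiv (\<lambda>y. K (cj x (f y))) z v = Ad x (fderiv (\<lambda>y. K (f y)) z v)"
proof -
  have eq: "\<forall>\<^sub>F y in nhds z. cj x (Ki (K (f y))) = cj x (f y)"
    using f(1) unfolding chart_reg_def by (auto simp: Ki_K elim: eventually_mono)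
  have eqK: "\<forall>\<^sub>F y in nhds z. K (cj x (Ki (K (f y)))) = K (cj x (f y))"
    using eq by (rule eventually_mono) simp
  have r: "reg (\<lambda>y. cj x (Ki y)) (K (f z))" using reg_cj_e0[OF x] f(2) by simp
  have "reg (\<lambda>y. cj x (Ki (K (f y)))) z"
    using chart_reg_compose[where f = "\<lambda>y. cj x (Ki y)" and g = "\<lambda>y. K (f y)" and z = z and d = c] r f(1)
    by (simp add: chart_reg_def)
  with eq show "reg (\<lambda>y. cj x (f y)) z" by (rule chart_reg_cong)
  have "fderiv (\<lambda>y. K (cj x (Ki (K (f y))))) z v =
      fderiv (\<lambda>y. K (cj x (Ki y))) (K (f z)) (fderiv (\<lambda>y. K (f y)) z v)"
    by (rule fderiv_compose[of "\<lambda>y. K (cj x (Ki y))" "\<lambda>y. K (f y)"])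
      (use chart_reg_diff[OF r] chart_reg_diff[OF f(1)] in simp_all)
  then show "fderiv (\<lambda>y. K (cj x (f y))) z v = Ad x (fderiv (\<lambda>y. K (f y)) z v)"
    using fderiv_cong_nhds[OF eqK] f(2) by (simp add: Ad_def)
qed

lemma fderiv_inv:
  assumes f: "reg f z" "f z = \<one>"
  shows "reg (\<lambda>y. inv (f y)) z" "fderiv (\<lambda>y. K (inv (f y))) z v = - fderiv (\<lambda>y. K (f y)) z v"
proof -
  show i: "reg (\<lambda>y. inv (f y)) z" using reg_inv[OF f(1)] f(2) one_in by simp
  have "fderiv (\<lambda>y. K (f y \<otimes> inv (f y))) z v =
      fderiv (\<lambda>y. K (f y)) z v + fderiv (\<lambda>y. K (inv (f y))) z v"
    using fderiv_mult_right[OF f(1) i, of v] f(2) by simp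
  then show "fderiv (\<lambda>y. K (inv (f y))) z v = - fderiv (\<lambda>y. K (f y)) z v"
    by (simp add: eq_neg_iff_add_eq_0 add.commute)
qed

lemma fderiv_commutator:
  assumes x: "x \<in> V1" and f: "reg f z" "f z = \<one>"
  shows "reg (\<lambda>y. cj x (f y) \<otimes> inv (f y)) z"
    "fderiv (\<lambda>y. K (cj x (f y) \<otimes> inv (f y))) z v =
      Ad x (fderiv (\<lambda>y. K (f y)) z v) - fderiv (\<lambda>y. K (f y)) z v"
proof -
  note 1 = reg_cj_compose[OF x f] and 2 = fderiv_inv[OF f]
  show "reg (\<lambda>y. cj x (f y) \<otimes> inv (f y)) z"
    using reg_mult(1)[OF 1(1) 2(1)] f(2) one_in by simp
  show "fderiv (\<lambda>y. K (cj x (f y) \<otimes> inv (f y))) z v =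
      Ad x (fderiv (\<lambda>y. K (f y)) z v) - fderiv (\<lambda>y. K (f y)) z v"
    using fderiv_mult_right[OF 1(1) 2(1), of v] f(2) by (simp add: 1(2) 2(2))
qed

text \<open>
  By induction on \<open>k\<close>: the commutator of \<open>x\<close> with \<open>f\<close> has derivative \<open>(Ad x - 1) (df)\<close>, and
  differentiating this in \<open>x\<close> turns \<open>Ad x - 1\<close> into a bracket.
\<close>

lemma fderiv_lower_central:
  fixes f :: "'x::real_normed_vector \<Rightarrow> 'm"
  assumes "reg f z" "f z = \<one>" "\<forall>\<^sub>F y in nhds z. f y \<in> lower_central N j"
    and "lower_central N (j + k) = {\<one>}"
  shows "fderiv (\<lambda>y. K (f y)) z v \<in> upper_central br k"
  using assms
proof (induction k arbitrary: j f)
  case 0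
  then have "\<forall>\<^sub>F y in nhds z. K (f y) = e0" by (auto elim: eventually_mono)
  then show ?case using fderiv_cong_nhds[of "\<lambda>y. K (f y)" "\<lambda>y. e0" z] by simp
next
  case (Suc k)
  let ?w = "fderiv (\<lambda>y. K (f y)) z v"
  have "Ad x ?w - ?w \<in> upper_central br k" if x: "x \<in> V1" for x
  proof -
    note r = fderiv_commutator[OF x Suc.prems(1,2)]
    have "\<forall>\<^sub>F y in nhds z. cj x (f y) \<otimes> inv (f y) \<in> lower_central N (Suc j)"
      using Suc.prems(3)
    proof eventually_elim
      case (elim y)
      have "Ki x \<otimes> f y \<otimes> inv (Ki x) \<otimes> inv (f y) \<in> generate N
        {x \<otimes> y \<otimes> inv x \<otimes> inv y | x y. x \<in> carrier N \<and> y \<in> lower_central N j}"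
        using elim by (intro generate.incl) auto
      then show ?case by (simp add: cj_def)
    qed
    then show ?thesis
      using Suc.IH[OF r(1), of "Suc j"] Suc.prems(2,4) by (simp add: r(2))
  qed
  then have "\<forall>\<^sub>F x in nhds e0. Ad x ?w - ?w \<in> upper_central br k"
    using ev_V1[OF e0_V1] by (auto elim: eventually_mono)
  moreover have "((\<lambda>x. Ad x ?w - ?w) has_derivative (\<lambda>h. fderiv (\<lambda>x. Ad x ?w) e0 h - 0)) (at e0)"
    by (intro has_derivative_diff has_derivative_const fderiv_works Ad_differentiable e0_V1)
  ultimately have "fderiv (\<lambda>x. Ad x ?w - ?w) e0 u \<in> upper_central br k" for u
    by (intro fderiv_in_subspace subspace_upper_central linear_br_right) (auto simp: differentiable_def)
  then show ?case
    using fderiv_eqI[OF \<open>((\<lambda>x. Ad x ?w - ?w) has_derivative _) _\<close>] by (simp add: fderiv_Ad)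
qed

lemma nilpotent_bracket:
  assumes "nilpotent_group N"
  shows "\<exists>k. upper_central br k = UNIV"
proof -
  obtain k where k: "lower_central N k = {\<one>}"
    using assms by (auto simp: nilpotent_group_def)
  have "v \<in> upper_central br k" for v
    using fderiv_lower_central[of Ki e0 0 k v] reg_Ki[OF e0_in] k by (simp add: fderiv_K_Ki e0_in)
  then show ?thesis by blast
qed

lemma E_surj: "x \<in> V1 \<Longrightarrow> \<exists>u. E u x = w"
proof -
  assume x: "x \<in> V1"
  have r: "reg (\<lambda>y. inv (Ki x) \<otimes> Ki y) x"
    using reg_mult(1)[OF chart_reg_const reg_Ki[OF V1_V[OF x]], of "inv (Ki x)"] x one_in by (simp add: V1_def)
  have "fderiv (\<lambda>y. K (inv (Ki x) \<otimes> Ki y)) x (E u x) = u" for u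
    using fderiv_E_equivariant[of "\<lambda>q. inv (Ki x) \<otimes> q" "\<lambda>q. q" x u, OF _ _ V1_V[OF x] r reg_Ki[OF e0_in]]
    by (simp add: m_assoc fderiv_K_Ki e0_in)
  then have "inj (\<lambda>u. E u x)" by (rule inj_on_inverseI)
  then have "surj (\<lambda>u. E u x)"
    by (rule linear_injective_imp_surjective[OF linear_E[OF V1_V[OF x]]]) simp
  from surjD[OF this, of w] show ?thesis by blast
qed

lemma fderiv_zero_if_E_zero:
  assumes "x \<in> V1" "\<And>u. fderiv f x (E u x) = 0"
  shows "fderiv f x = (\<lambda>h. 0)"
proof
  fix h
  obtain u where "E u x = h" using E_surj[OF assms(1)] by blast
  then show "fderiv f x h = 0" using assms(2)[of u] by simp
qed

lemma Ad_mult: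
  assumes x: "x \<in> V1" and s: "s \<in> V1" and xs: "Ki x \<otimes> Ki s \<in> fst c"
  shows "Ad (K (Ki x \<otimes> Ki s)) v = Ad x (Ad s v)"
proof -
  have "cj (K (Ki x \<otimes> Ki s)) q = cj x (cj s q)" for q
    by (simp add: cj_def Ki_K[OF xs] m_assoc inv_mult_group)
  then have "Ad (K (Ki x \<otimes> Ki s)) v = fderiv (\<lambda>y. K (cj x (cj s (Ki y)))) e0 v"
    by (simp add: Ad_def)
  also have "\<dots> = Ad x (Ad s v)"
    using reg_cj_compose(2)[OF x reg_cj_e0[OF s], of v] by (simp add: Ad_def)
  finally show ?thesis .
qed

lemma Ad_trivial_near:
  assumes br0: "\<And>u v. br u v = 0"
  obtains r where "r > 0" "ball e0 r \<subseteq> V1" "\<And>x v. x \<in> ball e0 r \<Longrightarrow> Ad x v = v"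
proof -
  obtain r where r: "r > 0" "ball e0 r \<subseteq> V1"
    using open_V1 e0_V1 open_contains_ball by blast
  have D0: "fderiv (\<lambda>x. Ad x v) x = (\<lambda>h. 0)" if x: "x \<in> V1" for x v
  proof (rule fderiv_zero_if_E_zero[OF x])
    fix u
    note rg = left_translation(1)[OF V1_V[OF x]]
    have "fderiv (\<lambda>s. K (Ki x \<otimes> Ki s)) e0 u = E u x" by (rule left_translation(2)[OF V1_V[OF x]])
    moreover have "fderiv (\<lambda>s. Ad (K (Ki x \<otimes> Ki s)) v) e0 u =
        fderiv (\<lambda>x. Ad x v) (K (Ki x \<otimes> Ki e0)) (fderiv (\<lambda>s. K (Ki x \<otimes> Ki s)) e0 u)"
      by (rule fderiv_compose[of "\<lambda>x. Ad x v" "\<lambda>s. K (Ki x \<otimes> Ki s)"])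
        (use Ad_differentiable[OF x] chart_reg_diff[OF rg] V1_V[OF x] in \<open>simp_all add: K_Ki\<close>)
    moreover have "fderiv (\<lambda>s. Ad (K (Ki x \<otimes> Ki s)) v) e0 = fderiv (\<lambda>s. Ad x (Ad s v)) e0"
    proof (rule fderiv_cong_nhds)
      have "\<forall>\<^sub>F s in nhds e0. Ki x \<otimes> Ki s \<in> fst c" using rg by (simp add: chart_reg_def)
      then show "\<forall>\<^sub>F s in nhds e0. Ad (K (Ki x \<otimes> Ki s)) v = Ad x (Ad s v)"
        using ev_V1[OF e0_V1] by eventually_elim (rule Ad_mult[OF x])
    qed
    moreover have "fderiv (\<lambda>s. Ad x (Ad s v)) e0 u = Ad x (br u v)"
      using fderiv_linear_compose(2)[OF linear_Ad[OF x] Ad_differentiable[OF e0_V1]] by (simp add: fderiv_Ad)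
    ultimately show "fderiv (\<lambda>x. Ad x v) x (E u x) = 0"
      using V1_V[OF x] linear_0[OF linear_Ad[OF x]] by (simp add: K_Ki br0)
  qed
  have "Ad x v = v" if "x \<in> ball e0 r" for x v
  proof -
    have "\<exists>a. \<forall>x\<in>ball e0 r. Ad x v = a"
    proof (rule has_derivative_zero_constant)
      fix y assume "y \<in> ball e0 r"
      then have "y \<in> V1" using r by blast
      then show "((\<lambda>x. Ad x v) has_derivative (\<lambda>h. 0)) (at y within ball e0 r)"
        using fderiv_works[OF Ad_differentiable, of y v] D0[of y v]
        by (simp add: has_derivative_at_withinI)
    qed simp
    then show ?thesis using that r(1) Ad_e0 by (metis centre_in_ball)
  qed
  then show thesis using r that by blast
qed

lemma commute_near:
  assumes x: "x \<in> V1" and Ad: "\<And>v. Ad x v = v"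
  shows "\<forall>\<^sub>F y in nhds e0. cj x (Ki y) = Ki y"
proof -
  let ?\<phi> = "\<lambda>q. cj x q \<otimes> inv q"
  have r0: "reg (\<lambda>y. ?\<phi> (Ki y)) e0" and d0: "fderiv (\<lambda>y. K (?\<phi> (Ki y))) e0 u = 0" for u
    using fderiv_commutator[OF x reg_Ki[OF e0_in]] Ad by simp_all
  have "\<forall>\<^sub>F y in nhds e0. y \<in> V1 \<and> reg (\<lambda>y. ?\<phi> (Ki y)) y \<and> cj x (Ki y) \<in> fst c"
  proof -
    have "\<forall>\<^sub>F y in nhds e0. ?\<phi> (Ki y) \<in> fst c" using r0 by (simp add: chart_reg_def)
    then show ?thesis
      using ev_reg_cj[OF x] ev_V1[OF e0_V1]
    proof eventually_elim
      case (elim y)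
      have "reg (\<lambda>y. inv (Ki y)) y"
        using reg_inv[OF reg_Ki[OF V1_V[OF elim(3)]]] elim(3) by (simp add: V1_def)
      then show ?case
        using reg_mult(1)[OF elim(2)] elim chart_reg_in[OF elim(2)] by simp
    qed
  qed
  then obtain r where r: "r > 0"
    "\<And>y. y \<in> ball e0 r \<Longrightarrow> y \<in> V1 \<and> reg (\<lambda>y. ?\<phi> (Ki y)) y \<and> cj x (Ki y) \<in> fst c"
    unfolding eventually_nhds_metric by (auto simp: dist_commute)
  have D0: "fderiv (\<lambda>y. K (?\<phi> (Ki y))) y = (\<lambda>h. 0)" if yb: "y \<in> ball e0 r" for y
  proof (rule fderiv_zero_if_E_zero)
    show y: "y \<in> V1" using r(2)[OF yb] by simp
    have ry: "reg (\<lambda>y. ?\<phi> (Ki y)) y" and cy: "cj x (Ki y) \<in> fst c" using r(2)[OF yb] by auto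
    have iy: "inv (Ki y) \<in> fst c" using y by (simp add: V1_def)
    fix u
    let ?t = "\<lambda>s. Ki y \<otimes> Ki s"
    note rg = left_translation(1)[OF V1_V[OF y]] and dE = left_translation(2)[OF V1_V[OF y], of u]
    have 1: "fderiv (\<lambda>s. (\<lambda>y. K (?\<phi> (Ki y))) (K (?t s))) e0 u =
        fderiv (\<lambda>y. K (?\<phi> (Ki y))) (K (?t e0)) (fderiv (\<lambda>s. K (?t s)) e0 u)"
      by (rule fderiv_compose[of "\<lambda>y. K (?\<phi> (Ki y))" "\<lambda>s. K (?t s)"])
        (use chart_reg_diff[OF ry] chart_reg_diff[OF rg] V1_V[OF y] in \<open>simp_all add: K_Ki\<close>)
    have eq: "?\<phi> (?t s) = cj x (Ki y) \<otimes> (?\<phi> (Ki s) \<otimes> inv (Ki y))" for s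
      by (simp add: cj_mult inv_mult_group m_assoc)
    have 2: "fderiv (\<lambda>s. (\<lambda>y. K (?\<phi> (Ki y))) (K (?t s))) e0 =
        fderiv (\<lambda>s. K (cj x (Ki y) \<otimes> (?\<phi> (Ki s) \<otimes> inv (Ki y)))) e0"
    proof (rule fderiv_cong_nhds)
      have "\<forall>\<^sub>F s in nhds e0. ?t s \<in> fst c" using rg by (simp add: chart_reg_def)
      then show "\<forall>\<^sub>F s in nhds e0. K (?\<phi> (Ki (K (?t s)))) = K (cj x (Ki y) \<otimes> (?\<phi> (Ki s) \<otimes> inv (Ki y)))"
        by (rule eventually_mono) (simp only: Ki_K eq)
    qed
    have lin0: "fderiv mu (K p, K q) (0, 0) = 0" if "p \<in> fst c" "q \<in> fst c" "p \<otimes> q \<in> fst c" for p q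
      using linear_0[OF linear_fderiv[OF mu_twice_diff, of "K p" "K q"]] that
      by (simp add: Ki_K zero_prod_def)
    have c1: "reg (\<lambda>s. inv (Ki y)) e0" using iy by (rule chart_reg_const)
    have r3: "reg (\<lambda>s. ?\<phi> (Ki s) \<otimes> inv (Ki y)) e0"
      using reg_mult(1)[OF r0 c1] iy by simp
    have 3: "fderiv (\<lambda>s. K (?\<phi> (Ki s) \<otimes> inv (Ki y))) e0 u = 0"
      using reg_mult(2)[OF r0 c1, of u] iy lin0[OF one_in iy] by (simp add: d0)
    have c2: "reg (\<lambda>s. cj x (Ki y)) e0" using cy by (rule chart_reg_const)
    have 4: "fderiv (\<lambda>s. K (cj x (Ki y) \<otimes> (?\<phi> (Ki s) \<otimes> inv (Ki y)))) e0 u = 0"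
      using reg_mult(2)[OF c2 r3, of u] chart_reg_in[OF ry] lin0[OF cy iy] by (simp add: 3)
    show "fderiv (\<lambda>y. K (?\<phi> (Ki y))) y (E u y) = 0"
      using 1 2 4 dE V1_V[OF y] by (simp add: K_Ki)
  qed
  have "\<exists>a. \<forall>y\<in>ball e0 r. K (?\<phi> (Ki y)) = a"
  proof (rule has_derivative_zero_constant)
    fix y assume y: "y \<in> ball e0 r"
    then have "reg (\<lambda>y. ?\<phi> (Ki y)) y" using r by blast
    from fderiv_works[OF chart_reg_diff[OF this]]
    show "((\<lambda>y. K (?\<phi> (Ki y))) has_derivative (\<lambda>h. 0)) (at y within ball e0 r)"
      unfolding D0[OF y] by (rule has_derivative_at_withinI)
  qed simp
  then obtain a where a: "\<And>y. y \<in> ball e0 r \<Longrightarrow> K (?\<phi> (Ki y)) = a" by blast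
  have "cj x (Ki y) = Ki y" if y: "y \<in> ball e0 r" for y
  proof -
    have "K (?\<phi> (Ki y)) = e0" using a[OF y] a[of e0] r(1) by simp
    moreover have "?\<phi> (Ki y) \<in> fst c"
      using r(2)[OF y] chart_reg_in[of c "\<lambda>y. ?\<phi> (Ki y)" y] by blast
    ultimately have "?\<phi> (Ki y) = \<one>"
      using Ki_K Ki_e0 by metis
    then have "cj x (Ki y) \<otimes> inv (Ki y) \<otimes> Ki y = Ki y" by simp
    then show ?thesis by (simp add: m_assoc)
  qed
  then show ?thesis
    unfolding eventually_nhds_metric using r(1) by (auto simp: dist_commute)
qed

lemma continuous_left_mult: "continuous_on UNIV (\<lambda>q. p \<otimes> q)"
proof -
  have "continuous_on UNIV (\<lambda>(x, y). x \<otimes> y)" using smooth_mult by (simp add: smooth_map_def)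
  then have "continuous_on UNIV (\<lambda>q. (\<lambda>(x, y). x \<otimes> y) (p, q))"
    by (rule continuous_on_compose2) (auto intro!: continuous_intros)
  then show ?thesis by simp
qed

lemma connected_group_generated:
  assumes con: "connected (UNIV :: 'm set)"
    and mult: "\<And>p q. p \<in> S \<Longrightarrow> q \<in> S \<Longrightarrow> p \<otimes> q \<in> S" and inv: "\<And>p. p \<in> S \<Longrightarrow> inv p \<in> S"
    and B: "open B" "e0 \<in> B" "\<And>y. y \<in> B \<Longrightarrow> y \<in> V \<Longrightarrow> Ki y \<in> S"
  shows "S = UNIV"
proof -
  define T where "T = K -` B \<inter> fst c"
  have T: "open T"
    unfolding T_def using continuous_on_open_vimage[OF open_chart_domain[OF chart_c], of K]
      continuous_on_chart[OF chart_c] B(1) by blast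
  have oneT: "\<one> \<in> T" using B(2) one_in by (simp add: T_def)
  have TS: "p \<in> S" if "p \<in> T" for p
    using B(3)[of "K p"] that by (auto simp: T_def Ki_K)
  define L where "L p = (\<lambda>q. inv p \<otimes> q) -` T" for p
  have L: "open (L p)" "p \<in> L p" for p
    unfolding L_def using T continuous_left_mult oneT
    by (metis continuous_on_open_vimage open_UNIV inf_top.right_neutral) (simp add: oneT)
  have 1: "L p \<subseteq> S" if "p \<in> S" for p
  proof
    fix q assume "q \<in> L p"
    then have "p \<otimes> (inv p \<otimes> q) \<in> S" using mult[OF that TS[of "inv p \<otimes> q"]] by (simp add: L_def)
    then show "q \<in> S" by (simp add: m_assoc[symmetric])
  qed
  have 2: "L p \<subseteq> - S" if "p \<notin> S" for p
  proof
    fix q assume q: "q \<in> L p"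
    have "p \<in> S" if "q \<in> S"
    proof -
      have "q \<otimes> inv (inv p \<otimes> q) \<in> S" using mult[OF that inv[OF TS[of "inv p \<otimes> q"]]] q by (simp add: L_def)
      then show ?thesis by (simp add: inv_mult_group m_assoc[symmetric])
    qed
    then show "q \<in> - S" using \<open>p \<notin> S\<close> by blast
  qed
  have "open S" using 1 L by (subst open_subopen) blast
  moreover have "open (- S)" using 2 L by (subst open_subopen) blast
  moreover have "S \<noteq> {}" using TS oneT by blast
  ultimately show ?thesis
    using con connectedD[of UNIV S "- S"] by blast
qed

lemma abelian_if_bracket_zero:
  assumes con: "connected (UNIV :: 'm set)" and br0: "\<And>u v. br u v = 0"
  shows "comm_group N"
proof -
  obtain r where r: "r > 0" "ball e0 r \<subseteq> V1" "\<And>x v. x \<in> ball e0 r \<Longrightarrow> Ad x v = v"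
    using Ad_trivial_near[OF br0] by blast
  have comm_mult: "p \<otimes> q \<otimes> s = s \<otimes> (p \<otimes> q)" if "p \<otimes> s = s \<otimes> p" "q \<otimes> s = s \<otimes> q" for p q s
  proof -
    have "p \<otimes> q \<otimes> s = p \<otimes> (q \<otimes> s)" by (simp add: m_assoc)
    also have "\<dots> = p \<otimes> s \<otimes> q" unfolding that(2) by (simp add: m_assoc)
    also have "\<dots> = s \<otimes> (p \<otimes> q)" unfolding that(1) by (simp add: m_assoc)
    finally show ?thesis .
  qed
  have comm_inv: "inv p \<otimes> s = s \<otimes> inv p" if "p \<otimes> s = s \<otimes> p" for p s
  proof -
    have "inv p \<otimes> s = inv p \<otimes> (s \<otimes> p) \<otimes> inv p" by (simp add: m_assoc)
    also have "\<dots> = (inv p \<otimes> p) \<otimes> s \<otimes> inv p" unfolding that[symmetric] by (simp only: m_assoc carrier_UNIV UNIV_I)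
    finally show ?thesis by simp
  qed
  have near: "q \<otimes> Ki x = Ki x \<otimes> q" if x: "x \<in> ball e0 r" for x q
  proof -
    have "\<forall>\<^sub>F y in nhds e0. cj x (Ki y) = Ki y"
      by (rule commute_near[OF subsetD[OF r(2) x] r(3)[OF x]])
    then obtain B where B: "open B" "e0 \<in> B" "\<And>y. y \<in> B \<Longrightarrow> cj x (Ki y) = Ki y"
      unfolding eventually_nhds by blast
    have "{q. q \<otimes> Ki x = Ki x \<otimes> q} = UNIV"
    proof (rule connected_group_generated[OF con _ _ B(1,2)])
      show "p \<otimes> q \<in> {q. q \<otimes> Ki x = Ki x \<otimes> q}"
        if "p \<in> {q. q \<otimes> Ki x = Ki x \<otimes> q}" "q \<in> {q. q \<otimes> Ki x = Ki x \<otimes> q}" for p q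
        using that comm_mult by blast
      show "inv p \<in> {q. q \<otimes> Ki x = Ki x \<otimes> q}" if "p \<in> {q. q \<otimes> Ki x = Ki x \<otimes> q}" for p
        using that comm_inv by blast
      fix y assume "y \<in> B"
      then have "Ki x \<otimes> Ki y \<otimes> inv (Ki x) = Ki y" using B(3) by (simp add: cj_def)
      then have "Ki y \<otimes> Ki x = Ki x \<otimes> Ki y \<otimes> inv (Ki x) \<otimes> Ki x" by simp
      also have "\<dots> = Ki x \<otimes> Ki y" by (simp add: m_assoc)
      finally show "Ki y \<in> {q. q \<otimes> Ki x = Ki x \<otimes> q}" by simp
    qed
    then show ?thesis by blast
  qed
  have "{q. \<forall>s. q \<otimes> s = s \<otimes> q} = UNIV"
  proof (rule connected_group_generated[OF con])
    show "open (ball e0 r)" "e0 \<in> ball e0 r" using r by auto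
    show "Ki y \<in> {q. \<forall>s. q \<otimes> s = s \<otimes> q}" if "y \<in> ball e0 r" for y
      using near[OF that] by (intro CollectI allI) (rule sym)
    show "p \<otimes> q \<in> {q. \<forall>s. q \<otimes> s = s \<otimes> q}"
      if "p \<in> {q. \<forall>s. q \<otimes> s = s \<otimes> q}" "q \<in> {q. \<forall>s. q \<otimes> s = s \<otimes> q}" for p q
      using that comm_mult by blast
    show "inv p \<in> {q. \<forall>s. q \<otimes> s = s \<otimes> q}" if "p \<in> {q. \<forall>s. q \<otimes> s = s \<otimes> q}" for p
      using that comm_inv by blast
  qed
  then have "p \<otimes> q = q \<otimes> p" for p q by blast
  then show ?thesis by (intro group_comm_groupI)
qed

end

section \<open>Left-invariant metrics and geodesics\<close>

lemma chart_reg_velocity: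
  assumes r: "chart_reg d \<gamma> t"
  shows "velocity d \<gamma> t = fderiv (\<lambda>s. snd d (\<gamma> s)) t 1"
    and "velocity d \<gamma> differentiable (at t)"
    and "acceleration d \<gamma> t = fderiv2 (\<lambda>s. snd d (\<gamma> s)) t 1 1"
proof -
  let ?y = "\<lambda>s. snd d (\<gamma> s)"
  have td: "twice_diff ?y t" using r by (simp add: chart_reg_def)
  show "velocity d \<gamma> t = fderiv ?y t 1"
    using fderiv_real[OF twice_diff_differentiable[OF td], of 1] by (simp add: velocity_def)
  have "\<forall>\<^sub>F s in nhds t. ?y differentiable (at s)"
    using td by (simp add: twice_diff_def)
  then have ev: "\<forall>\<^sub>F s in nhds t. fderiv ?y s 1 = velocity d \<gamma> s"
    by (rule eventually_mono) (simp add: velocity_def fderiv_real)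
  have D: "(\<lambda>s. fderiv ?y s 1) differentiable (at t)"
    using td unfolding twice_diff_def by blast
  show D': "velocity d \<gamma> differentiable (at t)"
    by (rule differentiable_cong_nhds[OF ev D])
  show "acceleration d \<gamma> t = fderiv2 ?y t 1 1"
    using fderiv_real[OF D', of 1] fderiv_cong_nhds[OF ev] by (simp add: acceleration_def)
qed

locale lie_metric = lie_chart N A c
  for N :: "'m::{t2_space, second_countable_topology} monoid" (structure)
    and A :: "('m, 'e::euclidean_space) chart set" and c :: "('m, 'e) chart" +
  fixes ds2 :: "('m, 'e) metric"
  assumes metric: "pseudo_riemannian_metric A ds2" and left_inv: "left_invariant_metric N A ds2"
begin

abbreviation "ip \<equiv> ds2 c \<one>"

lemma metric_bilinear: "d \<in> A \<Longrightarrow> p \<in> fst d \<Longrightarrow> bilinear (ds2 d p)"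
  and metric_sym: "d \<in> A \<Longrightarrow> p \<in> fst d \<Longrightarrow> ds2 d p u v = ds2 d p v u"
  and metric_nondeg: "d \<in> A \<Longrightarrow> p \<in> fst d \<Longrightarrow> nondegenerate_on (ds2 d p) UNIV"
  using metric by (auto simp: pseudo_riemannian_metric_def)

lemma metric_twice_diff:
  assumes "d \<in> A" "x \<in> snd d ` fst d"
  shows "twice_diff (\<lambda>x. ds2 d (chart_inv d x) u v) x"
proof (rule smooth_on_twice_diff)
  show "smooth_on (\<lambda>x. ds2 d (chart_inv d x) u v) (snd d ` fst d)"
    using metric assms(1) unfolding pseudo_riemannian_metric_def by blast
qed (use assms open_chart_range[OF charts[OF assms(1)]] in auto)

lemma bilinear_ip: "bilinear ip"
  using metric_bilinear[OF cA one_in] .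
lemma ip_sym: "ip u v = ip v u"
  by (rule metric_sym[OF cA one_in])
lemma linear_ip: "linear (ip u)" "linear (\<lambda>u. ip u v)"
  using bilinear_ip by (auto simp: bilinear_def)

lemma isometry_left: "isometry A ds2 (\<lambda>q. p \<otimes> q)"
  using left_inv by (simp add: left_invariant_metric_def)

lemma metric_E: "x \<in> V \<Longrightarrow> ds2 c (Ki x) (E u x) (E v x) = ip u v"
proof -
  assume x: "x \<in> V"
  have "preserves_metric A ds2 (\<lambda>q. Ki x \<otimes> q)"
    using isometry_left by (simp add: isometry_def)
  then have "ds2 c (Ki x \<otimes> \<one>) (differential c c (\<lambda>q. Ki x \<otimes> q) \<one> u) (differential c c (\<lambda>q. Ki x \<otimes> q) \<one> v) = ip u v"
    using cA one_in Ki_in[OF x] unfolding preserves_metric_def by (metis UNIV_I carrier_UNIV r_one)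
  moreover have "differential c c (\<lambda>q. Ki x \<otimes> q) \<one> u = E u x" for u
    using left_invariant_field_eq[OF x, of u] by (simp add: left_invariant_field_def)
  ultimately show ?thesis by simp
qed

lemma metric_family:
  assumes "d \<in> A" "x \<in> snd d ` fst d"
  shows "\<forall>\<^sub>F z in nhds x. bilinear (ds2 d (chart_inv d z))"
    and "(\<lambda>z. ds2 d (chart_inv d z) u v) differentiable (at x)"
proof -
  have "\<forall>\<^sub>F z in nhds x. z \<in> snd d ` fst d"
    using assms(2) open_chart_range[OF charts[OF assms(1)]] by (rule eventually_nhds_in_open[rotated])
  then show "\<forall>\<^sub>F z in nhds x. bilinear (ds2 d (chart_inv d z))"
    by (rule eventually_mono) (intro metric_bilinear assms chart_inv_in)
  show "(\<lambda>z. ds2 d (chart_inv d z) u v) differentiable (at x)"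
    by (rule twice_diff_differentiable[OF metric_twice_diff[OF assms]])
qed

lemma metric_deriv_e0: "metric_deriv ds2 c \<one> w u v = - ip (P u w) v - ip u (P v w)"
proof -
  have "((\<lambda>x. ds2 c (Ki x) (E u x) (E v x)) has_derivative
      (\<lambda>h. fderiv (\<lambda>z. ds2 c (Ki z) (E u e0) (E v e0)) e0 h + ds2 c (Ki e0) (fderiv (E u) e0 h) (E v e0)
        + ds2 c (Ki e0) (E u e0) (fderiv (E v) e0 h))) (at e0)"
    by (rule has_derivative_bilinear_family[OF metric_family[OF cA e0_in]
          fderiv_works[OF twice_diff_differentiable[OF E_twice_diff[OF e0_in]]]
          fderiv_works[OF twice_diff_differentiable[OF E_twice_diff[OF e0_in]]]])
  moreover have "fderiv (\<lambda>x. ds2 c (Ki x) (E u x) (E v x)) e0 w = 0"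
    using fderiv_cong_nhds[of "\<lambda>x. ds2 c (Ki x) (E u x) (E v x)" "\<lambda>x. ip u v" e0,
        OF eventually_mono[OF ev_V[OF e0_in] metric_E]] by simp
  ultimately have "metric_deriv ds2 c \<one> w u v + ip (P u w) v + ip u (P v w) = 0"
    by (simp add: fderiv_eqI metric_deriv_def P_def)
  then show ?thesis by simp
qed

lemma christoffel_e0: "christoffel ds2 c \<one> u u w = - ip (P u u) w - ip u (br u w)"
proof -
  have "ip u (br u w) = ip u (P w u) - ip u (P u w)"
    by (simp add: br_eq linear_diff[OF linear_ip(1)])
  moreover have "ip (P u w) u = ip u (P u w)" by (rule ip_sym)
  ultimately show ?thesis
    unfolding christoffel_def metric_deriv_e0 by (simp add: field_simps)
qed

lemma christoffel_transform:
  assumes F: "isometry A ds2 F" and d: "d \<in> A" "d' \<in> A" and p: "p \<in> fst d" "F p \<in> fst d'"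
  defines "\<Psi> \<equiv> coord_map d d' F" and "x \<equiv> snd d p"
  shows "ds2 d p u v = ds2 d' (F p) (fderiv \<Psi> x u) (fderiv \<Psi> x v)"
    and "christoffel ds2 d p u u w =
      christoffel ds2 d' (F p) (fderiv \<Psi> x u) (fderiv \<Psi> x u) (fderiv \<Psi> x w)
      + ds2 d' (F p) (fderiv2 \<Psi> x u u) (fderiv \<Psi> x w)"
proof -
  have sm: "smooth_map A A F" and pm: "preserves_metric A ds2 F"
    using F by (auto simp: isometry_def)
  note chd = charts[OF d(1)] charts[OF d(2)]
  note td = coord_map_twice_diff[OF sm d chd p, folded \<Psi>_def x_def]
  have pres: "ds2 d' (F q) (fderiv \<Psi> (snd d q) u) (fderiv \<Psi> (snd d q) v) = ds2 d q u v"
    if "q \<in> fst d" "F q \<in> fst d'" for q u v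
    using pm d that unfolding preserves_metric_def differential_def \<Psi>_def by blast
  show "ds2 d p u v = ds2 d' (F p) (fderiv \<Psi> x u) (fderiv \<Psi> x v)" for u v
    using pres[OF p] by (simp add: x_def)
  have \<Psi>x: "\<Psi> x = snd d' (F p)"
    using p chart_inv_chart[OF chd(1)] by (simp add: \<Psi>_def x_def coord_map_def)
  have inr: "\<Psi> x \<in> snd d' ` fst d'" using p by (simp add: \<Psi>x)
  have inv\<Psi>x: "chart_inv d' (\<Psi> x) = F p"
    unfolding \<Psi>x by (rule chart_inv_chart[OF chd(2) p(2)])
  define \<beta> where "\<beta> z = ds2 d' (chart_inv d' (\<Psi> z))" for z
  have md: "metric_deriv ds2 d p w u v = metric_deriv ds2 d' (F p) (fderiv \<Psi> x w) (fderiv \<Psi> x u) (fderiv \<Psi> x v)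
      + ds2 d' (F p) (fderiv2 \<Psi> x w u) (fderiv \<Psi> x v)
      + ds2 d' (F p) (fderiv \<Psi> x u) (fderiv2 \<Psi> x w v)" for w u v
  proof -
    have D: "((\<lambda>z. fderiv \<Psi> z u) has_derivative fderiv (\<lambda>z. fderiv \<Psi> z u) x) (at x)" for u
      using td(1) unfolding twice_diff_def by (intro fderiv_works) blast
    have dbeta: "(\<lambda>z. \<beta> z a b) differentiable (at x)"
      and fbeta: "fderiv (\<lambda>z. \<beta> z a b) x h = metric_deriv ds2 d' (F p) (fderiv \<Psi> x h) a b" for a b h
      using differentiable_chain_at[OF twice_diff_differentiable[OF td(1)] metric_family(2)[OF d(2) inr, of a b]]
        fderiv_compose[OF metric_family(2)[OF d(2) inr, of a b] twice_diff_differentiable[OF td(1)], of h]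
      by (simp_all add: \<beta>_def o_def metric_deriv_def \<Psi>x)
    have "((\<lambda>z. \<beta> z (fderiv \<Psi> z u) (fderiv \<Psi> z v)) has_derivative
      (\<lambda>h. fderiv (\<lambda>z. \<beta> z (fderiv \<Psi> x u) (fderiv \<Psi> x v)) x h +
        \<beta> x (fderiv (\<lambda>z. fderiv \<Psi> z u) x h) (fderiv \<Psi> x v) +
        \<beta> x (fderiv \<Psi> x u) (fderiv (\<lambda>z. fderiv \<Psi> z v) x h))) (at x)"
    proof (rule has_derivative_bilinear_family[OF _ dbeta D D])
      show "\<forall>\<^sub>F z in nhds x. bilinear (\<beta> z)"
        unfolding \<beta>_def
        by (rule eventually_nhds_compose[OF twice_diff_isCont[OF td(1)] metric_family(1)[OF d(2) inr]])
    qed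
    note 1 = fderiv_eqI[OF this]
    have "\<forall>\<^sub>F z in nhds x. \<beta> z (fderiv \<Psi> z u) (fderiv \<Psi> z v) = ds2 d (chart_inv d z) u v"
      using td(2)
    proof eventually_elim
      case (elim z)
      then have z: "z \<in> snd d ` fst d" "F (chart_inv d z) \<in> fst d'" by auto
      have "chart_inv d' (\<Psi> z) = F (chart_inv d z)"
        unfolding \<Psi>_def coord_map_def by (rule chart_inv_chart[OF chd(2) z(2)])
      then show ?case
        using pres[OF chart_inv_in[OF z(1)] z(2), of u v] chart_chart_inv[OF z(1)]
        by (simp add: \<beta>_def)
    qed
    then have "metric_deriv ds2 d p w u v = fderiv (\<lambda>z. \<beta> z (fderiv \<Psi> z u) (fderiv \<Psi> z v)) x w"
      unfolding metric_deriv_def x_def[symmetric] by (simp add: fderiv_cong_nhds)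
    then show ?thesis
      unfolding 1 fbeta unfolding \<beta>_def inv\<Psi>x .
  qed
  have sym: "ds2 d' (F p) a b = ds2 d' (F p) b a" for a b
    by (rule metric_sym[OF d(2) p(2)])
  show "christoffel ds2 d p u u w =
      christoffel ds2 d' (F p) (fderiv \<Psi> x u) (fderiv \<Psi> x u) (fderiv \<Psi> x w)
      + ds2 d' (F p) (fderiv2 \<Psi> x u u) (fderiv \<Psi> x w)"
    unfolding christoffel_def md fderiv2_symmetric[OF td(1), of w u]
      sym[of "fderiv2 \<Psi> x w u" "fderiv \<Psi> x u"] by (simp add: field_simps)
qed

definition geodesic_defect :: "('m, 'e) chart \<Rightarrow> (real \<Rightarrow> 'm) \<Rightarrow> real \<Rightarrow> 'e \<Rightarrow> real" where
  "geodesic_defect d \<gamma> t w = ds2 d (\<gamma> t) (acceleration d \<gamma> t) w +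
     christoffel ds2 d (\<gamma> t) (velocity d \<gamma> t) (velocity d \<gamma> t) w"

lemma geodesic_defect_transform:
  assumes F: "isometry A ds2 F" and d: "d \<in> A" "d' \<in> A"
    and \<gamma>: "chart_reg d \<gamma> t" and Fp: "F (\<gamma> t) \<in> fst d'"
  shows "geodesic_defect d \<gamma> t w =
    geodesic_defect d' (\<lambda>s. F (\<gamma> s)) t (fderiv (coord_map d d' F) (snd d (\<gamma> t)) w)"
proof -
  let ?\<Psi> = "coord_map d d' F" and ?y = "\<lambda>s. snd d (\<gamma> s)"
  let ?x = "?y t"
  have sm: "smooth_map A A F" using F by (simp add: isometry_def)
  note chd = charts[OF d(1)] charts[OF d(2)]
  note p = chart_reg_in[OF \<gamma>]
  note td = coord_map_twice_diff(1)[OF sm d chd p Fp]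
  have ty: "twice_diff ?y t" using \<gamma> by (simp add: chart_reg_def)
  note r = chart_reg_smooth_map[OF sm d chd \<gamma> Fp]
  have eq: "\<forall>\<^sub>F s in nhds t. snd d' (F (\<gamma> s)) = ?\<Psi> (?y s)"
    using \<gamma> unfolding chart_reg_def
    by (auto simp: coord_map_def chart_inv_chart[OF chd(1)] elim: eventually_mono)
  then have "\<forall>\<^sub>F s in nhds t. \<forall>\<^sub>F s in nhds s. snd d' (F (\<gamma> s)) = ?\<Psi> (?y s)"
    by (simp add: eventually_eventually)
  then have "\<forall>\<^sub>F s in nhds t. fderiv (\<lambda>s. snd d' (F (\<gamma> s))) s 1 = fderiv (\<lambda>s. ?\<Psi> (?y s)) s 1"
    by (rule eventually_mono) (simp add: fderiv_cong_nhds)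
  from fderiv_cong_nhds[OF this]
  have acc: "fderiv2 (\<lambda>s. snd d' (F (\<gamma> s))) t 1 1 =
      fderiv2 ?\<Psi> ?x (fderiv ?y t 1) (fderiv ?y t 1) + fderiv ?\<Psi> ?x (fderiv2 ?y t 1 1)"
    using fderiv2_compose[of ?\<Psi> ?y t 1 1, OF td ty] by simp
  have lin: "linear (\<lambda>u. ds2 d' (F (\<gamma> t)) u v)" for v
    using metric_bilinear[OF d(2) Fp] by (simp add: bilinear_def)
  show ?thesis
    unfolding geodesic_defect_def chart_reg_velocity(1,3)[OF \<gamma>] chart_reg_velocity(1,3)[OF r(1)] acc r(2)
      christoffel_transform[OF F d p Fp] linear_add[OF lin] by simp
qed

lemma left_invariant_curve:
  assumes \<gamma>: "reg \<gamma> t" "\<gamma> t = \<one>"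
    and vel: "\<forall>\<^sub>F s in nhds t. fderiv (\<lambda>s. K (\<gamma> s)) s 1 = E (v s) (K (\<gamma> s))"
    and v: "(v has_derivative (\<lambda>h. h *\<^sub>R v')) (at t)"
  shows "velocity c \<gamma> t = v t" "acceleration c \<gamma> t = v' + P (v t) (v t)"
    "geodesic_defect c \<gamma> t w = ip v' w - ip (v t) (br (v t) w)"
proof -
  let ?y = "\<lambda>s. K (\<gamma> s)"
  have yt: "?y t = e0" using \<gamma>(2) by simp
  have ty: "twice_diff ?y t" using \<gamma>(1) by (simp add: chart_reg_def)
  show 1: "velocity c \<gamma> t = v t"
    using eventually_nhds_x_imp_x[OF vel] \<gamma> by (simp add: chart_reg_velocity(1))
  have dE: "E u differentiable (at (?y t))" for u
    unfolding yt by (rule twice_diff_differentiable[OF E_twice_diff[OF e0_in]])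
  have comp: "(\<lambda>s. E u (?y s)) differentiable (at t)"
    "fderiv (\<lambda>s. E u (?y s)) t 1 = P u (v t)" for u
    using differentiable_chain_at[OF twice_diff_differentiable[OF ty] dE]
      fderiv_compose[OF dE twice_diff_differentiable[OF ty], of u 1] 1 \<gamma>
    by (simp_all add: o_def P_def chart_reg_velocity(1))
  have "((\<lambda>s. E (v s) (?y s)) has_derivative
      (\<lambda>h. fderiv (\<lambda>s. E (v t) (?y s)) t h + E (h *\<^sub>R v') (?y t))) (at t)"
  proof (rule has_derivative_apply_linear[where L = "\<lambda>s u. E u (?y s)", OF _ comp(1) v])
    show "\<forall>\<^sub>F s in nhds t. linear (\<lambda>u. E u (?y s))"
      by (rule eventually_mono[OF reg_eventually_V[OF \<gamma>(1)]]) (rule linear_E)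
  qed
  then have "fderiv2 ?y t 1 1 = P (v t) (v t) + v'"
    unfolding fderiv_cong_nhds[OF vel] by (simp add: fderiv_eqI comp(2) yt)
  then show 2: "acceleration c \<gamma> t = v' + P (v t) (v t)"
    by (simp add: chart_reg_velocity(3)[OF \<gamma>(1)])
  show "geodesic_defect c \<gamma> t w = ip v' w - ip (v t) (br (v t) w)"
    unfolding geodesic_defect_def 1 2 \<gamma>(2) christoffel_e0 linear_add[OF linear_ip(2)] by simp
qed

lemma euler_arnold_field:
  obtains Q where "\<And>v w. ip (Q v) w = ip v (br v w)" "\<And>v. twice_diff Q v"
proof -
  define J where "J a = (\<Sum>b\<in>Basis. ip a b *\<^sub>R b)" for a
  have linJ: "linear J"
    unfolding J_def
    by (rule linearI)
      (simp_all add: linear_add[OF linear_ip(2)] linear_scale[OF linear_ip(2)] scaleR_add_left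
        sum.distrib scaleR_right.sum)
  have Jb: "J a \<bullet> b = ip a b" if "b \<in> Basis" for a b
    using that by (simp add: J_def inner_sum_left inner_Basis if_distrib cong: if_cong)
  have expand: "ip a w = J a \<bullet> w" for a w
  proof -
    have "ip a w = ip a (\<Sum>b\<in>Basis. (w \<bullet> b) *\<^sub>R b)" by (simp add: euclidean_representation)
    also have "\<dots> = (\<Sum>b\<in>Basis. (w \<bullet> b) * ip a b)"
      by (simp add: linear_sum[OF linear_ip(1)] linear_scale[OF linear_ip(1)])
    also have "\<dots> = J a \<bullet> w" by (simp add: J_def inner_sum_left inner_commute[of w] mult.commute)
    finally show ?thesis .
  qed
  have "a = 0" if "J a = 0" for a
    using metric_nondeg[OF cA one_in] that expand[of a] unfolding nondegenerate_on_def by auto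
  then have "inj J" using linear_injective_0[OF linJ] by blast
  then have "surj J" by (rule linear_injective_imp_surjective[OF linJ]) simp
  then obtain Ji where Ji: "linear Ji" "J \<circ> Ji = id"
    using linear_surjective_right_inverse[OF linJ] by blast
  define Q where "Q v = (\<Sum>b\<in>Basis. ip v (br v b) *\<^sub>R Ji b)" for v
  have lin_br: "linear (\<lambda>w. ip v (br v w))" for v
    using linear_compose[OF linear_br_right linear_ip(1)] by (simp add: o_def)
  have JJ: "J (Ji b) = b" for b using Ji(2) by (metis comp_apply id_apply)
  have "ip (Q v) w = ip v (br v w)" for v w
  proof -
    have "J (Q v) = (\<Sum>b\<in>Basis. ip v (br v b) *\<^sub>R b)"
      by (simp add: Q_def linear_sum[OF linJ] linear_scale[OF linJ] JJ)
    then have "ip (Q v) w = (\<Sum>b\<in>Basis. (w \<bullet> b) * ip v (br v b))"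
      by (simp add: expand[of "Q v"] inner_sum_left inner_commute[of w] mult.commute)
    also have "\<dots> = ip v (br v (\<Sum>b\<in>Basis. (w \<bullet> b) *\<^sub>R b))"
      by (simp add: linear_sum[OF lin_br] linear_scale[OF lin_br])
    finally show ?thesis by (simp add: euclidean_representation)
  qed
  moreover have "twice_diff Q v" for v
    unfolding Q_def
  proof (intro twice_diff_sum twice_diff_scaleR_const)
    show "twice_diff (\<lambda>v. ip v (br v b)) v" for b
      using bilinear_ip linear_br_left[of b]
      by (intro twice_diff_bilinear[where p = ip])
        (auto simp: bilinear_conv_bounded_bilinear linear_conv_bounded_linear intro!: twice_diff_bounded_linear)
  qed simp
  ultimately show thesis by (rule that)
qed

text \<open>
  The Euler--Arnold equation has constant coefficients, so no geodesic equation has to be brought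
  into normal form. At each point of the solution curve, the geodesic equation in any chart is
  checked by moving the point to the unit by a left translation.
\<close>

lemma geodesic_exists:
  obtains J \<gamma> where "geodesic A ds2 J \<gamma>" "0 \<in> J" "\<gamma> 0 = \<one>" "velocity c \<gamma> 0 = T"
proof -
  obtain Q where Q: "\<And>v w. ip (Q v) w = ip v (br v w)" "\<And>v. twice_diff Q v"
    by (rule euler_arnold_field) blast
  define f where "f z = (\<Sum>b\<in>Basis. (snd z \<bullet> b) *\<^sub>R E b (fst z), Q (snd z))" for z :: "'e \<times> 'e"
  have feq: "f (x, v) = (E v x, Q v)" if "x \<in> V" for x v
  proof -
    have "E v x = E (\<Sum>b\<in>Basis. (v \<bullet> b) *\<^sub>R b) x" by (simp add: euclidean_representation)
    also have "\<dots> = (\<Sum>b\<in>Basis. (v \<bullet> b) *\<^sub>R E b x)"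
      by (simp add: linear_sum[OF linear_E[OF that]] linear_scale[OF linear_E[OF that]])
    finally show ?thesis by (simp add: f_def)
  qed
  have tf: "twice_diff f z" if z: "z \<in> V \<times> UNIV" for z
  proof -
    have 1: "twice_diff (\<lambda>z. E b (fst z)) z" for b
      by (rule twice_diff_compose[of "E b" fst]) (use z E_twice_diff in auto)
    have 2: "twice_diff (\<lambda>z. snd z \<bullet> b) z" for b :: 'e and z :: "'e \<times> 'e"
      by (rule twice_diff_bilinear[OF bounded_bilinear_inner]) auto
    have 3: "twice_diff (\<lambda>z. Q (snd z)) z"
      by (rule twice_diff_compose[of Q snd]) (use Q(2) in auto)
    show ?thesis
      unfolding f_def
      by (intro twice_diff_Pair twice_diff_sum twice_diff_bilinear[OF bounded_bilinear_scaleR] 1 2 3) auto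
  qed
  have oV: "open (V \<times> (UNIV :: 'e set))" using open_V by (simp add: open_Times)
  have "(e0, T) \<in> V \<times> UNIV" using e0_in by simp
  from twice_diff_locally_lipschitz[OF oV this tf]
  obtain r L where r: "r > 0" "L \<ge> 0" "cball (e0, T) r \<subseteq> V \<times> UNIV"
    "\<And>x y. x \<in> cball (e0, T) r \<Longrightarrow> y \<in> cball (e0, T) r \<Longrightarrow> norm (f x - f y) \<le> L * norm (x - y)"
    by blast
  obtain e z where z: "e > 0" "z 0 = (e0, T)" "\<And>t. t \<in> {-e<..<e} \<Longrightarrow> z t \<in> cball (e0, T) r"
    "\<And>t. t \<in> {-e<..<e} \<Longrightarrow> (z has_vector_derivative f (z t)) (at t)"
    using picard_lindelof[OF r(1,2,4)] by blast
  define J where "J = {-e<..<e}"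
  define x v where "x t = fst (z t)" and "v t = snd (z t)" for t
  have xV: "x t \<in> V" if "t \<in> J" for t
    using z(3)[of t] r(3) that by (auto simp: J_def x_def)
  have fz: "f (z t) = (E (v t) (x t), Q (v t))" if "t \<in> J" for t
    using feq[OF xV[OF that], of "v t"] by (simp add: x_def v_def)
  have dz: "(z has_derivative (\<lambda>h. h *\<^sub>R f (z t))) (at t)" if "t \<in> J" for t
    using z(4)[of t] that by (simp add: J_def has_vector_derivative_def)
  have dx: "(x has_derivative (\<lambda>h. h *\<^sub>R E (v t) (x t))) (at t)"
    and dv: "(v has_derivative (\<lambda>h. h *\<^sub>R Q (v t))) (at t)" if "t \<in> J" for t
    using has_derivative_fst[OF dz[OF that]] has_derivative_snd[OF dz[OF that]]
    by (simp_all add: fz[OF that] x_def[abs_def] v_def[abs_def])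
  have oJ: "open J" by (simp add: J_def)
  have evJ: "\<forall>\<^sub>F s in nhds t. s \<in> J" if "t \<in> J" for t
    using eventually_nhds_in_open[OF oJ that] .
  have tx: "twice_diff x t" if t: "t \<in> J" for t
  proof (rule twice_diffI)
    show "\<forall>\<^sub>F s in nhds t. (x has_derivative (\<lambda>h. h *\<^sub>R E (v s) (x s))) (at s)"
      using evJ[OF t] by (rule eventually_mono) (rule dx)
    have "f differentiable (at (z t))"
      using twice_diff_differentiable[OF tf[OF subsetD[OF r(3) z(3)]]] t by (simp add: J_def)
    from differentiable_chain_at[OF differentiableI[OF dz[OF t]] this]
    have "(\<lambda>s. fst (f (z s))) differentiable (at t)"
      by (auto simp: differentiable_def o_def dest: has_derivative_fst)
    then have "(\<lambda>s. E (v s) (x s)) differentiable (at t)"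
      by (rule differentiable_cong_nhds[rotated]) (use evJ[OF t] in \<open>auto simp: fz elim: eventually_mono\<close>)
    then show "(\<lambda>s. h *\<^sub>R E (v s) (x s)) differentiable (at t)" for h
      by simp
  qed
  define \<gamma> where "\<gamma> t = Ki (x t)" for t
  have rg: "reg \<gamma> t" if "t \<in> J" for t
    unfolding \<gamma>_def
    by (rule chart_reg_compose[where f = Ki and g = x, OF reg_Ki[OF xV[OF that]] tx[OF that]])
  have regd: "chart_reg d \<gamma> t" if "t \<in> J" "d \<in> A" "\<gamma> t \<in> fst d" for t d
    using chart_reg_smooth_map(1)[OF smooth_id cA that(2) chart_c charts[OF that(2)] rg[OF that(1)]] that(3)
    by simp
  have defect: "geodesic_defect d \<gamma> t w = 0" if t: "t \<in> J" and d: "d \<in> A" "\<gamma> t \<in> fst d" for t d w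
  proof -
    define F where "F q = inv (\<gamma> t) \<otimes> q" for q
    have iF: "isometry A ds2 F" unfolding F_def[abs_def] by (rule isometry_left)
    then have sF: "smooth_map A A F" by (simp add: isometry_def)
    have Ft: "F (\<gamma> t) = \<one>" by (simp add: F_def)
    have rF: "reg (\<lambda>s. F (\<gamma> s)) t"
      by (rule chart_reg_smooth_map(1)[OF sF cA cA chart_c chart_c rg[OF t]]) (simp add: Ft one_in)
    have "\<forall>\<^sub>F s in nhds t. F (\<gamma> s) \<in> fst c" using rF by (simp add: chart_reg_def)
    then have "\<forall>\<^sub>F s in nhds t. fderiv (\<lambda>s. K (F (\<gamma> s))) s 1 = E (v s) (K (F (\<gamma> s)))"
      using evJ[OF t]
    proof eventually_elim
      case (elim s)
      have r1: "reg (\<lambda>y. F (Ki y)) (x s)"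
        by (rule chart_reg_smooth_map(1)[OF sF cA cA chart_c chart_c reg_Ki[OF xV[OF elim(2)]]])
          (use elim in \<open>simp add: \<gamma>_def\<close>)
      have "fderiv (\<lambda>s. K (F (Ki (x s)))) s 1 = fderiv (\<lambda>y. K (F (Ki y))) (x s) (fderiv x s 1)"
        by (rule fderiv_compose[of "\<lambda>y. K (F (Ki y))" x, OF chart_reg_diff[OF r1] differentiableI[OF dx[OF elim(2)]]])
      also have "fderiv x s 1 = E (v s) (x s)"
        by (simp add: fderiv_eqI[OF dx[OF elim(2)]])
      also have "fderiv (\<lambda>y. K (F (Ki y))) (x s) (E (v s) (x s)) =
          E (fderiv (\<lambda>y. K (Ki y)) e0 (v s)) (K (F (Ki (x s))))"
        by (rule fderiv_E_equivariant[where \<phi> = F and \<psi> = "\<lambda>q. q", OF _ _ xV[OF elim(2)] r1 reg_Ki[OF e0_in]])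
          (simp_all add: F_def m_assoc)
      finally show ?case by (simp add: \<gamma>_def fderiv_K_Ki e0_in)
    qed
    from left_invariant_curve(3)[OF rF Ft this dv[OF t]]
    have "geodesic_defect c (\<lambda>s. F (\<gamma> s)) t w = 0" for w by (simp add: Q(1))
    then show ?thesis
      using geodesic_defect_transform[OF iF d(1) cA regd[OF t d]] by (simp add: Ft one_in)
  qed
  have "geodesic A ds2 J \<gamma>"
    unfolding geodesic_def
  proof (intro conjI ballI impI allI)
    show "open J" "is_interval J" "J \<noteq> {}"
      using z(1) by (auto simp: J_def is_interval_oo intro!: exI[of _ 0])
    show "continuous_on J \<gamma>"
      using chart_reg_isCont[OF chart_c rg] by (intro continuous_at_imp_continuous_on ballI)
    fix d t assume d: "d \<in> A" and t: "t \<in> J" and dt: "\<gamma> t \<in> fst d"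
    note r = regd[OF t d dt]
    show "(\<lambda>s. snd d (\<gamma> s)) differentiable (at t)" by (rule chart_reg_diff[OF r])
    show "velocity d \<gamma> differentiable (at t)" by (rule chart_reg_velocity(2)[OF r])
    show "ds2 d (\<gamma> t) (acceleration d \<gamma> t) w + christoffel ds2 d (\<gamma> t) (velocity d \<gamma> t) (velocity d \<gamma> t) w = 0" for w
      using defect[OF t d dt] by (simp add: geodesic_defect_def)
  qed
  moreover have J0: "0 \<in> J" using z(1) by (simp add: J_def)
  moreover have "\<gamma> 0 = \<one>" using z(2) by (simp add: \<gamma>_def x_def)
  moreover have "velocity c \<gamma> 0 = T"
  proof -
    have "\<forall>\<^sub>F s in nhds 0. K (\<gamma> s) = x s"
      using evJ[OF J0] by (rule eventually_mono) (simp add: \<gamma>_def K_Ki xV)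
    note eq = fderiv_cong_nhds[OF this]
    have "v 0 = T" "x 0 = e0" using z(2) by (simp_all add: x_def v_def)
    then show ?thesis
      unfolding chart_reg_velocity(1)[OF rg[OF J0]] eq fderiv_eqI[OF dx[OF J0]] by simp
  qed
  ultimately show thesis by (rule that)
qed

end

lemma automorphism_properties:
  assumes "subgroup H (AutoGroup N)" "h \<in> H" "group N" "carrier N = UNIV"
  shows "h (p \<otimes>\<^bsub>N\<^esub> q) = h p \<otimes>\<^bsub>N\<^esub> h q" "h \<one>\<^bsub>N\<^esub> = \<one>\<^bsub>N\<^esub>"
proof -
  have "h \<in> auto N"
    using subgroup.subset[OF assms(1)] assms(2) by (auto simp: AutoGroup_def)
  then have hom: "h \<in> hom N N" by (simp add: auto_def)
  then show "h (p \<otimes>\<^bsub>N\<^esub> q) = h p \<otimes>\<^bsub>N\<^esub> h q"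
    using assms(4) by (simp add: hom_mult)
  show "h \<one>\<^bsub>N\<^esub> = \<one>\<^bsub>N\<^esub>"
    using hom_one[OF hom] assms(3) by simp
qed

context lie_metric
begin

lemma fderiv2_scale:
  fixes y :: "real \<Rightarrow> 'e"
  assumes "twice_diff y t"
  shows "fderiv2 y t p q = (p * q) *\<^sub>R fderiv2 y t 1 1"
proof -
  have D: "(\<lambda>s. fderiv y s v) differentiable (at t)" for v
    using assms unfolding twice_diff_def by blast
  have "linear (\<lambda>v. fderiv (\<lambda>s. fderiv y s v) t p)"
    by (rule linear_fderiv_param[OF linear_fderiv_near[OF assms] D])
  from linear_scale[OF this, of q 1] linear_scale[OF linear_frechet_derivative[OF D[of 1]], of p 1]
  show ?thesis by simp
qed

text \<open>
  The orbit through the unit is \<open>a t = \<sigma> t \<one>\<close>, and \<open>h t = (a t)\<^sup>-\<^sup>1 \<sigma> t\<close> is in \<open>H\<close>. From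
  \<open>a (s + t) = a s \<otimes> h s (a t)\<close> the left-trivialized velocity of \<open>a\<close> is \<open>B s X\<close> with \<open>B s\<close> the
  differential of \<open>h s\<close>; the derivation \<open>D\<close> is \<open>B' 0\<close> up to the speed of the reparametrization,
  whose second derivative yields \<open>k\<close>.
\<close>

lemma geodesic_orbit_condition:
  assumes H: "subgroup H (AutoGroup N)" and isoH: "\<forall>h\<in>H. isometry A ds2 h"
    and GO: "geodesic_orbit A ds2 (semidirect N H)"
  obtains D k where "linear D" "\<And>u v. D (br u v) = br (D u) v + br u (D v)"
    "\<And>u v. ip (D u) v = - ip u (D v)" "\<And>w. ip T (br T w) = ip (D T) w + k * ip T w"
proof -
  obtain J \<gamma> where \<gamma>: "geodesic A ds2 J \<gamma>" "0 \<in> J" "\<gamma> 0 = \<one>" "velocity c \<gamma> 0 = T"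
    by (rule geodesic_exists)
  obtain \<sigma> I \<phi> where \<sigma>: "one_param_subgroup A (semidirect N H) \<sigma>"
    and I: "open I" "0 \<in> I" and \<phi>: "smooth_on \<phi> I" "\<forall>t\<in>I. deriv \<phi> t \<noteq> 0" "\<phi> 0 = 0"
    and orb: "\<forall>t\<in>I. \<gamma> (\<phi> t) = \<sigma> t \<one>"
    using GO \<gamma>(1-3) unfolding geodesic_orbit_def by metis
  have \<sigma>_in: "\<sigma> t \<in> semidirect N H" and \<sigma>0: "\<sigma> 0 = id" and \<sigma>_add: "\<sigma> (s + t) = \<sigma> s \<circ> \<sigma> t"
    and \<sigma>_smooth: "smooth_map (prod_atlas real_atlas A) A (\<lambda>(t, p). \<sigma> t p)" for s t
    using \<sigma> by (auto simp: one_param_subgroup_def)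
  define a where "a t = \<sigma> t \<one>" for t
  define h where "h t q = inv (a t) \<otimes> \<sigma> t q" for t q
  have a0: "a 0 = \<one>" by (simp add: a_def \<sigma>0)
  have h0: "h 0 q = q" for q by (simp add: h_def a0 \<sigma>0)
  have hH: "h t \<in> H" for t
  proof -
    obtain p g where pg: "\<sigma> t = (\<lambda>x. p \<otimes> g x)" "g \<in> H"
      using \<sigma>_in[of t] by (auto simp: semidirect_def)
    have "a t = p" using automorphism_properties(2)[OF H pg(2) is_group] by (simp add: a_def pg(1))
    then have "h t = g" by (simp add: h_def[abs_def] pg(1) m_assoc[symmetric])
    then show ?thesis using pg(2) by simp
  qed
  note h_mult = automorphism_properties(1)[OF H hH is_group carrier_UNIV]
    and h_one = automorphism_properties(2)[OF H hH is_group carrier_UNIV]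
  have h_iso: "isometry A ds2 (h t)" for t using isoH hH by blast
  then have h_smooth: "smooth_map A A (h t)" for t by (simp add: isometry_def)
  have a_add: "a (s + t) = a s \<otimes> h s (a t)" for s t
    by (simp add: h_def a_def \<sigma>_add m_assoc[symmetric])

  have reg_\<sigma>: "reg (\<lambda>z. \<sigma> (fst z) (Ki (snd z))) (t, y)" if "y \<in> V" "\<sigma> t (Ki y) \<in> fst c" for t y
  proof -
    have 1: "chart_reg (UNIV, id) fst (t, y)" by (simp add: chart_reg_def)
    have 2: "reg (\<lambda>z. Ki (snd z)) (t, y)"
      by (rule chart_reg_compose[where f = Ki and g = snd]) (use reg_Ki[OF that(1)] in simp_all)
    have R: "(UNIV, id) \<in> real_atlas" by (simp add: real_atlas_def)
    have "reg (\<lambda>z. (\<lambda>(t, p). \<sigma> t p) (fst z, Ki (snd z))) (t, y)"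
      by (rule chart_reg_smooth_map(1)[OF \<sigma>_smooth prod_chart_in[OF R cA] cA
          is_chart_prod[OF is_chart_real chart_c] chart_c chart_reg_Pair[OF 1 2]]) (simp add: that)
    then show ?thesis by simp
  qed
  have reg_a: "reg a t" if "a t \<in> fst c" for t
  proof -
    have "reg (\<lambda>t. \<sigma> (fst (t, e0)) (Ki (snd (t, e0)))) t"
      by (rule chart_reg_compose[where f = "\<lambda>z. \<sigma> (fst z) (Ki (snd z))" and g = "\<lambda>t. (t, e0)"])
        (use reg_\<sigma>[OF e0_in] that in \<open>simp_all add: a_def twice_diff_Pair\<close>)
    then show ?thesis by (simp add: a_def[abs_def])
  qed
  define A1 where "A1 = {t. a t \<in> fst c \<and> inv (a t) \<in> fst c}"
  have ra0: "reg a 0" using reg_a[of 0] a0 one_in by simp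
  have "\<forall>\<^sub>F t in nhds 0. a t \<in> fst c" using ra0 by (simp add: chart_reg_def)
  moreover have "\<forall>\<^sub>F t in nhds 0. inv (a t) \<in> fst c"
    using fderiv_inv(1)[OF ra0 a0] by (simp add: chart_reg_def)
  ultimately have evA1: "\<forall>\<^sub>F t in nhds 0. t \<in> A1"
    by eventually_elim (simp add: A1_def)
  have reg_h2: "reg (\<lambda>z. h (fst z) (Ki (snd z))) (t, e0)" if t: "t \<in> A1" for t
  proof -
    have 1: "reg (\<lambda>z. \<sigma> (fst z) (Ki (snd z))) (t, e0)"
      using reg_\<sigma>[OF e0_in, of t] t by (simp add: A1_def a_def)
    have "reg (\<lambda>z. a (fst z)) (t, e0)"
      by (rule chart_reg_compose[where f = a and g = fst]) (use reg_a[of t] t in \<open>simp_all add: A1_def\<close>)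
    then have 2: "reg (\<lambda>z. inv (a (fst z))) (t, e0)"
      using reg_inv[of "\<lambda>z. a (fst z)" "(t, e0)"] t by (simp add: A1_def)
    show ?thesis
      using reg_mult(1)[OF 2 1] h_one[of t] one_in by (simp add: h_def)
  qed

  define B where "B t u = fderiv (\<lambda>y. K (h t (Ki y))) e0 u" for t u
  have reg_h: "reg (\<lambda>y. h t (Ki y)) x" if "x \<in> V" "h t (Ki x) \<in> fst c" for t x
    using chart_reg_smooth_map(1)[OF h_smooth cA cA chart_c chart_c reg_Ki] that by blast
  have reg_h0: "reg (\<lambda>y. h t (Ki y)) e0" for t
    by (rule reg_h[OF e0_in]) (simp add: h_one one_in)
  have ev_reg_h: "\<forall>\<^sub>F x in nhds e0. reg (\<lambda>y. h t (Ki y)) x" for t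
  proof -
    have "\<forall>\<^sub>F x in nhds e0. h t (Ki x) \<in> fst c" using reg_h0 by (simp add: chart_reg_def)
    then show ?thesis using ev_V[OF e0_in] by eventually_elim (rule reg_h)
  qed
  have B_br: "br (B t u) (B t v) = B t (br u v)" for t u v
    unfolding B_def by (rule automorphism_bracket[OF h_mult h_one ev_reg_h])
  have B_ip: "ip (B t u) (B t v) = ip u v" for t u v
  proof -
    have "preserves_metric A ds2 (h t)" using h_iso by (simp add: isometry_def)
    then have "ds2 c (h t \<one>) (differential c c (h t) \<one> u) (differential c c (h t) \<one> v) = ip u v"
      using cA one_in h_one unfolding preserves_metric_def by metis
    then show ?thesis by (simp add: h_one differential_def coord_map_def B_def)
  qed
  have B_lin: "linear (B t)" for t
    unfolding B_def[abs_def] using reg_h0[of t] by (intro linear_fderiv) (simp add: chart_reg_def)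
  have B0: "B 0 u = u" for u by (simp add: B_def h0 fderiv_K_Ki e0_in)
  have B_diff: "(\<lambda>t. B t u) differentiable (at 0)" for u
  proof -
    let ?S = "\<lambda>z. K (h (fst z) (Ki (snd z)))"
    have "0 \<in> A1" using evA1 by (rule eventually_nhds_x_imp_x)
    then have "(\<lambda>z. fderiv ?S z (0, u)) differentiable (at (0, e0))"
      using reg_h2[of 0] unfolding chart_reg_def twice_diff_def by blast
    then have 1: "(\<lambda>t. fderiv ?S (t, e0) (0, u)) differentiable (at 0)"
      using differentiable_chain_at[of "\<lambda>t. (t, e0)" 0 "\<lambda>z. fderiv ?S z (0, u)"]
      by (simp add: o_def twice_diff_differentiable twice_diff_Pair)
    have "\<forall>\<^sub>F t in nhds 0. fderiv ?S (t, e0) (0, u) = B t u"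
      using evA1
    proof eventually_elim
      case (elim t)
      have "fderiv (\<lambda>y. ?S (t, y)) e0 u = fderiv ?S (t, e0) (fderiv (\<lambda>y. (t, y)) e0 u)"
        by (rule fderiv_compose[of ?S "\<lambda>y. (t, y)"])
          (use chart_reg_diff[OF reg_h2[OF elim]] in \<open>simp_all add: twice_diff_differentiable twice_diff_Pair\<close>)
      then show ?case by (simp add: B_def fderiv_Pair)
    qed
    then show ?thesis by (rule differentiable_cong_nhds) (rule 1)
  qed
  define D where "D u = fderiv (\<lambda>t. B t u) 0 1" for u
  have evB: "\<forall>\<^sub>F t in nhds 0. linear (B t)" by (rule always_eventually) (simp add: B_lin)
  have D_lin: "linear D"
    unfolding D_def[abs_def] by (rule linear_fderiv_param[OF evB B_diff])
  have D_br: "D (br u v) = br (D u) v + br u (D v)" for u v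
    using fderiv_bilinear[OF bilinear_br B_diff B_diff, of u v 1] by (simp add: B_br B0 D_def add.commute)
  have D_skew: "ip (D u) v = - ip u (D v)" for u v
    using fderiv_bilinear[OF bilinear_ip B_diff B_diff, of u v 1] by (simp add: B_ip B0 D_def)

  define x where "x t = K (a t)" for t
  define X where "X = fderiv x 0 1"
  have tx: "twice_diff x 0" using ra0 by (simp add: chart_reg_def x_def[abs_def])
  have x_vel: "fderiv x s 1 = E (B s X) (x s)" if s: "s \<in> A1" for s
  proof -
    have ras: "reg a s" and as_in: "a s \<in> fst c" using s reg_a by (auto simp: A1_def)
    have c0: "reg (\<lambda>t. a s) 0" using as_in by (rule chart_reg_const)
    have ha: "h s (a 0) \<in> fst c" by (simp add: a0 h_one one_in)
    note rh = chart_reg_smooth_map[OF h_smooth[of s] cA cA chart_c chart_c ra0 ha]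
    have "coord_map c c (h s) = (\<lambda>y. K (h s (Ki y)))" by (simp add: coord_map_def fun_eq_iff)
    then have 1: "fderiv (\<lambda>t. K (h s (a t))) 0 1 = B s X"
      using rh(2)[of 1] by (simp only: a0 B_def X_def x_def[abs_def])
    have 2: "fderiv (\<lambda>t. K (a s \<otimes> h s (a t))) 0 1 = E (B s X) (x s)"
      using fderiv_mult_right[OF c0 rh(1), of 1] by (simp add: a0 h_one 1 x_def)
    have 3: "((\<lambda>t. s + t) has_derivative (\<lambda>h. h)) (at 0)"
      by (auto intro!: derivative_eq_intros)
    have "fderiv (\<lambda>t. x (s + t)) 0 1 = fderiv x (s + 0) (fderiv (\<lambda>t. s + t) 0 1)"
      by (rule fderiv_compose[of x "\<lambda>t. s + t"])
        (simp add: x_def[abs_def] chart_reg_diff[OF ras], rule differentiableI[OF 3])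
    also have "\<dots> = fderiv x s 1" by (simp add: fderiv_eqI[OF 3])
    also have "(\<lambda>t. x (s + t)) = (\<lambda>t. K (a s \<otimes> h s (a t)))" by (simp add: x_def a_add)
    finally show ?thesis using 2 by simp
  qed
  have "((\<lambda>s. B s X) has_derivative (\<lambda>h. h *\<^sub>R D X)) (at 0)"
  proof -
    have "fderiv (\<lambda>t. B t X) 0 r = r *\<^sub>R D X" for r
      using linear_scale[OF linear_frechet_derivative[OF B_diff[of X]], of r 1]
      by (simp add: D_def)
    then have "fderiv (\<lambda>t. B t X) 0 = (\<lambda>r. r *\<^sub>R D X)" by (rule ext)
    then show ?thesis using fderiv_works[OF B_diff[of X]] by simp
  qed
  from left_invariant_curve(2)[OF ra0 a0 _ this]
  have x_acc: "fderiv2 x 0 1 1 = D X + P X X"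
    using eventually_mono[OF evA1 x_vel] chart_reg_velocity(3)[OF ra0] by (simp add: x_def[abs_def] B0)

  define y where "y r = K (\<gamma> r)" for r
  have oJ: "open J" and contJ: "continuous_on J \<gamma>"
    and geo: "\<And>t. t \<in> J \<Longrightarrow> \<gamma> t \<in> fst c \<Longrightarrow> y differentiable (at t) \<and> velocity c \<gamma> differentiable (at t) \<and>
      (\<forall>w. geodesic_defect c \<gamma> t w = 0)"
    using \<gamma>(1) cA unfolding geodesic_def geodesic_defect_def y_def[abs_def] by blast+
  have "isCont \<gamma> 0" using contJ oJ \<gamma>(2) continuous_on_eq_continuous_at by blast
  then have "\<forall>\<^sub>F r in nhds 0. \<gamma> r \<in> fst c"
    by (rule eventually_nhds_compose)
      (rule eventually_nhds_in_open, use open_chart_domain[OF chart_c] \<gamma>(3) one_in in simp_all)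
  then have ev\<gamma>: "\<forall>\<^sub>F r in nhds 0. r \<in> J \<and> \<gamma> r \<in> fst c"
    using eventually_nhds_in_open[OF oJ \<gamma>(2)] by eventually_elim blast
  have ty: "twice_diff y 0"
  proof (rule twice_diffI)
    show "\<forall>\<^sub>F r in nhds 0. (y has_derivative (\<lambda>h. h *\<^sub>R velocity c \<gamma> r)) (at r)"
      using ev\<gamma>
    proof eventually_elim
      case (elim r)
      then have d: "y differentiable (at r)" using geo by blast
      have "fderiv y r = (\<lambda>h. h *\<^sub>R velocity c \<gamma> r)"
        using fderiv_real[OF d] by (simp add: velocity_def y_def[abs_def] fun_eq_iff)
      then show ?case using fderiv_works[OF d] by simp
    qed
    show "(\<lambda>r. h *\<^sub>R velocity c \<gamma> r) differentiable (at 0)" for h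
      using geo[OF \<gamma>(2)] \<gamma>(3) one_in by simp
  qed
  have r\<gamma>: "reg \<gamma> 0"
    using ty ev\<gamma> by (auto simp: chart_reg_def y_def[abs_def] elim: eventually_mono)
  have yT: "fderiv y 0 1 = T"
    using chart_reg_velocity(1)[OF r\<gamma>] \<gamma>(4) by (simp add: y_def[abs_def])
  have y_acc: "ip (fderiv2 y 0 1 1) w = ip (P T T) w + ip T (br T w)" for w
  proof -
    have "geodesic_defect c \<gamma> 0 w = 0" using geo[OF \<gamma>(2)] \<gamma>(3) one_in by simp
    then have "ip (fderiv2 y 0 1 1) w + christoffel ds2 c \<one> T T w = 0"
      unfolding geodesic_defect_def chart_reg_velocity(3)[OF r\<gamma>] \<gamma>(3,4) y_def[abs_def] .
    then show ?thesis by (simp add: christoffel_e0)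
  qed

  define f1 f2 where "f1 = fderiv \<phi> 0 1" and "f2 = fderiv2 \<phi> 0 1 1"
  have t\<phi>: "twice_diff \<phi> 0" by (rule smooth_on_twice_diff[OF \<phi>(1) I])
  have f1: "f1 \<noteq> 0"
  proof -
    have d: "\<phi> differentiable (at 0)" by (rule twice_diff_differentiable[OF t\<phi>])
    have "f1 = vector_derivative \<phi> (at 0)" using fderiv_real[OF d, of 1] by (simp add: f1_def)
    then have "fderiv \<phi> 0 = (\<lambda>h. f1 * h)" by (intro ext) (simp add: fderiv_real[OF d])
    then have "(\<phi> has_derivative (\<lambda>h. f1 * h)) (at 0)" using fderiv_works[OF d] by simp
    then have "deriv \<phi> 0 = f1"
      by (intro DERIV_imp_deriv) (simp add: has_field_derivative_def)
    then show ?thesis using \<phi>(2) I(2) by blast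
  qed
  have eqx: "\<forall>\<^sub>F t in nhds 0. x t = y (\<phi> t)"
    using eventually_nhds_in_open[OF I] by (rule eventually_mono) (simp add: x_def y_def a_def orb)
  have ty': "twice_diff y (\<phi> 0)" using ty by (simp add: \<phi>(3))
  have X: "X = f1 *\<^sub>R T"
  proof -
    have "X = fderiv (\<lambda>t. y (\<phi> t)) 0 1"
      using fderiv_cong_nhds[OF eqx] by (simp add: X_def)
    also have "\<dots> = fderiv y (\<phi> 0) f1"
      unfolding f1_def
      by (rule fderiv_compose[of y \<phi>, OF twice_diff_differentiable[OF ty'] twice_diff_differentiable[OF t\<phi>]])
    also have "\<dots> = f1 *\<^sub>R T"
      using linear_scale[OF linear_fderiv[OF ty], of f1 1] by (simp add: \<phi>(3) yT)
    finally show ?thesis .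
  qed
  have "fderiv2 x 0 1 1 = fderiv2 (\<lambda>t. y (\<phi> t)) 0 1 1"
  proof -
    have "\<forall>\<^sub>F t in nhds 0. \<forall>\<^sub>F s in nhds t. x s = y (\<phi> s)"
      using eqx by (simp add: eventually_eventually)
    then have "\<forall>\<^sub>F t in nhds 0. fderiv x t 1 = fderiv (\<lambda>t. y (\<phi> t)) t 1"
      by (rule eventually_mono) (simp add: fderiv_cong_nhds)
    from fderiv_cong_nhds[OF this] show ?thesis by simp
  qed
  also have "\<dots> = fderiv2 y 0 f1 f1 + fderiv y 0 f2"
    using fderiv2_compose[of y \<phi> 0 1 1, OF ty' t\<phi>] by (simp add: \<phi>(3) f1_def f2_def)
  also have "\<dots> = (f1 * f1) *\<^sub>R fderiv2 y 0 1 1 + f2 *\<^sub>R T"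
    using linear_scale[OF linear_fderiv[OF ty], of f2 1] fderiv2_scale[OF ty, of f1 f1] by (simp add: yT)
  finally have acc: "f1 *\<^sub>R D T + (f1 * f1) *\<^sub>R P T T = (f1 * f1) *\<^sub>R fderiv2 y 0 1 1 + f2 *\<^sub>R T"
    using linear_scale[OF D_lin, of f1 T] linear_scale[OF linear_P_left, of f1 T]
      linear_scale[OF linear_P_right, of _ f1 T]
    by (simp add: x_acc X)
  have key: "ip T (br T w) = (1 / f1) * ip (D T) w + (- f2 / (f1 * f1)) * ip T w" for w
  proof -
    have "ip (f1 *\<^sub>R D T + (f1 * f1) *\<^sub>R P T T) w = ip ((f1 * f1) *\<^sub>R fderiv2 y 0 1 1 + f2 *\<^sub>R T) w"
      by (simp only: acc)
    then have "f1 * ip (D T) w + f1 * f1 * ip (P T T) w =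
        f1 * f1 * (ip (P T T) w + ip T (br T w)) + f2 * ip T w"
      by (simp add: linear_add[OF linear_ip(2)] linear_scale[OF linear_ip(2)] y_acc)
    then show ?thesis using f1 by (simp add: field_simps)
  qed
  show thesis
  proof (rule that[of "\<lambda>u. (1 / f1) *\<^sub>R D u" "- f2 / (f1 * f1)"])
    show "linear (\<lambda>u. (1 / f1) *\<^sub>R D u)" by (rule linear_compose_scale_right[OF D_lin])
    show "(1 / f1) *\<^sub>R D (br u v) = br ((1 / f1) *\<^sub>R D u) v + br u ((1 / f1) *\<^sub>R D v)" for u v
      by (simp only: D_br linear_scale[OF linear_br_left] linear_scale[OF linear_br_right] scaleR_add_right)
    show "ip ((1 / f1) *\<^sub>R D u) v = - ip u ((1 / f1) *\<^sub>R D v)" for u v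
      by (simp add: linear_scale[OF linear_ip(1)] linear_scale[OF linear_ip(2)] D_skew)
    show "ip T (br T w) = ip ((1 / f1) *\<^sub>R D T) w + (- f2 / (f1 * f1)) * ip T w" for w
      by (simp only: key linear_scale[OF linear_ip(2)] real_scaleR_def)
  qed
qed

end

section \<open>Nilpotent Lie algebras with the geodesic orbit condition\<close>

lemma has_signature_basis:
  assumes "has_signature b S p q"
  obtains B where "finite B" "independent B" "span B = S" "pairwise (\<lambda>x y. b x y = 0) B"
    "\<forall>x\<in>B. b x x \<noteq> 0"
proof -
  obtain P Q where PQ: "finite P" "finite Q" "independent (P \<union> Q)" "span (P \<union> Q) = S"
    "pairwise (\<lambda>x y. b x y = 0) (P \<union> Q)" "\<forall>x\<in>P. b x x > 0" "\<forall>x\<in>Q. b x x < 0"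
    using assms unfolding has_signature_def by blast
  show thesis
  proof (rule that[OF _ PQ(3-5)])
    show "finite (P \<union> Q)" using PQ(1,2) by simp
    show "\<forall>x\<in>P \<union> Q. b x x \<noteq> 0" using PQ(6,7) by force
  qed
qed

lemma has_signature_nondegenerate:
  fixes b :: "'e::real_vector \<Rightarrow> 'e \<Rightarrow> real"
  assumes bil: "bilinear b" and sig: "has_signature b S p q"
  shows "nondegenerate_on b S"
  unfolding nondegenerate_on_def
proof (intro ballI impI)
  fix x assume x: "x \<in> S" "\<forall>y\<in>S. b x y = 0"
  obtain B where B: "finite B" "independent B" "span B = S" "pairwise (\<lambda>x y. b x y = 0) B"
    "\<forall>x\<in>B. b x x \<noteq> 0"
    by (rule has_signature_basis[OF sig])
  have "x \<in> span B" using x(1) B(3) by simp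
  then obtain u where u: "x = (\<Sum>v\<in>B. u v *\<^sub>R v)"
    unfolding span_finite[OF B(1)] by blast
  have lin: "linear (\<lambda>x. b x y)" for y using bil by (simp add: bilinear_def)
  have "u v = 0" if v: "v \<in> B" for v
  proof -
    have "b x v = 0" using x(2) span_base[OF v] B(3) by simp
    then have "0 = b x v" by simp
    also have "\<dots> = (\<Sum>w\<in>B. u w * b w v)"
      unfolding u by (simp add: linear_sum[OF lin] linear_scale[OF lin])
    also have "\<dots> = (\<Sum>w\<in>B. if w = v then u v * b v v else 0)"
      by (rule sum.cong) (use B(4) v in \<open>auto simp: pairwise_def\<close>)
    also have "\<dots> = u v * b v v" using B(1) v by simp
    finally show ?thesis using B(5) v by simp
  qed
  then show "x = 0" by (simp add: u)
qed

lemma orthogonal_positive: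
  fixes b :: "'e::real_vector \<Rightarrow> 'e \<Rightarrow> real"
  assumes bil: "bilinear b" and P: "finite P" "pairwise (\<lambda>x y. b x y = 0) P" "\<And>x. x \<in> P \<Longrightarrow> b x x > 0"
    and x: "x \<in> span P"
  shows "b x x \<ge> 0" "b x x = 0 \<Longrightarrow> x = 0"
proof -
  obtain u where u: "x = (\<Sum>v\<in>P. u v *\<^sub>R v)"
    using x unfolding span_finite[OF P(1)] by blast
  have lin: "linear (\<lambda>x. b x y)" "linear (b y)" for y using bil by (auto simp: bilinear_def)
  have bx: "b x v = u v * b v v" if v: "v \<in> P" for v
  proof -
    have "b x v = (\<Sum>w\<in>P. u w * b w v)"
      unfolding u by (simp add: linear_sum[OF lin(1)] linear_scale[OF lin(1)])
    also have "\<dots> = (\<Sum>w\<in>P. if w = v then u v * b v v else 0)"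
      by (rule sum.cong) (use P(2) v in \<open>auto simp: pairwise_def\<close>)
    finally show ?thesis using P(1) v by simp
  qed
  have "b x x = (\<Sum>v\<in>P. u v * b x v)"
    by (subst (2) u) (simp add: linear_sum[OF lin(2)] linear_scale[OF lin(2)])
  then have bxx: "b x x = (\<Sum>v\<in>P. u v * u v * b v v)"
    by (simp add: bx mult.assoc)
  have nn: "u v * u v * b v v \<ge> 0" if "v \<in> P" for v
    using P(3)[OF that] by simp
  then show "b x x \<ge> 0" unfolding bxx by (rule sum_nonneg)
  assume "b x x = 0"
  then have "u v * u v * b v v = 0" if "v \<in> P" for v
    using sum_nonneg_eq_0_iff[OF P(1), of "\<lambda>v. u v * u v * b v v"] nn that unfolding bxx by blast
  then have "u v = 0" if "v \<in> P" for v using P(3)[OF that] that by fastforce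
  then show "x = 0" by (simp add: u)
qed

lemma lorentz_split:
  fixes b :: "'e::real_vector \<Rightarrow> 'e \<Rightarrow> real"
  assumes bil: "bilinear b" and sig: "has_signature b S p 1"
  obtains P q where "q \<in> S" "b q q < 0" "\<forall>x\<in>span P. b x x \<ge> 0"
    "\<forall>x\<in>span P. b x x = 0 \<longrightarrow> x = 0" "\<forall>x\<in>S. \<exists>t. x - t *\<^sub>R q \<in> span P"
proof -
  obtain P Q where PQ: "finite P" "card Q = 1" "span (P \<union> Q) = S"
    "pairwise (\<lambda>x y. b x y = 0) (P \<union> Q)" "\<forall>x\<in>P. b x x > 0" "\<forall>x\<in>Q. b x x < 0"
    using sig unfolding has_signature_def by blast
  obtain q where q: "Q = {q}" using PQ(2) card_1_singletonE by blast
  have pw: "pairwise (\<lambda>x y. b x y = 0) P" using PQ(4) by (rule pairwise_subset) simp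
  show thesis
  proof (rule that)
    show "q \<in> S" unfolding PQ(3)[symmetric] by (rule span_base) (simp add: q)
    show "b q q < 0" using PQ(6) q by simp
    show "\<forall>x\<in>span P. b x x \<ge> 0"
      by (rule ballI, rule orthogonal_positive(1)[OF bil PQ(1) pw bspec[OF PQ(5)]])
    show "\<forall>x\<in>span P. b x x = 0 \<longrightarrow> x = 0"
      by (intro ballI impI, rule orthogonal_positive(2)[OF bil PQ(1) pw bspec[OF PQ(5)]])
    show "\<forall>x\<in>S. \<exists>t. x - t *\<^sub>R q \<in> span P"
    proof
      fix x assume "x \<in> S"
      then have "x \<in> span (insert q P)" using PQ(3) q by simp
      then show "\<exists>t. x - t *\<^sub>R q \<in> span P" by (simp add: span_insert)
    qed
  qed
qed

lemma lorentz_null: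
  fixes b :: "'e::real_vector \<Rightarrow> 'e \<Rightarrow> real"
  assumes bil: "bilinear b" and sig: "has_signature b S p 1" and sym: "\<And>x y. b x y = b y x"
    and e: "e \<in> S" "e \<noteq> 0" "b e e = 0" and x: "x \<in> S" "b x e = 0" "b x x = 0"
  shows "x \<in> span {e}"
proof -
  obtain P q where P: "q \<in> S" "b q q < 0" "\<forall>x\<in>span P. b x x \<ge> 0"
    "\<forall>x\<in>span P. b x x = 0 \<longrightarrow> x = 0" "\<forall>x\<in>S. \<exists>t. x - t *\<^sub>R q \<in> span P"
    by (rule lorentz_split[OF bil sig])
  from bspec[OF P(5) e(1)] obtain s where s: "e - s *\<^sub>R q \<in> span P" ..
  from bspec[OF P(5) x(1)] obtain t where t: "x - t *\<^sub>R q \<in> span P" ..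
  have s0: "s \<noteq> 0"
  proof
    assume "s = 0"
    then have "e \<in> span P" using s by simp
    from bspec[OF P(4) this] e(2,3) show False by simp
  qed
  have "(x - t *\<^sub>R q) - (t / s) *\<^sub>R (e - s *\<^sub>R q) = x - (t / s) *\<^sub>R e"
    using s0 by (simp add: scaleR_right_diff_distrib)
  with span_diff[OF t span_scale[OF s, of "t / s"]]
  have y: "x - (t / s) *\<^sub>R e \<in> span P" by (simp only:)
  have "b e x = 0" using sym[of e x] x(2) by simp
  then have "b (x - (t / s) *\<^sub>R e) (x - (t / s) *\<^sub>R e) = 0"
    using e(3) x(2,3)
    by (simp add: bilinear_lsub[OF bil] bilinear_rsub[OF bil] bilinear_lmul[OF bil] bilinear_rmul[OF bil])
  with bspec[OF P(4) y] have "x = (t / s) *\<^sub>R e" by simp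
  then show ?thesis by (simp add: span_base span_scale)
qed

lemma lorentz_orthogonal_definite:
  fixes b :: "'e::real_vector \<Rightarrow> 'e \<Rightarrow> real"
  assumes bil: "bilinear b" and sig: "has_signature b UNIV p 1" and sym: "\<And>x y. b x y = b y x"
    and q: "b q q < 0" and y: "b y q = 0" "b y y \<le> 0"
  shows "y = 0"
proof -
  obtain P r where P': "r \<in> UNIV" "b r r < 0" "\<forall>x\<in>span P. b x x \<ge> 0"
    "\<forall>x\<in>span P. b x x = 0 \<longrightarrow> x = 0" "\<forall>x\<in>UNIV. \<exists>t. x - t *\<^sub>R r \<in> span P"
    by (rule lorentz_split[OF bil sig])
  note P = P'(2-4)[rule_format] and split = P'(5)
  from bspec[OF split UNIV_I] obtain s where s: "q - s *\<^sub>R r \<in> span P" ..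
  from bspec[OF split UNIV_I] obtain t where t: "y - t *\<^sub>R r \<in> span P" ..
  have s0: "s \<noteq> 0"
  proof
    assume "s = 0"
    then have "q \<in> span P" using s by simp
    then show False using P(2)[of q] q by simp
  qed
  have "(y - t *\<^sub>R r) - (t / s) *\<^sub>R (q - s *\<^sub>R r) = y - (t / s) *\<^sub>R q"
    using s0 by (simp add: scaleR_right_diff_distrib)
  with span_diff[OF t span_scale[OF s, of "t / s"]]
  have z: "y - (t / s) *\<^sub>R q \<in> span P" by (simp only:)
  have "b q y = 0" using sym[of q y] y(1) by simp
  then have b: "b (y - (t / s) *\<^sub>R q) (y - (t / s) *\<^sub>R q) = b y y + (t / s) * (t / s) * b q q"
    using y(1)
    by (simp add: bilinear_lsub[OF bil] bilinear_rsub[OF bil] bilinear_lmul[OF bil] bilinear_rmul[OF bil])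
  have "(t / s) * (t / s) * b q q \<le> 0"
    using q by (intro mult_nonneg_nonpos) auto
  with b y(2) P(2)[OF z] have eq: "b (y - (t / s) *\<^sub>R q) (y - (t / s) *\<^sub>R q) = 0"
    by linarith
  then have yq: "y = (t / s) *\<^sub>R q" using P(3)[OF z] by simp
  then have "(t / s) * b q q = 0" using y(1) bilinear_lmul[OF bil, of "t / s" q q] by simp
  then show ?thesis using q yq by simp
qed

lemma orthogonal_decomposition:
  fixes b :: "'e::euclidean_space \<Rightarrow> 'e \<Rightarrow> real"
  assumes bil: "bilinear b" and S: "subspace S" and nd: "nondegenerate_on b S"
  shows "\<exists>s\<in>S. \<forall>y\<in>S. b (x - s) y = 0"
proof -
  obtain B where B': "B \<subseteq> S" "independent B" "S \<subseteq> span B" "card B = dim S"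
    by (rule basis_exists)
  note B = B'(1-3) independent_imp_finite[OF B'(2)]
  have SB: "span B = S" using span_minimal[OF B(1) S] B(3) by (rule subset_antisym)
  have lin: "linear (\<lambda>x. b x y)" "linear (b y)" for y using bil by (auto simp: bilinear_def)
  define G where "G a = (\<Sum>i\<in>B. b a i *\<^sub>R i)" for a
  have linG: "linear G"
    unfolding G_def
    by (rule linearI)
      (simp_all add: linear_add[OF lin(1)] linear_scale[OF lin(1)] scaleR_add_left sum.distrib scaleR_right.sum)
  have GS: "G a \<in> S" for a
    unfolding G_def using B(1) S by (intro subspace_sum subspace_scale) auto
  have zero: "b a y = 0" if Ga: "G a = 0" and y: "y \<in> S" for a y
  proof -
    have "b a i = 0" if "i \<in> B" for i
      using independentD[OF B(2,4) subset_refl _ that, of "b a"] Ga by (simp add: G_def)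
    moreover obtain u where "y = (\<Sum>v\<in>B. u v *\<^sub>R v)"
      using y unfolding SB[symmetric] span_finite[OF B(4)] by blast
    ultimately show ?thesis by (simp add: linear_sum[OF lin(2)] linear_scale[OF lin(2)])
  qed
  have "inj_on G S"
  proof (rule inj_onI)
    fix a a' assume a: "a \<in> S" "a' \<in> S" "G a = G a'"
    then have "G (a - a') = 0" by (simp add: linear_diff[OF linG])
    then have "a - a' = 0"
      using nd zero[of "a - a'"] subspace_diff[OF S a(1,2)] unfolding nondegenerate_on_def by blast
    then show "a = a'" by simp
  qed
  then have "dim (G ` S) = dim S"
    using dim_image_eq[OF linG, of S] S by (simp add: span_eq_iff[THEN iffD2])
  then have "G ` S = S"
    using GS by (intro subspace_dim_equal linear_subspace_image[OF linG] S) auto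
  then have "G x \<in> G ` S" using GS by simp
  then obtain s where s: "G x = G s" "s \<in> S" by (rule imageE)
  then have "G (x - s) = 0" by (simp add: linear_diff[OF linG])
  then show ?thesis using s(2) zero by blast
qed

locale go_algebra =
  fixes br :: "'e::euclidean_space \<Rightarrow> 'e \<Rightarrow> 'e" and ip :: "'e \<Rightarrow> 'e \<Rightarrow> real"
  assumes bil_br: "bilinear br" and antisym: "br u v = - br v u"
    and jacobi: "br u (br v w) = br (br u v) w + br v (br u w)"
    and nilpotent: "\<exists>k. upper_central br k = UNIV"
    and bil: "bilinear ip" and sym: "ip u v = ip v u"
    and go: "\<exists>D k. linear D \<and> (\<forall>u v. D (br u v) = br (D u) v + br u (D v)) \<and>
      (\<forall>u v. ip (D u) v = - ip u (D v)) \<and> (\<forall>w. ip T (br T w) = ip (D T) w + k * ip T w)"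
begin

lemmas br_simps = bilinear_ladd[OF bil_br] bilinear_radd[OF bil_br] bilinear_lmul[OF bil_br]
  bilinear_rmul[OF bil_br] bilinear_lsub[OF bil_br] bilinear_rsub[OF bil_br]
  bilinear_lzero[OF bil_br] bilinear_rzero[OF bil_br] bilinear_lneg[OF bil_br] bilinear_rneg[OF bil_br]

lemmas ip_simps = bilinear_ladd[OF bil] bilinear_radd[OF bil] bilinear_lmul[OF bil]
  bilinear_rmul[OF bil] bilinear_lsub[OF bil] bilinear_rsub[OF bil]
  bilinear_lzero[OF bil] bilinear_rzero[OF bil] bilinear_lneg[OF bil] bilinear_rneg[OF bil]

abbreviation "L \<equiv> derived_algebra br"

lemma br_self [simp]: "br u u = 0"
proof -
  have "2 *\<^sub>R br u u = 0" using antisym[of u u] unfolding scaleR_2 by (metis add.right_inverse)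
  then show ?thesis by simp
qed

lemma subspace_L: "subspace L"
  by (simp add: derived_algebra_def bracket_span_def)

lemma br_L [simp]: "br u v \<in> L"
  unfolding derived_algebra_def bracket_span_def by (rule span_base) blast

lemma L_induct:
  assumes "x \<in> L" "subspace S" "\<And>u v. br u v \<in> S" shows "x \<in> S"
proof -
  have "L \<subseteq> S"
    unfolding derived_algebra_def bracket_span_def using assms(2,3) by (intro span_minimal) auto
  then show ?thesis using assms(1) by blast
qed

lemma linear_br: "linear (br u)" "linear (\<lambda>u. br u v)"
  using bil_br by (auto simp: bilinear_def)

lemma subspace_uc: "subspace (upper_central br k)"
  by (rule subspace_upper_central[OF linear_br(1)])

lemma go_eq:
  obtains D k where "linear D" "\<forall>u v. D (br u v) = br (D u) v + br u (D v)"
    "\<forall>u v. ip (D u) v = - ip u (D v)" "\<forall>w. ip T (br T w) = - ip T (D w) + k * ip T w"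
    "\<forall>x\<in>L. D x \<in> L" "k * ip T T = 0" "\<forall>x. ip x (D x) = 0"
proof -
  obtain D k where D': "linear D" "\<forall>u v. D (br u v) = br (D u) v + br u (D v)"
    "\<forall>u v. ip (D u) v = - ip u (D v)" "\<forall>w. ip T (br T w) = ip (D T) w + k * ip T w"
    using go[of T] by blast
  note D = D'[rule_format]
  have D4: "ip T (br T w) = - ip T (D w) + k * ip T w" for w
    using D(3,4) by simp
  have DL: "D x \<in> L" if "x \<in> L" for x
  proof -
    have "x \<in> D -` L"
    proof (rule L_induct[OF that])
      show "subspace (D -` L)" by (rule linear_subspace_vimage[OF D(1) subspace_L])
      show "br u v \<in> D -` L" for u v
        by (simp add: D(2) subspace_add[OF subspace_L])
    qed
    then show ?thesis by simp
  qed
  have skew0: "ip x (D x) = 0" for x using D(3)[of x x] sym[of x "D x"] by simp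
  have "k * ip T T = 0" using D4[of T] skew0[of T] by (simp add: ip_simps)
  then show thesis using D4 DL skew0 by (intro that[OF D'(1-3)]) blast+
qed

lemma nilpotent_iterate: "\<exists>k. \<forall>u x. (br u ^^ k) x = 0"
proof -
  obtain k where k: "upper_central br k = UNIV" using nilpotent by blast
  have "(br u ^^ j) x = 0" if "x \<in> upper_central br j" for u x j
    using that by (induction j arbitrary: x) (auto simp: funpow_swap1 simp del: funpow.simps(2) simp add: funpow_Suc_right)
  then show ?thesis using k by blast
qed

lemma eigen_zero:
  assumes "br u x = m *\<^sub>R x" shows "br u x = 0"
proof -
  obtain k where k: "(br u ^^ k) x = 0" using nilpotent_iterate by blast
  have "(br u ^^ j) x = m ^ j *\<^sub>R x" for j
    by (induction j) (auto simp: br_simps assms)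
  with k have "m ^ k *\<^sub>R x = 0" by simp
  then show ?thesis using assms by auto
qed

text \<open>
  If \<open>M + Z\<^sub>k\<^sub>+\<^sub>1\<close> is everything, \<open>Z\<close> being the upper central series, then all brackets lie in
  \<open>M + Z\<^sub>k\<close>, which is therefore also everything. Descend to \<open>Z\<^sub>0 = 0\<close>.
\<close>

lemma subalgebra_generating:
  assumes M: "subspace M" "\<And>u v. u \<in> M \<Longrightarrow> v \<in> M \<Longrightarrow> br u v \<in> M"
    and gen: "\<And>x. \<exists>m\<in>M. x - m \<in> L"
  shows "M = UNIV"
proof -
  obtain K where K: "upper_central br K = UNIV" using nilpotent by blast
  let ?Z = "upper_central br"
  define W where "W k = {x + y | x y. x \<in> M \<and> y \<in> ?Z k}" for k
  have sW: "subspace (W k)" for k unfolding W_def by (rule subspace_sums[OF M(1) subspace_uc])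
  have "W k = UNIV \<Longrightarrow> W 0 = UNIV" for k
  proof (induction k)
    case (Suc k)
    have mono: "x \<in> W k" if "x \<in> M \<or> x \<in> ?Z k" for x
      using that subspace_0[OF M(1)] subspace_0[OF subspace_uc[of k]] unfolding W_def
      by (metis (mono_tags, lifting) add_0 add.right_neutral mem_Collect_eq)
    have brW: "br u v \<in> W k" for u v
    proof -
      have "u \<in> W (Suc k)" "v \<in> W (Suc k)" using Suc.prems by auto
      then obtain a b a' b' where ab: "u = a + b" "a \<in> M" "b \<in> ?Z (Suc k)"
        "v = a' + b'" "a' \<in> M" "b' \<in> ?Z (Suc k)"
        unfolding W_def by blast
      have z: "br x b \<in> ?Z k" "br x b' \<in> ?Z k" for x using ab(3,6) by auto
      have eq: "br u v = br a a' + (br a b' + (br b b' - br a' b))"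
        using antisym[of b a'] by (simp add: ab(1,4) br_simps)
      show ?thesis
        unfolding eq using z M(2)[OF ab(2,5)]
        by (intro subspace_add[OF sW] subspace_diff[OF sW] mono) auto
    qed
    have "x \<in> W k" for x
    proof -
      obtain m where m: "m \<in> M" "x - m \<in> L" using gen by blast
      have "x - m \<in> W k" by (rule L_induct[OF m(2) sW brW])
      then have "m + (x - m) \<in> W k" using m(1) mono by (intro subspace_add[OF sW]) auto
      then show ?thesis by simp
    qed
    then show ?case using Suc.IH by blast
  qed auto
  moreover have "W K = UNIV"
    using K subspace_0[OF M(1)] unfolding W_def by (auto intro: exI[of _ 0])
  ultimately have "W 0 = UNIV" by blast
  then show ?thesis unfolding W_def by auto
qed

end

locale go_algebra_nondeg = go_algebra +
  assumes nonnull_span: "\<exists>B. span B = L \<and> (\<forall>x\<in>B. ip x x \<noteq> 0)"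
    and nondeg_L: "nondegenerate_on ip L"
begin

lemma L_split: "\<exists>z\<in>L. \<forall>y\<in>L. ip (x - z) y = 0"
  using orthogonal_decomposition[OF bil subspace_L nondeg_L] by blast

lemma L_zeroI: "x \<in> L \<Longrightarrow> (\<And>y. y \<in> L \<Longrightarrow> ip x y = 0) \<Longrightarrow> x = 0"
  using nondeg_L unfolding nondegenerate_on_def by blast

lemma quadratic_nonnull:
  assumes Y: "\<And>z. z \<in> L \<Longrightarrow> ip Y z = 0" and Z: "Z \<in> L" "ip Z Z \<noteq> 0"
  shows "ip Z (br Y Z) = 0"
proof -
  have main: "ip Z (br Y Z) = 0" if Z: "Z \<in> L" and ne: "ip Y Y + ip Z Z \<noteq> 0" for Z
  proof -
    let ?T = "Y + Z"
    obtain D k where D': "linear D" "\<forall>u v. D (br u v) = br (D u) v + br u (D v)"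
      "\<forall>u v. ip (D u) v = - ip u (D v)" "\<forall>w. ip ?T (br ?T w) = - ip ?T (D w) + k * ip ?T w"
      "\<forall>x\<in>L. D x \<in> L" "k * ip ?T ?T = 0" "\<forall>x. ip x (D x) = 0"
      by (rule go_eq[of ?T])
    note D = D'(1) D'(4-7)[rule_format]
    have "ip ?T ?T = ip Y Y + ip Z Z"
      using Y[OF Z] sym[of Z Y] by (simp add: ip_simps)
    then have "k = 0" using D(4) ne by simp
    then show ?thesis
      using D(2)[of Z] Y[OF D(3)[OF Z]] D(5)[of Z] Y[of "br Y Z"] by (simp add: ip_simps br_simps)
  qed
  show ?thesis
  proof (cases "ip Y Y + ip Z Z = 0")
    case True
    then have "ip Y Y + ip (2 *\<^sub>R Z) (2 *\<^sub>R Z) \<noteq> 0" using Z(2) by (simp add: ip_simps)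
    from main[OF _ this] show ?thesis
      using subspace_scale[OF subspace_L Z(1)] by (simp add: ip_simps br_simps)
  qed (use main Z in blast)
qed

lemma quadratic:
  assumes Y: "\<And>z. z \<in> L \<Longrightarrow> ip Y z = 0" and Z: "Z \<in> L"
  shows "ip Z (br Y Z) = 0"
proof (cases "ip Z Z = 0 \<and> Z \<noteq> 0")
  case True
  obtain B where B: "span B = L" "\<forall>x\<in>B. ip x x \<noteq> 0" using nonnull_span by blast
  have "B \<noteq> {}" using B(1) Z True by auto
  then obtain W where "W \<in> B" by blast
  then have W: "W \<in> L" "ip W W \<noteq> 0" using B span_base by blast+
  have QW: "ip W (br Y W) = 0" by (rule quadratic_nonnull[OF Y W])
  define p q r where "p = ip Z (br Y Z)" and "q = ip Z (br Y W) + ip W (br Y Z)" and "r = ip Z W"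
  have *: "p + t * q = 0" if "2 * r + t * ip W W \<noteq> 0" "t \<noteq> 0" for t
  proof -
    let ?X = "Z + t *\<^sub>R W"
    have "ip ?X ?X = t * (2 * r + t * ip W W)"
      using True sym[of W Z] by (simp add: ip_simps r_def algebra_simps)
    then have "ip ?X (br Y ?X) = 0"
      using that Z W(1) by (intro quadratic_nonnull[OF Y] subspace_add[OF subspace_L] subspace_scale[OF subspace_L]) auto
    moreover have "ip ?X (br Y ?X) = p + t * q"
      using QW by (simp add: ip_simps br_simps p_def q_def algebra_simps)
    ultimately show ?thesis by simp
  qed
  have "p = 0"
  proof (cases "2 * r + 1 * ip W W = 0")
    case True
    then have "2 * r + 2 * ip W W \<noteq> 0" "2 * r + 3 * ip W W \<noteq> 0" using W(2) by linarith+
    from *[OF this(1)] *[OF this(2)] show ?thesis by simp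
  next
    case F: False
    show ?thesis
    proof (cases "2 * r + 2 * ip W W = 0")
      case True
      then have "2 * r + 3 * ip W W \<noteq> 0" using W(2) by linarith
      from *[OF this] *[OF F] show ?thesis by simp
    next
      case False
      from *[OF this] *[OF F] show ?thesis by simp
    qed
  qed
  then show ?thesis by (simp add: p_def)
next
  case False
  then show ?thesis using quadratic_nonnull[OF Y Z] by (auto simp: ip_simps)
qed

lemma skew: "X \<in> L \<Longrightarrow> X' \<in> L \<Longrightarrow> ip (br Y X) X' = - ip X (br Y X')"
proof -
  define M where "M = {Y. \<forall>X\<in>L. \<forall>X'\<in>L. ip (br Y X) X' = - ip X (br Y X')}"
  have "M = UNIV"
  proof (rule subalgebra_generating)
    show "subspace M" unfolding M_def subspace_def by (auto simp: br_simps ip_simps)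
    show "br u v \<in> M" if uv: "u \<in> M" "v \<in> M" for u v
    proof -
      have "br (br u v) x = br u (br v x) - br v (br u x)" for x
        using jacobi[of u v x] by simp
      then show ?thesis using uv unfolding M_def by (auto simp: ip_simps)
    qed
    fix x
    obtain z where z: "z \<in> L" "\<And>y. y \<in> L \<Longrightarrow> ip (x - z) y = 0" using L_split by blast
    let ?y = "x - z"
    have "ip (br ?y X) X' = - ip X (br ?y X')" if X: "X \<in> L" "X' \<in> L" for X X'
      using quadratic[of ?y, OF z(2) subspace_add[OF subspace_L X]] quadratic[of ?y, OF z(2) X(1)]
        quadratic[of ?y, OF z(2) X(2)] sym[of "br ?y X" X']
      by (simp add: ip_simps br_simps)
    then have "?y \<in> M" unfolding M_def by blast
    then show "\<exists>m\<in>M. x - m \<in> L" using z(1) by (intro bexI[of _ ?y]) auto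
  qed
  then show "X \<in> L \<Longrightarrow> X' \<in> L \<Longrightarrow> ip (br Y X) X' = - ip X (br Y X')"
    unfolding M_def by blast
qed

lemma bracket_in_null_line:
  assumes e: "e \<in> L" "\<And>Y. br Y e = 0"
    and null: "\<And>X. X \<in> L \<Longrightarrow> ip X e = 0 \<Longrightarrow> ip X X = 0 \<Longrightarrow> X \<in> span {e}"
    and X: "X \<in> L" "ip X e = 0"
  shows "br Y X \<in> span {e}"
proof -
  let ?R = "br Y"
  have inv: "(?R ^^ j) X \<in> L \<and> ip ((?R ^^ j) X) e = 0" if "X \<in> L" "ip X e = 0" for j X
    using that by (induction j) (auto simp: skew[OF _ e(1)] e(2) ip_simps)
  obtain k where "\<forall>x. (?R ^^ k) x = 0" using nilpotent_iterate by blast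
  then have start: "(?R ^^ Suc k) X \<in> span {e}" for X
    by (simp add: br_simps span_0)
  have "\<forall>X. X \<in> L \<and> ip X e = 0 \<longrightarrow> (?R ^^ Suc k) X \<in> span {e} \<Longrightarrow>
      \<forall>X. X \<in> L \<and> ip X e = 0 \<longrightarrow> (?R ^^ Suc 0) X \<in> span {e}" for k
  proof (induction k)
    case (Suc k)
    have "(?R ^^ Suc k) X \<in> span {e}" if X: "X \<in> L" "ip X e = 0" for X
    proof (rule null)
      show "(?R ^^ Suc k) X \<in> L" "ip ((?R ^^ Suc k) X) e = 0" using inv[OF X, of "Suc k"] by auto
      obtain r where r: "(?R ^^ Suc (Suc k)) X = r *\<^sub>R e"
        using Suc.prems X unfolding span_singleton by blast
      have "ip (br Y ((?R ^^ k) X)) ((?R ^^ Suc k) X) = - ip ((?R ^^ k) X) (br Y ((?R ^^ Suc k) X))"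
        by (rule skew) (use inv[OF X, of k] inv[OF X, of "Suc k"] in auto)
      also have "\<dots> = - r * ip ((?R ^^ k) X) e" using r by (simp add: ip_simps)
      also have "\<dots> = 0" using inv[OF X, of k] by simp
      finally show "ip ((?R ^^ Suc k) X) ((?R ^^ Suc k) X) = 0" by simp
    qed
    then show ?case using Suc.IH by blast
  qed
  from this[of k] start X show ?thesis by auto
qed

lemma definite_case:
  assumes "\<And>x. x \<in> L \<Longrightarrow> ip x x = 0 \<Longrightarrow> x = 0"
  shows "X \<in> L \<Longrightarrow> br Y X = 0"
  using bracket_in_null_line[of 0 X Y] assms subspace_0[OF subspace_L] by (auto simp: br_simps ip_simps)

end

locale go_algebra_lorentz = go_algebra_nondeg +
  assumes lorentz: "lorentzian_on ip L" and not_two_step: "\<exists>Y X. X \<in> L \<and> br Y X \<noteq> 0"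
begin

definition "L2 = span {br Y X | Y X. X \<in> L}"

lemma central_element:
  obtains e where "e \<in> L2" "e \<noteq> 0" "\<forall>Y. br Y e = 0"
proof -
  obtain Y X where "X \<in> L" "br Y X \<noteq> 0" using not_two_step by blast
  then have ne: "\<exists>x. x \<in> L2 \<and> x \<noteq> 0"
    unfolding L2_def by (metis (mono_tags, lifting) mem_Collect_eq span_base)
  define Q where "Q k \<longleftrightarrow> (\<exists>x. x \<in> L2 \<and> x \<noteq> 0 \<and> x \<in> upper_central br k)" for k
  have "\<exists>k. Q k" using ne nilpotent unfolding Q_def by (metis UNIV_I)
  then have "Q (LEAST k. Q k)" by (rule LeastI_ex)
  then obtain e where e: "e \<in> L2" "e \<noteq> 0" "e \<in> upper_central br (LEAST k. Q k)"
    unfolding Q_def by blast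
  have L2_L: "L2 \<subseteq> L"
    unfolding L2_def by (rule span_minimal[OF _ subspace_L]) auto
  have "br Y e = 0" for Y
  proof (rule ccontr)
    assume n: "br Y e \<noteq> 0"
    obtain k where k: "(LEAST k. Q k) = Suc k"
      using e(2,3) by (cases "LEAST k. Q k") auto
    then have "br Y e \<in> upper_central br k" using e(3) by simp
    moreover have "br Y e \<in> L2" unfolding L2_def using e(1) L2_L by (blast intro: span_base)
    ultimately have "Q k" using n unfolding Q_def by blast
    then have "(LEAST k. Q k) \<le> k" by (rule Least_le)
    then show False using k by simp
  qed
  then show thesis using that e by blast
qed

lemma L2_orthogonal:
  assumes "e \<in> L" "\<And>Y. br Y e = 0" and X: "X \<in> L2"
  shows "ip X e = 0"
proof -
  have "{br Y X | Y X. X \<in> L} \<subseteq> {x. ip x e = 0}"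
    by (auto simp: skew[OF _ assms(1)] assms(2) ip_simps)
  moreover have "subspace {x. ip x e = 0}" unfolding subspace_def by (auto simp: ip_simps)
  ultimately have "L2 \<subseteq> {x. ip x e = 0}" unfolding L2_def by (rule span_minimal)
  then show ?thesis using X by blast
qed

lemma null_frame:
  obtains e f where "e \<in> L" "e \<noteq> 0" "\<forall>Y. br Y e = 0" "f \<in> L" "ip e f = 1"
    "\<forall>X\<in>L. \<forall>Y. ip (br Y X) e = 0" "\<forall>Y. ip f (br Y f) = 0" "\<forall>Z\<in>L. \<forall>X\<in>L. br Z X = 0"
    "\<forall>X\<in>L. \<forall>Y. br Y X = ip X e *\<^sub>R br Y f - ip X (br Y f) *\<^sub>R e"
proof -
  obtain e where e': "e \<in> L2" "e \<noteq> 0" "\<forall>Y. br Y e = 0" by (rule central_element)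
  note e = e'[rule_format]
  have "L2 \<subseteq> L" unfolding L2_def by (rule span_minimal[OF _ subspace_L]) auto
  with e have eL: "e \<in> L" by blast
  note orth = L2_orthogonal[OF eL e(3)]
  have ee: "ip e e = 0" by (rule orth[OF e(1)])
  have brL2: "br Y X \<in> L2" if "X \<in> L" for Y X
    unfolding L2_def using that by (blast intro: span_base)
  have orth': "ip (br Y X) e = 0" if "X \<in> L" for Y X by (rule orth[OF brL2[OF that]])
  obtain g where g: "g \<in> L" "ip e g \<noteq> 0" using L_zeroI[OF eL] e(2) by blast
  define f where "f = (1 / ip e g) *\<^sub>R g"
  have f: "f \<in> L" "ip e f = 1"
    using g subspace_scale[OF subspace_L] by (auto simp: f_def ip_simps)
  have fe: "ip f e = 1" using f(2) sym[of f e] by simp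
  have line: "br Y X \<in> span {e}" if "X \<in> L" "ip X e = 0" for X Y
    by (rule bracket_in_null_line[OF eL e(3) _ that])
      (use lorentz_null[OF bil _ sym eL e(2) ee] lorentz in \<open>auto simp: lorentzian_on_def\<close>)
  have ff: "ip f (br Y f) = 0" for Y
    using skew[OF f(1) f(1), of Y] sym[of f "br Y f"] by simp
  have comm0: "br (br S T) X = 0" if X: "X \<in> L" "ip X e \<noteq> 0" for S T X
  proof -
    have "br (br S T) X = br S (br T X) - br T (br S X)" using jacobi[of S T X] by simp
    also have "\<dots> \<in> span {e}"
      by (intro span_diff line) (use X(1) orth' in auto)
    finally obtain m where m: "br (br S T) X = m *\<^sub>R e" unfolding span_singleton by blast
    have "ip (br (br S T) X) X = 0"
      using skew[OF X(1) X(1), of "br S T"] sym[of X "br (br S T) X"] by simp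
    then have "m = 0" using X(2) sym[of X e] by (simp add: m ip_simps)
    then show ?thesis by (simp add: m)
  qed
  have comm1: "br (br S T) X = 0" if X: "X \<in> L" for S T X
  proof (cases "ip X e = 0")
    case True
    have "br (br S T) (X + f) = 0"
      using True fe f X by (intro comm0 subspace_add[OF subspace_L]) (auto simp: ip_simps)
    moreover have "br (br S T) f = 0" using fe f by (intro comm0) auto
    ultimately show ?thesis by (simp add: br_simps)
  qed (rule comm0[OF X])
  have comm: "br Z X = 0" if "Z \<in> L" "X \<in> L" for Z X
  proof -
    have "Z \<in> {Z. br Z X = 0}"
      by (rule L_induct[OF that(1)]) (auto simp: subspace_def br_simps comm1[OF that(2)])
    then show ?thesis by simp
  qed
  have formula: "br Y X = ip X e *\<^sub>R br Y f - ip X (br Y f) *\<^sub>R e" if X: "X \<in> L" for X Y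
  proof -
    define X0 where "X0 = X - ip X e *\<^sub>R f"
    have X0: "X0 \<in> L" "ip X0 e = 0"
      using X f fe subspace_diff[OF subspace_L] subspace_scale[OF subspace_L]
      by (auto simp: X0_def ip_simps)
    obtain m where m: "br Y X0 = m *\<^sub>R e" using line[OF X0] unfolding span_singleton by blast
    have "m = ip (br Y X0) f" using f(2) by (simp add: m ip_simps)
    also have "\<dots> = - ip X0 (br Y f)" by (rule skew[OF X0(1) f(1)])
    also have "\<dots> = - ip X (br Y f)" by (simp add: X0_def ip_simps ff)
    finally have "br Y X0 = - ip X (br Y f) *\<^sub>R e" using m by simp
    moreover have "br Y X = ip X e *\<^sub>R br Y f + br Y X0" by (simp add: X0_def br_simps)
    ultimately show ?thesis by simp
  qed
  show thesis
    by (rule that[OF eL e'(2,3) f]) (use orth' ff comm formula in blast)+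
qed

lemma L_abelian: "Z \<in> L \<Longrightarrow> X \<in> L \<Longrightarrow> br Z X = 0"
proof -
  assume ZX: "Z \<in> L" "X \<in> L"
  obtain e f where "e \<in> L" "e \<noteq> 0" "\<forall>Y. br Y e = 0" "f \<in> L" "ip e f = 1"
    "\<forall>X\<in>L. \<forall>Y. ip (br Y X) e = 0" "\<forall>Y. ip f (br Y f) = 0" "\<forall>Z\<in>L. \<forall>X\<in>L. br Z X = 0"
    "\<forall>X\<in>L. \<forall>Y. br Y X = ip X e *\<^sub>R br Y f - ip X (br Y f) *\<^sub>R e"
    by (rule null_frame)
  then show "br Z X = 0" using ZX by blast
qed

lemma centralizer_degenerate:
  assumes nd: "nondegenerate_on ip (centralizer_of br L)"
  shows False
proof -
  obtain e f where nf: "e \<in> L" "e \<noteq> 0" "\<forall>Y. br Y e = 0" "f \<in> L" "ip e f = 1"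
    "\<forall>X\<in>L. \<forall>Y. ip (br Y X) e = 0" "\<forall>Y. ip f (br Y f) = 0" "\<forall>Z\<in>L. \<forall>X\<in>L. br Z X = 0"
    "\<forall>X\<in>L. \<forall>Y. br Y X = ip X e *\<^sub>R br Y f - ip X (br Y f) *\<^sub>R e"
    by (rule null_frame)
  note e = nf(1-3)[rule_format] and f = nf(4,5) and orth = nf(6)[rule_format]
    and ff = nf(7)[rule_format] and formula = nf(9)[rule_format]
  let ?c = "centralizer_of br L"
  have c_def: "x \<in> ?c \<longleftrightarrow> (\<forall>y\<in>L. br x y = 0)" for x by (simp add: centralizer_of_def)
  have sc: "subspace ?c" unfolding centralizer_of_def subspace_def by (auto simp: br_simps)
  have Lc: "x \<in> ?c" if "x \<in> L" for x using that L_abelian by (auto simp: c_def)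
  have cf: "Y \<in> ?c" if "br Y f = 0" for Y
    using formula[of _ Y] that unfolding c_def by (simp add: ip_simps)
  have line0: "br Y f = 0" if "br Y f = m *\<^sub>R e" for Y m
    using ff[of Y] f(2) sym[of f e] that by (simp add: ip_simps)
  have from_formula: "ip X e = 0 \<or> br Y f = 0" if "X \<in> L" "br Y X = 0" for X Y
  proof (rule disjCI)
    assume n: "br Y f \<noteq> 0"
    show "ip X e = 0"
    proof (rule ccontr)
      assume nz: "ip X e \<noteq> 0"
      have "ip X e *\<^sub>R br Y f = ip X (br Y f) *\<^sub>R e" using formula[OF that(1), of Y] that(2) by simp
      then have "(1 / ip X e) *\<^sub>R ip X e *\<^sub>R br Y f = (1 / ip X e) *\<^sub>R ip X (br Y f) *\<^sub>R e" by simp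
      then have "br Y f = (ip X (br Y f) / ip X e) *\<^sub>R e" using nz by simp
      then show False using line0 n by blast
    qed
  qed
  define u where "u = {Y. \<forall>X\<in>?c. ip Y X = 0}"
  have su: "subspace u" unfolding u_def subspace_def by (auto simp: ip_simps)
  have cu: "Y = 0" if "Y \<in> ?c" "Y \<in> u" for Y
    using that nd unfolding u_def nondegenerate_on_def by blast
  have split: "\<exists>x\<in>?c. a - x \<in> u" for a
    using orthogonal_decomposition[OF bil sc nd, of a] unfolding u_def by blast
  have uL: "ip Y Z = 0" if "Y \<in> u" "Z \<in> L" for Y Z
    using that Lc unfolding u_def by blast
  have Dc: "D X \<in> ?c" if X: "X \<in> ?c" and D: "\<And>u v. D (br u v) = br (D u) v + br u (D v)"
    "linear D" "\<And>x. x \<in> L \<Longrightarrow> D x \<in> L" for D X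
  proof -
    have "br (D X) y = 0" if "y \<in> L" for y
      using D(1)[of X y] D(3)[OF that] X that linear_0[OF D(2)] unfolding c_def by simp
    then show ?thesis by (simp add: c_def)
  qed
  have ux: "br Y X = 0" if Y: "Y \<in> u" and X: "X \<in> ?c" "\<And>z. z \<in> L \<Longrightarrow> ip X z = 0" for Y X
  proof (rule L_zeroI)
    fix Z assume Z: "Z \<in> L"
    let ?T = "Y + Z"
    obtain D k where D': "linear D" "\<forall>u v. D (br u v) = br (D u) v + br u (D v)"
      "\<forall>u v. ip (D u) v = - ip u (D v)" "\<forall>w. ip ?T (br ?T w) = - ip ?T (D w) + k * ip ?T w"
      "\<forall>x\<in>L. D x \<in> L" "k * ip ?T ?T = 0" "\<forall>x. ip x (D x) = 0"
      by (rule go_eq[of ?T])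
    note D = D'(2)[rule_format] D'(1) D'(3-5)[rule_format]
    have DX: "D X \<in> ?c" by (rule Dc[OF X(1) D(1,2,5)])
    have "br Z X = 0" using X(1) Z antisym[of Z X] unfolding c_def by simp
    moreover have "ip Y (D X) = 0" using Y DX unfolding u_def by blast
    moreover have "ip Z (D X) = 0"
      using D(3)[of Z X] X(2)[OF D(5)[OF Z]] sym[of "D Z" X] by simp
    moreover have "ip Y X = 0" using Y X(1) unfolding u_def by blast
    moreover have "ip Z X = 0" using X(2)[OF Z] sym by metis
    moreover have "ip Y (br Y X) = 0" by (rule uL[OF Y br_L])
    ultimately have "ip Z (br Y X) = 0"
      using D(4)[of X] by (simp add: ip_simps br_simps)
    then show "ip (br Y X) Z = 0" using sym by metis
  qed simp
  obtain Y0 where Y0: "br Y0 f \<noteq> 0"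
    using not_two_step cf unfolding c_def by metis
  have xx: "ip (br x1 x2) e = 0"
    if x: "x1 \<in> ?c" "x2 \<in> ?c" "\<And>z. z \<in> L \<Longrightarrow> ip x1 z = 0" "\<And>z. z \<in> L \<Longrightarrow> ip x2 z = 0" for x1 x2
  proof -
    have "br Y (br x1 x2) = 0" for Y
    proof -
      obtain y where y: "y \<in> ?c" "Y - y \<in> u" using split by blast
      have "br (Y - y) (br x1 x2) = 0"
        using jacobi[of "Y - y" x1 x2] ux[OF y(2) x(1,3)] ux[OF y(2) x(2,4)] by (simp add: br_simps)
      moreover have "br y (br x1 x2) = 0" using y(1) unfolding c_def by simp
      ultimately show ?thesis by (simp add: br_simps)
    qed
    then show ?thesis using from_formula[of "br x1 x2" Y0] Y0 by simp
  qed
  have "\<exists>Y1\<in>u. \<exists>Y2\<in>u. ip (br Y1 Y2) e \<noteq> 0"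
  proof (rule ccontr)
    assume "\<not> ?thesis"
    then have uu: "ip (br Y1 Y2) e = 0" if "Y1 \<in> u" "Y2 \<in> u" for Y1 Y2 using that by blast
    have dec: "\<exists>y x z. a = y + x + z \<and> y \<in> u \<and> x \<in> ?c \<and> (\<forall>z\<in>L. ip x z = 0) \<and> z \<in> L" for a
    proof -
      obtain w where w: "w \<in> ?c" "a - w \<in> u" using split by blast
      obtain z where z: "z \<in> L" "\<And>y. y \<in> L \<Longrightarrow> ip (w - z) y = 0" using L_split by blast
      have "w - z \<in> ?c" using w(1) Lc[OF z(1)] by (rule subspace_diff[OF sc])
      then show ?thesis
        using w(2) z by (intro exI[of _ "a - w"] exI[of _ "w - z"] exI[of _ z]) auto
    qed
    have "ip (br a b) e = 0" for a b
    proof -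
      obtain y x z where a: "a = y + x + z" "y \<in> u" "x \<in> ?c" "\<forall>z\<in>L. ip x z = 0" "z \<in> L"
        using dec by blast
      obtain y' x' z' where b: "b = y' + x' + z'" "y' \<in> u" "x' \<in> ?c" "\<forall>z\<in>L. ip x' z = 0" "z' \<in> L"
        using dec by blast
      have "ip (br z v) e = 0" for v
        using orth[OF a(5), of v] antisym[of z v] by (simp add: ip_simps)
      moreover have "ip (br v z') e = 0" for v using orth[OF b(5)] .
      moreover have "br y x' = 0" using ux[OF a(2) b(3)] b(4) by blast
      moreover have "br x y' = 0" using ux[OF b(2) a(3)] a(4) antisym[of x y'] by simp
      moreover have "ip (br x x') e = 0" using xx[OF a(3) b(3)] a(4) b(4) by blast
      ultimately show ?thesis
        using uu[OF a(2) b(2)] by (simp add: a(1) b(1) br_simps ip_simps)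
    qed
    then have "f \<in> {x. ip x e = 0}"
      by (intro L_induct[OF f(1)]) (auto simp: subspace_def ip_simps)
    then show False using f(2) sym[of e f] by simp
  qed
  then obtain Y1 Y2 where Y: "Y1 \<in> u" "Y2 \<in> u" and \<omega>: "ip (br Y1 Y2) e \<noteq> 0" by blast
  have two_dim: "\<exists>a b. Y3 = a *\<^sub>R Y1 + b *\<^sub>R Y2" if Y3: "Y3 \<in> u" for Y3
  proof -
    let ?w = "ip (br Y1 Y2) e" and ?w1 = "ip (br Y2 Y3) e" and ?w2 = "ip (br Y3 Y1) e"
    let ?V = "?w *\<^sub>R Y3 + ?w1 *\<^sub>R Y1 + ?w2 *\<^sub>R Y2"
    let ?m = "ip (br Y1 Y2) (br Y3 f) + ip (br Y2 Y3) (br Y1 f) + ip (br Y3 Y1) (br Y2 f)"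
    have "br Y3 (br Y1 Y2) + br Y1 (br Y2 Y3) + br Y2 (br Y3 Y1) = 0"
    proof -
      have "br Y1 (br Y2 Y3) = br (br Y1 Y2) Y3 + br Y2 (br Y1 Y3)" by (rule jacobi)
      then show ?thesis
        using antisym[of "br Y1 Y2" Y3] antisym[of Y3 Y1] by (simp add: br_simps)
    qed
    then have "br ?V f = ?m *\<^sub>R e"
      unfolding formula[OF br_L, of Y3 Y1 Y2] formula[OF br_L, of Y1 Y2 Y3] formula[OF br_L, of Y2 Y3 Y1]
      by (simp add: br_simps algebra_simps)
    then have "br ?V f = 0" by (rule line0)
    moreover have "?V \<in> u"
      using Y Y3 by (intro subspace_add[OF su] subspace_scale[OF su])
    ultimately have "?V = 0" using cu cf by blast
    then have "?w *\<^sub>R Y3 = - (?w1 *\<^sub>R Y1) - ?w2 *\<^sub>R Y2"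
      by (simp add: add_eq_0_iff2 algebra_simps)
    then have "(1 / ?w) *\<^sub>R (?w *\<^sub>R Y3) = (1 / ?w) *\<^sub>R (- (?w1 *\<^sub>R Y1) - ?w2 *\<^sub>R Y2)" by (simp only:)
    then have "Y3 = (- ?w1 / ?w) *\<^sub>R Y1 + (- ?w2 / ?w) *\<^sub>R Y2"
      using \<omega> by (simp add: scaleR_right_diff_distrib)
    then show ?thesis by blast
  qed
  define F where "F = br Y1 Y2"
  have FL: "F \<in> L" by (simp add: F_def)
  let ?T = "Y1 + F"
  obtain D k where D': "linear D" "\<forall>u v. D (br u v) = br (D u) v + br u (D v)"
    "\<forall>u v. ip (D u) v = - ip u (D v)" "\<forall>w. ip ?T (br ?T w) = - ip ?T (D w) + k * ip ?T w"
    "\<forall>x\<in>L. D x \<in> L" "k * ip ?T ?T = 0" "\<forall>x. ip x (D x) = 0"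
    by (rule go_eq[of ?T])
  note D = D'(2)[rule_format] D'(1) D'(3-5)[rule_format]
  have Du: "D Z \<in> u" if "Z \<in> u" for Z
    using that Dc[OF _ D(1,2,5)] D(3) unfolding u_def by simp
  obtain a1 a2 b1 b2 where DY: "D Y1 = a1 *\<^sub>R Y1 + a2 *\<^sub>R Y2" "D Y2 = b1 *\<^sub>R Y1 + b2 *\<^sub>R Y2"
    using two_dim[OF Du[OF Y(1)]] two_dim[OF Du[OF Y(2)]] by blast
  have DF: "D F = (a1 + b2) *\<^sub>R F"
    by (simp add: F_def D(1) DY br_simps scaleR_add_left)
  have "br Y1 F + (a1 + b2 + k) *\<^sub>R F = 0"
  proof (rule L_zeroI)
    show "br Y1 F + (a1 + b2 + k) *\<^sub>R F \<in> L"
      using FL by (intro subspace_add[OF subspace_L] subspace_scale[OF subspace_L]) auto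
    fix X assume X: "X \<in> L"
    have "br F X = 0" by (rule L_abelian[OF FL X])
    moreover have "ip Y1 (br Y1 X) = 0" "ip Y1 (D X) = 0" "ip Y1 X = 0"
      using uL[OF Y(1)] X D(5) by auto
    moreover have "ip F (br Y1 X) = - ip (br Y1 F) X"
      using skew[OF FL X, of Y1] by simp
    moreover have "ip F (D X) = - ((a1 + b2) * ip F X)"
      using D(3)[of F X] by (simp add: DF ip_simps)
    ultimately show "ip (br Y1 F + (a1 + b2 + k) *\<^sub>R F) X = 0"
      using D(4)[of X] by (simp add: ip_simps br_simps algebra_simps)
  qed
  then have "br Y1 F = (- (a1 + b2 + k)) *\<^sub>R F"
    unfolding scaleR_minus_left by (simp add: add_eq_0_iff2)
  then have "br Y1 F = 0" by (rule eigen_zero)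
  then have "br Y1 f = 0" using from_formula[OF FL, of Y1] \<omega> by (simp add: F_def)
  then have "Y1 = 0" using cf cu Y(1) by blast
  then show False using \<omega> by (simp add: br_simps ip_simps)
qed

end

context go_algebra
begin

lemma derived_algebra_central:
  assumes "definite_on ip L \<or> (lorentzian_on ip L \<and> nondegenerate_on ip (centralizer_of br L)) \<or>
    (lorentzian_on ip UNIV \<and> lorentzian_on ip L)"
  shows "X \<in> L \<Longrightarrow> br Y X = 0"
proof -
  obtain p q where sig: "has_signature ip L p q"
    using assms unfolding definite_on_def lorentzian_on_def by blast
  interpret go_algebra_nondeg br ip
  proof unfold_locales
    show "\<exists>B. span B = L \<and> (\<forall>x\<in>B. ip x x \<noteq> 0)" by (rule has_signature_basis[OF sig]) blast
    show "nondegenerate_on ip L" by (rule has_signature_nondegenerate[OF bil sig])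
  qed
  show "br Y X = 0" if XL: "X \<in> L"
  proof (cases "definite_on ip L")
    case True
    have "x = 0" if x: "x \<in> L" "ip x x = 0" for x
    proof -
      consider "has_signature ip L (dim L) 0" | "has_signature ip L 0 (dim L)"
        using True unfolding definite_on_def by blast
      then show ?thesis
      proof cases
        case 1
        then obtain P where "finite P" "span P = L" "pairwise (\<lambda>x y. ip x y = 0) P" "\<forall>x\<in>P. ip x x > 0"
          unfolding has_signature_def by auto
        then show ?thesis using orthogonal_positive(2)[OF bil, of P x] x by simp
      next
        case 2
        then obtain P where P: "finite P" "span P = L" "pairwise (\<lambda>x y. ip x y = 0) P" "\<forall>x\<in>P. ip x x < 0"
          unfolding has_signature_def by auto
        have bn: "bilinear (\<lambda>x y. - ip x y)"
          using bil unfolding bilinear_def by (auto intro: linear_compose_neg)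
        show ?thesis
          using orthogonal_positive(2)[OF bn, of P x] P x by simp
      qed
    qed
    then show ?thesis using definite_case[OF _ XL] by blast
  next
    case False
    then have lor: "lorentzian_on ip L" using assms by blast
    show ?thesis
    proof (rule ccontr)
      assume "br Y X \<noteq> 0"
      then interpret go_algebra_lorentz br ip
        using XL lor by unfold_locales blast+
      have "nondegenerate_on ip (centralizer_of br L)" if U: "lorentzian_on ip UNIV"
        unfolding nondegenerate_on_def
      proof (intro ballI impI)
        fix x assume x: "x \<in> centralizer_of br L" "\<forall>y\<in>centralizer_of br L. ip x y = 0"
        have "ip x z = 0" if "z \<in> L" for z
          using x(2) that L_abelian unfolding centralizer_of_def by blast
        moreover obtain q where q: "q \<in> L" "ip q q < 0"
          using lor unfolding lorentzian_on_def by (rule lorentz_split[OF bil]) blast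
        ultimately show "x = 0"
          using lorentz_orthogonal_definite[OF bil _ sym q(2), of _ x] U x by (auto simp: lorentzian_on_def)
      qed
      then show False using centralizer_degenerate assms False by blast
    qed
  qed
qed

end

theorem theorem1:
  fixes N :: "'m::{t2_space, second_countable_topology} monoid"
    and A :: "('m, 'e::euclidean_space) chart set"
    and ds2 :: "('m, 'e) metric"
    and H :: "('m \<Rightarrow> 'm) set"
    and c :: "('m, 'e) chart"
  defines "br \<equiv> lie_bracket N c"
    and "ip \<equiv> ds2 c \<one>\<^bsub>N\<^esub>"
  assumes "lie_group N A"
    and "connected (UNIV :: 'm set)"
    and "nilpotent_group N"
    and "pseudo_riemannian_metric A ds2"
    and "left_invariant_metric N A ds2"
    and "subgroup H (AutoGroup N)"
    and "\<forall>h\<in>H. isometry A ds2 h"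
    and "geodesic_orbit A ds2 (semidirect N H)"
    and "c \<in> A" and "\<one>\<^bsub>N\<^esub> \<in> fst c"
    and "definite_on ip (derived_algebra br) \<or>
      (lorentzian_on ip (derived_algebra br) \<and>
        nondegenerate_on ip (centralizer_of br (derived_algebra br))) \<or>
      (lorentzian_on ip UNIV \<and> lorentzian_on ip (derived_algebra br))"
  shows "comm_group N \<or> two_step_nilpotent br"
proof -
  interpret lie_metric N A c ds2
    using assms by unfold_locales auto
  have go: "\<exists>D k. linear D \<and> (\<forall>u v. D (br u v) = br (D u) v + br u (D v)) \<and>
      (\<forall>u v. ip (D u) v = - ip u (D v)) \<and> (\<forall>w. ip T (br T w) = ip (D T) w + k * ip T w)" for T
    unfolding br_def ip_def
    by (rule geodesic_orbit_condition[OF assms(8-10), of T]) blast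
  interpret go_algebra br ip
  proof unfold_locales
    show "bilinear br" unfolding br_def bilinear_def using linear_br_left linear_br_right by blast
    show "br u v = - br v u" for u v unfolding br_def by (rule br_antisym)
    show "br u (br v w) = br (br u v) w + br v (br u w)" for u v w unfolding br_def by (rule jacobi)
    show "\<exists>k. upper_central br k = UNIV" unfolding br_def by (rule nilpotent_bracket[OF assms(5)])
    show "bilinear ip" unfolding ip_def by (rule bilinear_ip)
    show "ip u v = ip v u" for u v unfolding ip_def by (rule ip_sym)
  qed (rule go)
  have central: "br Y X = 0" if "X \<in> derived_algebra br" for X Y
    by (rule derived_algebra_central[OF assms(13) that])
  show ?thesis
  proof (cases "derived_algebra br = {0}")
    case True
    then have "lie_bracket N c u v = 0" for u v using br_L[of u v] by (simp add: br_def)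
    then show ?thesis using abelian_if_bracket_zero[OF assms(4)] by blast
  next
    case False
    have "{br x y | x y. x \<in> UNIV \<and> y \<in> derived_algebra br} \<subseteq> {0}"
      using central by blast
    then have "bracket_span br UNIV (derived_algebra br) \<subseteq> {0}"
      unfolding bracket_span_def by (rule span_minimal) (rule subspace_single_0)
    then have "bracket_span br UNIV (derived_algebra br) = {0}"
      unfolding bracket_span_def using span_0 by blast
    then show ?thesis using False by (simp add: two_step_nilpotent_def)
  qed
qed

end
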